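(* Let $K$ be a finite pre-cubical set with no loops and let $\mathfrak{F}$ be an equivalence system. Then the geometric realization $|K|$ admits: (a) a coarsest stable total $\mathfrak{F}$-component system; (b) a coarsest stable future (respectively past) $\mathfrak{F}$-component system, which is closed.
   Context: **d-spaces.** A d-space is a topological space $X$ with a set $\vec{P}_X$ of continuous paths $[0,1]\to X$ (called d-paths; topologized as a subspace of the path space with the compact-open topology) containing all constant paths $\sigma_x$, closed under concatenation $\alpha*\beta$ (for $\alpha(1)=\beta(0)$) and under precomposition with non-decreasing continuous maps $[0,1]\to[0,1]$. For $A\subseteq X$, $\vec{P}_A$ is the set of d-paths with image in $A$; $\vec{P}_A(B,C)=\{\alpha\in\vec{P}_A : \alpha(0)\in B,\ \alpha(1)\in C\}$ (points are written for singletons). Write $x\le y$ if $\vec{P}_X(x,y)\ne\emptyset$. $X$ has no loops if $\vec{P}_X(x,x)=\{\sigma_x\}$ for all $x$. $A_{\ge x}=\{y\in A: y\ge x\}$, $A_{\le x}=\{y\in A: y\le x\}$. For d-paths $\alpha,\beta$, $\vec{P}(\alpha,\beta):\vec{P}_X(\alpha(1),\beta(0))\to\vec{P}_X(\alpha(0),\beta(1))$ is the map $\omega\mapsto\alpha*\omega*\beta$. **Equivalence systems.** A family $\mathfrak{F}$ of morphisms of the category of topological spaces is an equivalence system if: (a) it satisfies 2-out-of-3; (b) if $f,g$ are homotopic then both or neither lie in $\mathfrak{F}$; (c) it contains all weak homotopy equivalences; (d) $f\in\mathfrak{F}$ implies $\pi_0(f)$ is a bijection; (e) for a finite family of maps $f_i$,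 $\coprod f_i\in\mathfrak{F}$ iff all $f_i\in\mathfrak{F}$; (f) $f,g\in\mathfrak{F}$ implies $f\times g\in\mathfrak{F}$. Members of $\mathfrak{F}$ are $\mathfrak{F}$-equivalences; two spaces are $\mathfrak{F}$-equivalent if connected by a zig-zag of $\mathfrak{F}$-equivalences; a space $Y$ is $\mathfrak{F}$-contractible if $Y\to\{*\}$ is in $\mathfrak{F}$. **Stability.** $A\subseteq X$ is d-convex if $\vec{P}_A(A,A)=\vec{P}_X(A,A)$; future connected if for all $x,y\in A$ there is $z\in A$ with $\vec{P}_A(x,z)\ne\emptyset\ne\vec{P}_A(y,z)$; past connected if for all $x,y\in A$ there is $z\in A$ with $\vec{P}_A(z,x)\ne\emptyset\ne\vec{P}_A(z,y)$. For $\alpha\in\vec{P}_X$ and $A$ future connected, $\mathrm{St}^+_{\mathfrak{F}}(\alpha;A)$ is the set of $z\in A$ such that $\vec{P}(\alpha,\beta)\in\mathfrak{F}$ for every $\beta\in\vec{P}_{A_{\ge z}}$; for $A$ past connected, $\mathrm{St}^-_{\mathfrak{F}}(A;\alpha)$ is the set of $z\in A$ such that $\vec{P}(\beta,\alpha)\in\mathfrak{F}$ for every $\beta\in\vec{P}_{A_{\le z}}$. For a point $x$ these are taken with $\alpha=\sigma_x$. For future connected $A,B$ the pair $(A,B)$ is future $\mathfrak{F}$-stable if $\mathrm{St}^+_{\mathfrak{F}}(\alpha;B)\ne\emptyset$ for all $\alpha\in\vec{P}_A$; for past connected $A,B$ it is past $\mathfrak{F}$-stable if $\mathrm{St}^-_{\mathfrak{F}}(A;\beta)\ne\emptyset$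 for all $\beta\in\vec{P}_B$. It is totally $\mathfrak{F}$-stable if it is future and past $\mathfrak{F}$-stable and there are $a\in A$, $b\in B$ with $b\in\mathrm{St}^+_{\mathfrak{F}}(a;B)$ and $a\in\mathrm{St}^-_{\mathfrak{F}}(A;b)$. If $(A,B)$ is future $\mathfrak{F}$-stable, $\mathrm{S}\vec{\mathrm{P}}^+_{\mathfrak{F}}(A,B):=\vec{P}_X(a,z)$ for any $a\in A$, $z\in\mathrm{St}^+_{\mathfrak{F}}(a;B)$ (well defined up to $\mathfrak{F}$-equivalence); if past $\mathfrak{F}$-stable, $\mathrm{S}\vec{\mathrm{P}}^-_{\mathfrak{F}}(A,B):=\vec{P}_X(z,b)$ for any $b\in B$, $z\in\mathrm{St}^-_{\mathfrak{F}}(A;b)$. **Component systems.** A future (past) connected $A$ is future (past) $\mathfrak{F}$-trivial if $(A,A)$ is future (past) $\mathfrak{F}$-stable and $\mathrm{S}\vec{\mathrm{P}}^{+}_{\mathfrak{F}}(A,A)$ (resp. $\mathrm{S}\vec{\mathrm{P}}^{-}_{\mathfrak{F}}(A,A)$) is $\mathfrak{F}$-contractible. A family $\{A_i\}_{i\in I}$ of pairwise disjoint subsets covering $X$ is a stable future (past) $\mathfrak{F}$-component system if every $A_i$ is d-convex, future (past) connected and future (past) $\mathfrak{F}$-trivial, and every pair $(A_i,A_j)$ is future (past) $\mathfrak{F}$-stable. A future (past) system is closed if every $A_i$ has a final point, i.e. $x\in A_i$ with $y\le x$ for all $y\in A_i$ (resp. an initial point, $x\in A_i$ with $x\le y$ for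 all $y\in A_i$). A stable total $\mathfrak{F}$-component system is a family that is both a stable future and a stable past $\mathfrak{F}$-component system and such that every pair $(A_i,A_j)$ is totally $\mathfrak{F}$-stable. A system $\mathcal{A}$ is coarser than $\mathcal{B}$ if every $B\in\mathcal{B}$ is contained in some $A\in\mathcal{A}$; a coarsest system (of a given kind: future, past or total) is one coarser than any other system of that kind. **Pre-cubical sets.** A pre-cubical set $K$ is a sequence of disjoint sets $(K[n])_{n\ge0}$ with face maps $d^\varepsilon_i:K[n]\to K[n-1]$, $1\le i\le n$, $\varepsilon\in\{0,1\}$, satisfying $d^\varepsilon_i d^\eta_j=d^\eta_{j-1}d^\varepsilon_i$ for $i<j$; it is finite if it has finitely many cubes in total. Let $\vec{I}^n=[0,1]^n$ with d-paths the paths non-decreasing in each coordinate. The geometric realization $|K|$ is the quotient d-space of $\coprod_n K[n]\times\vec{I}^n$ by the equivalence relation generated by $[d^\varepsilon_i(c),(t_1,\dots,t_{n-1})]\sim[c,(t_1,\dots,t_{i-1},\varepsilon,t_i,\dots,t_{n-1})]$ (with the smallest d-structure making the projection map d-paths to d-paths). $K$ has no loops if there is no non-empty sequence of $1$-cubes $e_1,\dots,e_n$ with $d^1_1(e_n)=d^0_1(e_1)$ and $d^1_1(e_i)=d^0_1(e_{i+1})$ for $1\le i<n$; equivalently, $|K|$ has no loops. *)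

theory Defs
  imports "HOL-Analysis.Analysis"
begin

section \<open>Topological preliminaries\<close>

text \<open>Functions on a subset are represented by their extensional representative, so that
  different elements of a path space are different as maps on $[0,1]$.\<close>

definition compact_open_topology :: "'a topology \<Rightarrow> 'b topology \<Rightarrow> ('a \<Rightarrow> 'b) topology" where
  "compact_open_topology X Y = topology_generated_by
     {{f \<in> extensional (topspace X). continuous_map X Y f \<and> f ` C \<subseteq> U} | C U.
        compactin X C \<and> openin Y U}"

definition quotient_topology :: "'a topology \<Rightarrow> ('a \<Rightarrow> 'b) \<Rightarrow> 'b topology" where
  "quotient_topology X q =
     topology (\<lambda>U. U \<subseteq> q ` topspace X \<and> openin X {x \<in> topspace X. q x \<in> U})"

lemma openin_quotient_topology:
  "openin (quotient_topology X q) U \<longleftrightarrow>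
     U \<subseteq> q ` topspace X \<and> openin X {x \<in> topspace X. q x \<in> U}"
proof -
  have "istopology (\<lambda>U. U \<subseteq> q ` topspace X \<and> openin X {x \<in> topspace X. q x \<in> U})"
    unfolding istopology_def
  proof (intro conjI allI impI; (elim conjE)?)
    fix S T
    assume "openin X {x \<in> topspace X. q x \<in> S}" "openin X {x \<in> topspace X. q x \<in> T}"
    then have "openin X ({x \<in> topspace X. q x \<in> S} \<inter> {x \<in> topspace X. q x \<in> T})"
      by blast
    moreover have "{x \<in> topspace X. q x \<in> S} \<inter> {x \<in> topspace X. q x \<in> T}
        = {x \<in> topspace X. q x \<in> S \<inter> T}"
      by blast
    ultimately show "openin X {x \<in> topspace X. q x \<in> S \<inter> T}"
      by simp
  next
    fix \<K>
    assume *: "\<forall>S\<in>\<K>. S \<subseteq> q ` topspace X \<and> openin X {x \<in> topspace X. q x \<in> S}"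
    have "openin X (\<Union>S\<in>\<K>. {x \<in> topspace X. q x \<in> S})"
      using * by blast
    moreover have "(\<Union>S\<in>\<K>. {x \<in> topspace X. q x \<in> S}) = {x \<in> topspace X. q x \<in> \<Union>\<K>}"
      by blast
    ultimately show "openin X {x \<in> topspace X. q x \<in> \<Union>\<K>}"
      by simp
  qed blast+
  then show ?thesis
    unfolding quotient_topology_def by (simp add: topology_inverse')
qed

lemma topspace_quotient_topology [simp]: "topspace (quotient_topology X q) = q ` topspace X"
proof
  show "topspace (quotient_topology X q) \<subseteq> q ` topspace X"
    using openin_quotient_topology[of X q] openin_topspace by blast
  have "{x \<in> topspace X. q x \<in> q ` topspace X} = topspace X"
    by blast
  then have "openin (quotient_topology X q) (q ` topspace X)"
    by (simp add: openin_quotient_topology)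
  then show "q ` topspace X \<subseteq> topspace (quotient_topology X q)"
    by (rule openin_subset)
qed

lemma quotient_map_quotient_topology: "quotient_map X (quotient_topology X q) q"
  by (auto simp: quotient_map_def openin_quotient_topology)

text \<open>The coordinates of a point of $[0,1]^n$ are numbered $1,\dots,n$.\<close>

definition unit_cube :: "nat \<Rightarrow> (nat \<Rightarrow> real) topology" where
  "unit_cube n = product_topology (\<lambda>_. top_of_set {0..1}) {1..n}"

definition cube_boundary :: "nat \<Rightarrow> (nat \<Rightarrow> real) set" where
  "cube_boundary n = {t \<in> topspace (unit_cube n). \<exists>i\<in>{1..n}. t i = 0 \<or> t i = 1}"


section \<open>Weak homotopy equivalences\<close>

text \<open>The induced map on path components: for continuous \<open>f\<close>, the union consists of a single
  path component.\<close>

definition pi0_map :: "'b topology \<Rightarrow> ('a \<Rightarrow> 'b) \<Rightarrow> 'a set \<Rightarrow> 'b set" where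
  "pi0_map Y f C = (\<Union>y \<in> f ` C. path_component_of_set Y y)"

definition pi0_bijective :: "'a topology \<Rightarrow> 'b topology \<Rightarrow> ('a \<Rightarrow> 'b) \<Rightarrow> bool" where
  "pi0_bijective X Y f \<longleftrightarrow> bij_betw (pi0_map Y f) (path_components_of X) (path_components_of Y)"

definition homotopic_rel_boundary ::
  "nat \<Rightarrow> 'a topology \<Rightarrow> 'a \<Rightarrow> (((nat \<Rightarrow> real) \<Rightarrow> 'a) \<times> ((nat \<Rightarrow> real) \<Rightarrow> 'a)) set" where
  "homotopic_rel_boundary n X x =
     {(\<gamma>, \<delta>). homotopic_with (\<lambda>h. \<forall>t\<in>cube_boundary n. h t = x) (unit_cube n) X \<gamma> \<delta>}"

text \<open>The underlying set of $\pi_n(X,x)$: homotopy classes of maps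
  $(I^n,\partial I^n)\to(X,x)$. Induced maps are automatically homomorphisms, so that they are
  isomorphisms of groups if and only if they are bijective.\<close>

definition homotopy_classes ::
  "nat \<Rightarrow> 'a topology \<Rightarrow> 'a \<Rightarrow> ((nat \<Rightarrow> real) \<Rightarrow> 'a) set set" where
  "homotopy_classes n X x =
     {\<gamma>. continuous_map (unit_cube n) X \<gamma> \<and> (\<forall>t\<in>cube_boundary n. \<gamma> t = x)}
       // homotopic_rel_boundary n X x"

definition homotopy_classes_map ::
  "nat \<Rightarrow> 'b topology \<Rightarrow> ('a \<Rightarrow> 'b) \<Rightarrow> 'a \<Rightarrow> ((nat \<Rightarrow> real) \<Rightarrow> 'a) set \<Rightarrow> ((nat \<Rightarrow> real) \<Rightarrow> 'b) set" where
  "homotopy_classes_map n Y f x C = homotopic_rel_boundary n Y (f x) `` ((\<lambda>\<gamma>. f \<circ> \<gamma>) ` C)"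

definition weak_homotopy_equivalence :: "'a topology \<Rightarrow> 'b topology \<Rightarrow> ('a \<Rightarrow> 'b) \<Rightarrow> bool" where
  "weak_homotopy_equivalence X Y f \<longleftrightarrow>
     continuous_map X Y f \<and> pi0_bijective X Y f \<and>
     (\<forall>n\<ge>1. \<forall>x\<in>topspace X.
        bij_betw (homotopy_classes_map n Y f x) (homotopy_classes n X x) (homotopy_classes n Y (f x)))"


section \<open>Equivalence systems\<close>

text \<open>A family of morphisms of the category of topological spaces is given on the spaces carried by
  a universe type \<open>'u\<close>. A map between spaces over other types is regarded as a member if a
  homeomorphic copy of it is; for \<open>'u\<close> itself this changes nothing, because an equivalence system
  is closed under composition with homeomorphisms.\<close>

type_synonym 'u morphism_family = "('u topology \<times> 'u topology \<times> ('u \<Rightarrow> 'u)) set"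

definition equivalence_in ::
  "'u morphism_family \<Rightarrow> 'a topology \<Rightarrow> 'b topology \<Rightarrow> ('a \<Rightarrow> 'b) \<Rightarrow> bool" where
  "equivalence_in F X Y f \<longleftrightarrow>
     (\<exists>X' Y' h h' k k'. homeomorphic_maps X X' h h' \<and> homeomorphic_maps Y Y' k k' \<and>
        (X', Y', k \<circ> f \<circ> h') \<in> F)"

text \<open>In the last two clauses the existence of copies of the (co)products in \<open>'u\<close> is no
  restriction: it holds for every infinite type \<open>'u\<close>.\<close>

definition equivalence_system :: "'u morphism_family \<Rightarrow> bool" where
  "equivalence_system F \<longleftrightarrow>
     (\<forall>(X, Y, f) \<in> F. continuous_map X Y f) \<and>
     (\<forall>X Y Z f g. continuous_map X Y f \<and> continuous_map Y Z g \<longrightarrow>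
        ((X, Y, f) \<in> F \<and> (Y, Z, g) \<in> F \<longrightarrow> (X, Z, g \<circ> f) \<in> F) \<and>
        ((X, Y, f) \<in> F \<and> (X, Z, g \<circ> f) \<in> F \<longrightarrow> (Y, Z, g) \<in> F) \<and>
        ((Y, Z, g) \<in> F \<and> (X, Z, g \<circ> f) \<in> F \<longrightarrow> (X, Y, f) \<in> F)) \<and>
     (\<forall>X Y f g. homotopic_with (\<lambda>_. True) X Y f g \<longrightarrow> ((X, Y, f) \<in> F \<longleftrightarrow> (X, Y, g) \<in> F)) \<and>
     (\<forall>X Y f. weak_homotopy_equivalence X Y f \<longrightarrow> (X, Y, f) \<in> F) \<and>
     (\<forall>(X, Y, f) \<in> F. pi0_bijective X Y f) \<and>
     (\<forall>(I :: nat set) X Y f. finite I \<and> (\<forall>i\<in>I. continuous_map (X i) (Y i) (f i)) \<longrightarrow>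
        (equivalence_in F (sum_topology X I) (sum_topology Y I) (\<lambda>(i, x). (i, f i x)) \<longleftrightarrow>
         (\<forall>i\<in>I. (X i, Y i, f i) \<in> F))) \<and>
     (\<forall>(X, Y, f) \<in> F. \<forall>(X', Y', f') \<in> F.
        equivalence_in F (prod_topology X X') (prod_topology Y Y') (map_prod f f'))"

definition F_contractible :: "'u morphism_family \<Rightarrow> 'a topology \<Rightarrow> bool" where
  "F_contractible F Y \<longleftrightarrow> equivalence_in F Y (discrete_topology {()}) (\<lambda>_. ())"


section \<open>d-spaces\<close>

record 'a dspace =
  dtop :: "'a topology"
  dpaths :: "(real \<Rightarrow> 'a) set"

definition const_path :: "'a \<Rightarrow> real \<Rightarrow> 'a" where
  "const_path x = (\<lambda>t\<in>{0..1}. x)"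

definition path_concat :: "(real \<Rightarrow> 'a) \<Rightarrow> (real \<Rightarrow> 'a) \<Rightarrow> real \<Rightarrow> 'a" where
  "path_concat \<alpha> \<beta> = (\<lambda>t\<in>{0..1}. if t \<le> 1/2 then \<alpha> (2 * t) else \<beta> (2 * t - 1))"

definition d_space :: "'a dspace \<Rightarrow> bool" where
  "d_space X \<longleftrightarrow>
     (\<forall>\<alpha>\<in>dpaths X. pathin (dtop X) \<alpha> \<and> \<alpha> \<in> extensional {0..1}) \<and>
     (\<forall>x\<in>topspace (dtop X). const_path x \<in> dpaths X) \<and>
     (\<forall>\<alpha>\<in>dpaths X. \<forall>\<beta>\<in>dpaths X. \<alpha> 1 = \<beta> 0 \<longrightarrow> path_concat \<alpha> \<beta> \<in> dpaths X) \<and>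
     (\<forall>\<alpha>\<in>dpaths X. \<forall>\<phi>. continuous_on {0..1} \<phi> \<and> \<phi> ` {0..1} \<subseteq> {0..1} \<and> mono_on {0..1} \<phi> \<longrightarrow>
        restrict (\<alpha> \<circ> \<phi>) {0..1} \<in> dpaths X)"

definition dpaths_in :: "'a dspace \<Rightarrow> 'a set \<Rightarrow> (real \<Rightarrow> 'a) set" where
  "dpaths_in X A = {\<alpha> \<in> dpaths X. \<alpha> ` {0..1} \<subseteq> A}"

definition dpaths_between :: "'a dspace \<Rightarrow> 'a set \<Rightarrow> 'a set \<Rightarrow> 'a set \<Rightarrow> (real \<Rightarrow> 'a) set" where
  "dpaths_between X A B C = {\<alpha> \<in> dpaths_in X A. \<alpha> 0 \<in> B \<and> \<alpha> 1 \<in> C}"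

definition dpath_space :: "'a dspace \<Rightarrow> 'a \<Rightarrow> 'a \<Rightarrow> (real \<Rightarrow> 'a) topology" where
  "dpath_space X x y = subtopology (compact_open_topology (top_of_set {0..1}) (dtop X))
     (dpaths_between X (topspace (dtop X)) {x} {y})"

definition dle :: "'a dspace \<Rightarrow> 'a \<Rightarrow> 'a \<Rightarrow> bool" where
  "dle X x y \<longleftrightarrow> dpaths_between X (topspace (dtop X)) {x} {y} \<noteq> {}"

definition upper_part :: "'a dspace \<Rightarrow> 'a set \<Rightarrow> 'a \<Rightarrow> 'a set" where
  "upper_part X A x = {y \<in> A. dle X x y}"

definition lower_part :: "'a dspace \<Rightarrow> 'a set \<Rightarrow> 'a \<Rightarrow> 'a set" where
  "lower_part X A x = {y \<in> A. dle X y x}"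

definition d_convex :: "'a dspace \<Rightarrow> 'a set \<Rightarrow> bool" where
  "d_convex X A \<longleftrightarrow> dpaths_between X A A A = dpaths_between X (topspace (dtop X)) A A"

definition future_connected :: "'a dspace \<Rightarrow> 'a set \<Rightarrow> bool" where
  "future_connected X A \<longleftrightarrow>
     (\<forall>x\<in>A. \<forall>y\<in>A. \<exists>z\<in>A. dpaths_between X A {x} {z} \<noteq> {} \<and> dpaths_between X A {y} {z} \<noteq> {})"

definition past_connected :: "'a dspace \<Rightarrow> 'a set \<Rightarrow> bool" where
  "past_connected X A \<longleftrightarrow>
     (\<forall>x\<in>A. \<forall>y\<in>A. \<exists>z\<in>A. dpaths_between X A {z} {x} \<noteq> {} \<and> dpaths_between X A {z} {y} \<noteq> {})"


section \<open>Stability\<close>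

text \<open>The map $\vec P(\alpha,\beta) : \vec P_X(\alpha(1),\beta(0)) \to \vec P_X(\alpha(0),\beta(1))$,
  $\omega\mapsto\alpha*\omega*\beta$, is an \<open>F\<close>-equivalence. The two bracketings of the triple
  concatenation are homotopic maps, so the choice is immaterial.\<close>

definition extension_equivalence ::
  "'u morphism_family \<Rightarrow> 'a dspace \<Rightarrow> (real \<Rightarrow> 'a) \<Rightarrow> (real \<Rightarrow> 'a) \<Rightarrow> bool" where
  "extension_equivalence F X \<alpha> \<beta> \<longleftrightarrow>
     equivalence_in F (dpath_space X (\<alpha> 1) (\<beta> 0)) (dpath_space X (\<alpha> 0) (\<beta> 1))
       (\<lambda>\<omega>. path_concat (path_concat \<alpha> \<omega>) \<beta>)"

definition St_future ::
  "'u morphism_family \<Rightarrow> 'a dspace \<Rightarrow> (real \<Rightarrow> 'a) \<Rightarrow> 'a set \<Rightarrow> 'a set" where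
  "St_future F X \<alpha> A =
     {z \<in> A. \<forall>\<beta> \<in> dpaths_in X (upper_part X A z). extension_equivalence F X \<alpha> \<beta>}"

definition St_past ::
  "'u morphism_family \<Rightarrow> 'a dspace \<Rightarrow> 'a set \<Rightarrow> (real \<Rightarrow> 'a) \<Rightarrow> 'a set" where
  "St_past F X A \<alpha> =
     {z \<in> A. \<forall>\<beta> \<in> dpaths_in X (lower_part X A z). extension_equivalence F X \<beta> \<alpha>}"

definition future_stable :: "'u morphism_family \<Rightarrow> 'a dspace \<Rightarrow> 'a set \<Rightarrow> 'a set \<Rightarrow> bool" where
  "future_stable F X A B \<longleftrightarrow> future_connected X A \<and> future_connected X B \<and>
     (\<forall>\<alpha> \<in> dpaths_in X A. St_future F X \<alpha> B \<noteq> {})"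

definition past_stable :: "'u morphism_family \<Rightarrow> 'a dspace \<Rightarrow> 'a set \<Rightarrow> 'a set \<Rightarrow> bool" where
  "past_stable F X A B \<longleftrightarrow> past_connected X A \<and> past_connected X B \<and>
     (\<forall>\<beta> \<in> dpaths_in X B. St_past F X A \<beta> \<noteq> {})"

definition totally_stable :: "'u morphism_family \<Rightarrow> 'a dspace \<Rightarrow> 'a set \<Rightarrow> 'a set \<Rightarrow> bool" where
  "totally_stable F X A B \<longleftrightarrow> future_stable F X A B \<and> past_stable F X A B \<and>
     (\<exists>a\<in>A. \<exists>b\<in>B. b \<in> St_future F X (const_path a) B \<and> a \<in> St_past F X A (const_path b))"

text \<open>The stable path space of a stable pair is only defined up to \<open>F\<close>-equivalence; here we
  collect all spaces representing it. For non-empty \<open>A\<close> these are \<open>F\<close>-equivalent to each other,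
  so that an \<open>F\<close>-invariant property holds for one if and only if it holds for all.\<close>

definition future_stable_path_spaces ::
  "'u morphism_family \<Rightarrow> 'a dspace \<Rightarrow> 'a set \<Rightarrow> 'a set \<Rightarrow> (real \<Rightarrow> 'a) topology set" where
  "future_stable_path_spaces F X A B =
     {dpath_space X a z | a z. a \<in> A \<and> z \<in> St_future F X (const_path a) B}"

definition past_stable_path_spaces ::
  "'u morphism_family \<Rightarrow> 'a dspace \<Rightarrow> 'a set \<Rightarrow> 'a set \<Rightarrow> (real \<Rightarrow> 'a) topology set" where
  "past_stable_path_spaces F X A B =
     {dpath_space X z b | z b. b \<in> B \<and> z \<in> St_past F X A (const_path b)}"

text \<open>With this reading the empty set, which has no stable path space, is not trivial.\<close>

definition future_trivial :: "'u morphism_family \<Rightarrow> 'a dspace \<Rightarrow> 'a set \<Rightarrow> bool" where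
  "future_trivial F X A \<longleftrightarrow> future_connected X A \<and> future_stable F X A A \<and>
     (\<exists>Y \<in> future_stable_path_spaces F X A A. F_contractible F Y)"

definition past_trivial :: "'u morphism_family \<Rightarrow> 'a dspace \<Rightarrow> 'a set \<Rightarrow> bool" where
  "past_trivial F X A \<longleftrightarrow> past_connected X A \<and> past_stable F X A A \<and>
     (\<exists>Y \<in> past_stable_path_spaces F X A A. F_contractible F Y)"


section \<open>Component systems\<close>

definition stable_future_component_system ::
  "'u morphism_family \<Rightarrow> 'a dspace \<Rightarrow> 'a set set \<Rightarrow> bool" where
  "stable_future_component_system F X \<A> \<longleftrightarrow>
     pairwise disjnt \<A> \<and> \<Union>\<A> = topspace (dtop X) \<and>
     (\<forall>A\<in>\<A>. d_convex X A \<and> future_connected X A \<and> future_trivial F X A) \<and>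
     (\<forall>A\<in>\<A>. \<forall>B\<in>\<A>. future_stable F X A B)"

definition stable_past_component_system ::
  "'u morphism_family \<Rightarrow> 'a dspace \<Rightarrow> 'a set set \<Rightarrow> bool" where
  "stable_past_component_system F X \<A> \<longleftrightarrow>
     pairwise disjnt \<A> \<and> \<Union>\<A> = topspace (dtop X) \<and>
     (\<forall>A\<in>\<A>. d_convex X A \<and> past_connected X A \<and> past_trivial F X A) \<and>
     (\<forall>A\<in>\<A>. \<forall>B\<in>\<A>. past_stable F X A B)"

definition stable_total_component_system ::
  "'u morphism_family \<Rightarrow> 'a dspace \<Rightarrow> 'a set set \<Rightarrow> bool" where
  "stable_total_component_system F X \<A> \<longleftrightarrow>
     stable_future_component_system F X \<A> \<and> stable_past_component_system F X \<A> \<and>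
     (\<forall>A\<in>\<A>. \<forall>B\<in>\<A>. totally_stable F X A B)"

definition future_closed :: "'a dspace \<Rightarrow> 'a set set \<Rightarrow> bool" where
  "future_closed X \<A> \<longleftrightarrow> (\<forall>A\<in>\<A>. \<exists>x\<in>A. \<forall>y\<in>A. dle X y x)"

definition past_closed :: "'a dspace \<Rightarrow> 'a set set \<Rightarrow> bool" where
  "past_closed X \<A> \<longleftrightarrow> (\<forall>A\<in>\<A>. \<exists>x\<in>A. \<forall>y\<in>A. dle X x y)"

definition coarser :: "'a set set \<Rightarrow> 'a set set \<Rightarrow> bool" where
  "coarser \<A> \<B> \<longleftrightarrow> (\<forall>B\<in>\<B>. \<exists>A\<in>\<A>. B \<subseteq> A)"

definition coarsest :: "('a set set \<Rightarrow> bool) \<Rightarrow> 'a set set \<Rightarrow> bool" where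
  "coarsest is_system \<A> \<longleftrightarrow> is_system \<A> \<and> (\<forall>\<B>. is_system \<B> \<longrightarrow> coarser \<A> \<B>)"


section \<open>Pre-cubical sets and their geometric realization\<close>

text \<open>\<open>face K \<epsilon> i c\<close> is $d^\varepsilon_i(c)$, with \<open>False\<close> and \<open>True\<close> encoding $\varepsilon=0$ and
  $\varepsilon=1$.\<close>

record 'c precubical =
  cubes :: "nat \<Rightarrow> 'c set"
  face :: "bool \<Rightarrow> nat \<Rightarrow> 'c \<Rightarrow> 'c"

definition precubical_set :: "'c precubical \<Rightarrow> bool" where
  "precubical_set K \<longleftrightarrow>
     disjoint_family (cubes K) \<and>
     (\<forall>n i \<epsilon>. \<forall>c \<in> cubes K n. 1 \<le> i \<and> i \<le> n \<longrightarrow> face K \<epsilon> i c \<in> cubes K (n - 1)) \<and>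
     (\<forall>n i j \<epsilon> \<eta>. \<forall>c \<in> cubes K n. 1 \<le> i \<and> i < j \<and> j \<le> n \<longrightarrow>
        face K \<epsilon> i (face K \<eta> j c) = face K \<eta> (j - 1) (face K \<epsilon> i c))"

definition finite_precubical :: "'c precubical \<Rightarrow> bool" where
  "finite_precubical K \<longleftrightarrow> finite (\<Union>n. cubes K n)"

definition precubical_no_loops :: "'c precubical \<Rightarrow> bool" where
  "precubical_no_loops K \<longleftrightarrow>
     \<not> (\<exists>es. es \<noteq> [] \<and> set es \<subseteq> cubes K 1 \<and>
          face K True 1 (last es) = face K False 1 (hd es) \<and>
          (\<forall>i. Suc i < length es \<longrightarrow> face K True 1 (es ! i) = face K False 1 (es ! Suc i)))"

definition directed_cube :: "nat \<Rightarrow> (nat \<Rightarrow> real) dspace" where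
  "directed_cube n =
     \<lparr>dtop = unit_cube n,
      dpaths = {\<alpha> \<in> extensional {0..1}. pathin (unit_cube n) \<alpha> \<and>
                  (\<forall>i\<in>{1..n}. mono_on {0..1} (\<lambda>t. \<alpha> t i))}\<rparr>"

definition dspace_sum :: "('i \<Rightarrow> 'a dspace) \<Rightarrow> 'i set \<Rightarrow> ('i \<times> 'a) dspace" where
  "dspace_sum X I =
     \<lparr>dtop = sum_topology (\<lambda>i. dtop (X i)) I,
      dpaths = {\<lambda>t\<in>{0..1}. (i, \<alpha> t) | i \<alpha>. i \<in> I \<and> \<alpha> \<in> dpaths (X i)}\<rparr>"

text \<open>The smallest d-structure on the quotient that makes the projection \<open>q\<close> map d-paths to
  d-paths; the intersection is over a non-empty family, as all paths form a d-structure.\<close>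

definition dspace_quotient :: "'a dspace \<Rightarrow> ('a \<Rightarrow> 'b) \<Rightarrow> 'b dspace" where
  "dspace_quotient X q =
     \<lparr>dtop = quotient_topology (dtop X) q,
      dpaths = \<Inter>{P. d_space \<lparr>dtop = quotient_topology (dtop X) q, dpaths = P\<rparr> \<and>
                     (\<forall>\<alpha>\<in>dpaths X. restrict (q \<circ> \<alpha>) {0..1} \<in> P)}\<rparr>"

definition insert_coord :: "nat \<Rightarrow> nat \<Rightarrow> real \<Rightarrow> (nat \<Rightarrow> real) \<Rightarrow> nat \<Rightarrow> real" where
  "insert_coord n i e t = (\<lambda>k\<in>{1..n}. if k < i then t k else if k = i then e else t (k - 1))"

text \<open>A point of the disjoint union of the \<open>cubes K n\<close> times $[0,1]^n$ is a pair \<open>((n, c), t)\<close>;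
  points of the realization are equivalence classes of these.\<close>

type_synonym 'c cube_point = "(nat \<times> 'c) \<times> (nat \<Rightarrow> real)"

definition glue :: "'c precubical \<Rightarrow> 'c cube_point rel" where
  "glue K =
     {(((n - 1, face K \<epsilon> i c), t), ((n, c), insert_coord n i (of_bool \<epsilon>) t)) | n c \<epsilon> i t.
        c \<in> cubes K n \<and> 1 \<le> i \<and> i \<le> n \<and> t \<in> topspace (unit_cube (n - 1))}"

definition glue_class :: "'c precubical \<Rightarrow> 'c cube_point \<Rightarrow> 'c cube_point set" where
  "glue_class K p = (glue K \<union> (glue K)\<inverse>)\<^sup>* `` {p}"

definition realization :: "'c precubical \<Rightarrow> 'c cube_point set dspace" where
  "realization K =
     dspace_quotient (dspace_sum (\<lambda>(n, c). directed_cube n) (SIGMA n:UNIV. cubes K n)) (glue_class K)"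

end

theory Submission
  imports Defs
begin

text \<open>Coarsest systems exist because systems can be joined. Let \<open>\<A>\<close> be a
  finite system and \<open>\<B>\<close> an arbitrary system of the same kind (future, past or
  total). The classes of the equivalence relation generated by lying in a common member of
  \<open>\<A>\<close> or \<open>\<B>\<close> form a system of that kind again
  (\<open>join_future_system\<close>, \<open>join_past\<close>, \<open>join_total\<close>). A
  finite system \<open>\<A>\<close> with the least number of members is therefore coarsest: each
  class of its join with \<open>\<B>\<close> contains a member of \<open>\<A>\<close>, by
  minimality exactly one, so each member of \<open>\<B>\<close> lies in a member of
  \<open>\<A>\<close> (\<open>coarsest_if_joins\<close>). Moreover, whatever is coarser than a
  finite closed system is closed, because finitely many final points in a directed set have an
  upper bound (\<open>closed_if_coarser_than_closed\<close>). It remains to find one finite system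
  of each kind on $|K|$, closed in the future and past cases.

  The join is a system for the following reason. The members of a stable future system are
  partially ordered, a member lying below another if some d-path leads from it to the other.
  Passing from a member of \<open>\<A>\<close> to a higher one within a member of
  \<open>\<B>\<close> ends after finitely many steps, and the member where it ends does not depend
  on the choices (\<open>hat_unique\<close>). Each class thus has a last member of
  \<open>\<A>\<close>, from which no d-path leads to the rest of the class. Stability and
  triviality concern only points far up, so the class inherits them from its last member, once
  every point is joined to that member by a d-path whose prepending is an equivalence on path
  spaces with far endpoints (\<open>equivalence_into_end\<close>). Past systems are future systems
  for reversed time. For total systems the first member of one class and the last member of
  another one form a totally stable pair in \<open>\<A>\<close>, and its witnesses serve the two
  classes.

  The equivalences between path spaces of $|K|$ come from directed flows. A non-decreasing map of
  $[0,1]$ fixing 0 and 1 acts on all coordinates of all cubes simultaneously, compatibly with the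
  gluing. Pulling the coordinates strictly between 0 and \<open>m\<close> up towards
  \<open>m\<close> fixes every point whose coordinates are 0 or at least \<open>m\<close>.
  Prepending the trace of a point under this flow is an equivalence for d-paths ending at fixed
  points, with the final map of the flow as inverse up to homotopy (\<open>pre_equiv_flow\<close>,
  \<open>center_flow\<close>); since $|K|$ has no loops, the path space from a point to the end of
  its trace is contractible, so all d-paths between points with the same end behave like the
  traces (\<open>pre_equiv_via\<close>). With \<open>m = 1\<close> this shows that the points
  whose open cubes have a common final vertex form a closed future system
  (\<open>corner_system\<close>), and with \<open>0 < m < 1\<close> that the open cubes form a
  total system (\<open>open_cube_total_system\<close>). Loops are excluded by a function that
  increases strictly along non-constant d-paths, obtained from the heights of the vertices
  (\<open>elevation_dpath\<close>).

  Finally, an equivalence system contains the maps with a homotopy inverse because these are weak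
  homotopy equivalences (\<open>homotopy_inverse_imp_weak_homotopy_equivalence\<close>); base
  points, which homotopies move, are taken care of by collars.\<close>

section \<open>Homotopy equivalences are weak homotopy equivalences\<close>

abbreviation unit_interval :: "real topology" where
  "unit_interval \<equiv> top_of_set {0..1}"

lemma continuous_map_compose_pair:
  assumes "continuous_map (prod_topology A B) C h" "continuous_map Z A f" "continuous_map Z B g"
  shows "continuous_map Z C (\<lambda>z. h (f z, g z))"
proof -
  have "continuous_map Z (prod_topology A B) (\<lambda>z. (f z, g z))"
    using assms by (intro continuous_map_pairedI)
  from continuous_map_compose[OF this assms(1)] show ?thesis by (simp add: o_def)
qed

lemma continuous_map_compose':
  assumes "continuous_map B C h" "continuous_map Z B g"
  shows "continuous_map Z C (\<lambda>z. h (g z))"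
  using continuous_map_compose[OF assms(2,1)] by (simp add: o_def)

lemma continuous_map_into_unit_interval:
  "continuous_map Z unit_interval f \<longleftrightarrow> continuous_map Z euclideanreal f \<and> (\<forall>z\<in>topspace Z. 0 \<le> f z \<and> f z \<le> 1)"
  by (auto simp: continuous_map_in_subtopology)

lemma topspace_unit_cube: "topspace (unit_cube n) = (\<Pi>\<^sub>E i\<in>{1..n}. {0..1})"
  by (simp add: unit_cube_def)

lemma unit_cube_range: "t \<in> topspace (unit_cube n) \<Longrightarrow> i \<in> {1..n} \<Longrightarrow> 0 \<le> t i \<and> t i \<le> 1"
  by (force simp: topspace_unit_cube)

lemma continuous_map_into_unit_cube:
  assumes "\<And>i. i \<in> {1..n} \<Longrightarrow> continuous_map Z euclideanreal (\<lambda>z. f z i)"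
    and "\<And>i z. i \<in> {1..n} \<Longrightarrow> z \<in> topspace Z \<Longrightarrow> 0 \<le> f z i \<and> f z i \<le> 1"
  shows "continuous_map Z (unit_cube n) (\<lambda>z. \<lambda>i\<in>{1..n}. f z i)"
  unfolding unit_cube_def continuous_map_componentwise
proof (intro conjI ballI)
  fix k assume k: "k \<in> {1..n}"
  have "continuous_map Z unit_interval (\<lambda>z. f z k)"
    using assms k by (auto simp: continuous_map_into_unit_interval)
  then show "continuous_map Z unit_interval (\<lambda>x. (\<lambda>i\<in>{1..n}. f x i) k)" using k by simp
qed auto

lemma continuous_map_unit_cube_coord:
  assumes "continuous_map Z (unit_cube n) g" "i \<in> {1..n}"
  shows "continuous_map Z euclideanreal (\<lambda>z. g z i)"
  using assms unfolding unit_cube_def continuous_map_componentwise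
  by (auto simp: continuous_map_in_subtopology)

lemma continuous_map_Min:
  fixes f :: "'i \<Rightarrow> 'a \<Rightarrow> real"
  assumes "finite I" "I \<noteq> {}" "\<And>i. i \<in> I \<Longrightarrow> continuous_map X euclideanreal (f i)"
  shows "continuous_map X euclideanreal (\<lambda>x. Min ((\<lambda>i. f i x) ` I))"
  using assms
proof (induction rule: finite_ne_induct)
  case (insert i I)
  then have "(\<lambda>x. Min ((\<lambda>i. f i x) ` insert i I)) = (\<lambda>x. min (f i x) (Min ((\<lambda>i. f i x) ` I)))"
    by (auto simp: Min_insert)
  with insert show ?case by (simp add: continuous_map_real_min)
qed auto

definition boundary_distance :: "nat \<Rightarrow> (nat \<Rightarrow> real) \<Rightarrow> real" where
  "boundary_distance n t = Min ((\<lambda>i. min (t i) (1 - t i)) ` {1..n})"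

text \<open>Blows the inner cube $[1/4,3/4]^n$ up to the whole cube and sends the rest to the
  boundary.\<close>

definition stretch :: "nat \<Rightarrow> (nat \<Rightarrow> real) \<Rightarrow> nat \<Rightarrow> real" where
  "stretch n t = (\<lambda>i\<in>{1..n}. max 0 (min 1 (2 * t i - 1/2)))"

text \<open>The action of a path from \<open>x\<close> to \<open>y\<close> on homotopy groups:
  \<open>\<gamma>\<close> based at \<open>y\<close> is put on the inner cube, and the path
  \<open>p\<close> is run through on the way from the boundary to the inner cube.\<close>

definition collar :: "nat \<Rightarrow> (real \<Rightarrow> 'a) \<Rightarrow> ((nat \<Rightarrow> real) \<Rightarrow> 'a) \<Rightarrow> (nat \<Rightarrow> real) \<Rightarrow> 'a" where
  "collar n p \<gamma> t = (if 4 * boundary_distance n t \<le> 1 then p (4 * boundary_distance n t) else \<gamma> (stretch n t))"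

lemma boundary_distance_nonneg: "n \<ge> 1 \<Longrightarrow> t \<in> topspace (unit_cube n) \<Longrightarrow> 0 \<le> boundary_distance n t"
  unfolding boundary_distance_def using unit_cube_range[of t n] by (subst Min_ge_iff) auto

lemma boundary_distance_zero:
  assumes "t \<in> cube_boundary n" shows "boundary_distance n t = 0"
proof -
  from assms obtain i where i: "i \<in> {1..n}" "t i = 0 \<or> t i = 1" and t: "t \<in> topspace (unit_cube n)"
    by (auto simp: cube_boundary_def)
  then have "min (t i) (1 - t i) = 0" by auto
  then have "boundary_distance n t \<le> 0"
    unfolding boundary_distance_def using i(1) by (intro Min_le) force+
  moreover have "n \<ge> 1" using i by auto
  ultimately show ?thesis using boundary_distance_nonneg[OF _ t] by auto
qed

lemma stretch_in_cube: "stretch n t \<in> topspace (unit_cube n)"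
  by (auto simp: stretch_def topspace_unit_cube)

lemma stretch_near_boundary:
  assumes "n \<ge> 1" "4 * boundary_distance n t \<le> 1" "t \<in> topspace (unit_cube n)"
  shows "stretch n t \<in> cube_boundary n"
proof -
  have "boundary_distance n t \<in> (\<lambda>i. min (t i) (1 - t i)) ` {1..n}"
    unfolding boundary_distance_def using assms(1) by (intro Min_in) auto
  then obtain i where "i \<in> {1..n}" "boundary_distance n t = min (t i) (1 - t i)" by auto
  then have "i \<in> {1..n}" "t i \<le> 1/4 \<or> t i \<ge> 3/4" using assms by (auto simp: min_def split: if_splits)
  then have "i \<in> {1..n}" "stretch n t i = 0 \<or> stretch n t i = 1" by (auto simp: stretch_def)
  then show ?thesis using stretch_in_cube[of n t] unfolding cube_boundary_def by blast
qed

lemma continuous_map_stretch: "continuous_map (unit_cube n) (unit_cube n) (stretch n)"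
proof -
  have "continuous_map (unit_cube n) (unit_cube n) (\<lambda>t. \<lambda>i\<in>{1..n}. max 0 (min 1 (2 * t i - 1/2)))"
  proof (rule continuous_map_into_unit_cube)
    fix i assume i: "i \<in> {1..n}"
    show "continuous_map (unit_cube n) euclideanreal (\<lambda>t. max 0 (min 1 (2 * t i - 1/2)))"
      by (intro continuous_intros continuous_map_unit_cube_coord[OF continuous_map_id[unfolded id_def] i]) auto
  qed auto
  then show ?thesis by (simp add: stretch_def[abs_def])
qed

lemma continuous_map_boundary_distance:
  assumes "n \<ge> 1" shows "continuous_map (unit_cube n) euclideanreal (boundary_distance n)"
proof -
  have "continuous_map (unit_cube n) euclideanreal (\<lambda>t. Min ((\<lambda>i. min (t i) (1 - t i)) ` {1..n}))"
  proof (rule continuous_map_Min)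
    fix i assume i: "i \<in> {1..n}"
    show "continuous_map (unit_cube n) euclideanreal (\<lambda>t. min (t i) (1 - t i))"
      by (intro continuous_intros continuous_map_unit_cube_coord[OF continuous_map_id[unfolded id_def] i]) auto
  qed (use assms in auto)
  then show ?thesis by (simp add: boundary_distance_def[abs_def])
qed

lemma continuous_map_collar:
  assumes n: "n \<ge> 1"
    and P: "continuous_map (prod_topology Z unit_interval) X P"
    and K: "continuous_map (prod_topology Z (unit_cube n)) X K"
    and PK: "\<And>z t. z \<in> topspace Z \<Longrightarrow> t \<in> cube_boundary n \<Longrightarrow> K (z, t) = P (z, 1)"
  shows "continuous_map (prod_topology Z (unit_cube n)) X (\<lambda>(z, t). collar n (\<lambda>s. P (z, s)) (\<lambda>t. K (z, t)) t)"
proof -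
  let ?d = "\<lambda>x. 4 * boundary_distance n (snd x)"
  have d: "continuous_map (prod_topology Z (unit_cube n)) euclideanreal ?d"
    by (intro continuous_intros continuous_map_compose'[OF continuous_map_boundary_distance[OF n]]) 
  have "continuous_map (prod_topology Z (unit_cube n)) X
     (\<lambda>x. if ?d x \<le> 1 then P (fst x, ?d x) else K (fst x, stretch n (snd x)))"
  proof (rule continuous_map_cases_le[OF d])
    show "continuous_map (prod_topology Z (unit_cube n)) euclideanreal (\<lambda>x. 1)" by simp
    let ?S = "subtopology (prod_topology Z (unit_cube n)) {x \<in> topspace (prod_topology Z (unit_cube n)). ?d x \<le> 1}"
    have "continuous_map ?S Z fst" by (intro continuous_intros)
    moreover have "continuous_map ?S unit_interval ?d"
      using d boundary_distance_nonneg[OF n] by (auto simp: continuous_map_into_unit_interval intro: continuous_map_from_subtopology)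
    ultimately show "continuous_map ?S X (\<lambda>x. P (fst x, ?d x))"
      by (rule continuous_map_compose_pair[OF P])
    show "continuous_map (subtopology (prod_topology Z (unit_cube n)) {x \<in> topspace (prod_topology Z (unit_cube n)). 1 \<le> ?d x})
      X (\<lambda>x. K (fst x, stretch n (snd x)))"
      by (intro continuous_map_from_subtopology continuous_map_compose_pair[OF K] continuous_intros
          continuous_map_compose'[OF continuous_map_stretch])
    fix x assume "x \<in> topspace (prod_topology Z (unit_cube n))" "?d x = 1"
    then show "P (fst x, ?d x) = K (fst x, stretch n (snd x))"
      using PK stretch_near_boundary[OF n, of "snd x"] by auto
  qed
  then show ?thesis by (simp add: collar_def case_prod_unfold)
qed

abbreviation homotopic_rel :: "nat \<Rightarrow> 'a topology \<Rightarrow> 'a \<Rightarrow> ((nat \<Rightarrow> real) \<Rightarrow> 'a) \<Rightarrow> ((nat \<Rightarrow> real) \<Rightarrow> 'a) \<Rightarrow> bool" where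
  "homotopic_rel n X x \<equiv> homotopic_with (\<lambda>h. \<forall>t\<in>cube_boundary n. h t = x) (unit_cube n) X"

definition cube_loops :: "nat \<Rightarrow> 'a topology \<Rightarrow> 'a \<Rightarrow> ((nat \<Rightarrow> real) \<Rightarrow> 'a) set" where
  "cube_loops n X x = {\<gamma>. continuous_map (unit_cube n) X \<gamma> \<and> (\<forall>t\<in>cube_boundary n. \<gamma> t = x)}"

lemma homotopic_relI:
  assumes "continuous_map (prod_topology unit_interval (unit_cube n)) X h"
    "\<And>t. t \<in> topspace (unit_cube n) \<Longrightarrow> h (0, t) = \<gamma> t"
    "\<And>t. t \<in> topspace (unit_cube n) \<Longrightarrow> h (1, t) = \<delta> t"
    "\<And>s t. s \<in> {0..1} \<Longrightarrow> t \<in> cube_boundary n \<Longrightarrow> h (s, t) = x"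
  shows "homotopic_rel n X x \<gamma> \<delta>"
proof (subst homotopic_with)
  show "(\<forall>t\<in>cube_boundary n. h t = x) = (\<forall>t\<in>cube_boundary n. k t = x)"
    if "\<And>x. x \<in> topspace (unit_cube n) \<Longrightarrow> h x = k x" for h k
    using that by (auto simp: cube_boundary_def)
  show "\<exists>h. continuous_map (prod_topology unit_interval (unit_cube n)) X h \<and>
        (\<forall>x\<in>topspace (unit_cube n). h (0, x) = \<gamma> x) \<and> (\<forall>x\<in>topspace (unit_cube n). h (1, x) = \<delta> x) \<and>
        (\<forall>t\<in>{0..1}. \<forall>ta\<in>cube_boundary n. h (t, ta) = x)"
    using assms by blast
qed

text \<open>A free homotopy moves the whole boundary along \<open>p\<close>; performing it only
  away from the boundary leaves a collar in which \<open>p\<close> itself is traversed.\<close>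

lemma homotopic_rel_collar:
  assumes n: "n \<ge> 1"
    and G: "continuous_map (prod_topology unit_interval (unit_cube n)) X G"
    and p: "\<And>s t. s \<in> {0..1} \<Longrightarrow> t \<in> cube_boundary n \<Longrightarrow> G (s, t) = p s"
  shows "homotopic_rel n X (p 0) (\<lambda>t. G (0, t)) (collar n p (\<lambda>t. G (1, t)))"
proof (rule homotopic_relI)
  \<comment> \<open>?c s interpolates between the identity and stretch, and the time s of G is
    scaled down to 0 on the boundary by ?u, which is constantly 1 on the inner cube.\<close>
  let ?u = "\<lambda>t. max 0 (min 1 (4 * boundary_distance n t))"
  let ?c = "\<lambda>s t. \<lambda>i\<in>{1..n}. (1 - s) * t i + s * stretch n t i"
  let ?h = "\<lambda>x. G (fst x * ?u (snd x), ?c (fst x) (snd x))"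
  have fst_real: "continuous_map (prod_topology unit_interval (unit_cube n)) euclideanreal fst"
    using continuous_map_fst[of unit_interval "unit_cube n"] by (simp add: continuous_map_in_subtopology)
  show "continuous_map (prod_topology unit_interval (unit_cube n)) X ?h"
  proof (rule continuous_map_compose_pair[OF G])
    show "continuous_map (prod_topology unit_interval (unit_cube n)) unit_interval (\<lambda>x. fst x * ?u (snd x))"
      unfolding continuous_map_into_unit_interval
      by (intro conjI continuous_intros fst_real continuous_map_compose'[OF continuous_map_boundary_distance[OF n]] )
        (auto intro!: mult_nonneg_nonneg mult_le_one)
    show "continuous_map (prod_topology unit_interval (unit_cube n)) (unit_cube n) (\<lambda>x. ?c (fst x) (snd x))"
    proof (rule continuous_map_into_unit_cube)
      fix i assume i: "i \<in> {1..n}"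
      show "continuous_map (prod_topology unit_interval (unit_cube n)) euclideanreal (\<lambda>x. (1 - fst x) * snd x i + fst x * stretch n (snd x) i)"
        by (intro continuous_intros fst_real continuous_map_unit_cube_coord[OF _ i] continuous_map_compose'[OF continuous_map_stretch])
      fix z :: "real \<times> (nat \<Rightarrow> real)" assume z: "z \<in> topspace (prod_topology unit_interval (unit_cube n))"
      have "0 \<le> snd z i \<and> snd z i \<le> 1" "0 \<le> stretch n (snd z) i \<and> stretch n (snd z) i \<le> 1" "0 \<le> fst z" "fst z \<le> 1"
        using z i unit_cube_range[of "snd z" n i] unit_cube_range[OF stretch_in_cube i] by auto
      then show "0 \<le> (1 - fst z) * snd z i + fst z * stretch n (snd z) i \<and> (1 - fst z) * snd z i + fst z * stretch n (snd z) i \<le> 1"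
        using convex_bound_le[of "snd z i" 1 "stretch n (snd z) i" "1 - fst z" "fst z"] by auto
    qed
  qed
next
  fix t assume t: "t \<in> topspace (unit_cube n)"
  have "(\<lambda>i\<in>{1..n}. t i) = t" using t by (auto simp: topspace_unit_cube PiE_def extensional_restrict)
  then show "G (fst (0::real, t) * max 0 (min 1 (4 * boundary_distance n (snd (0::real, t)))),
          \<lambda>i\<in>{1..n}. (1 - fst (0, t)) * snd (0::real, t) i + fst (0, t) * stretch n (snd (0::real, t)) i) = G (0, t)"
    by simp
  have s: "(\<lambda>i\<in>{1..n}. stretch n t i) = stretch n t" by (auto simp: stretch_def)
  show "G (fst (1::real, t) * max 0 (min 1 (4 * boundary_distance n (snd (1::real, t)))),
          \<lambda>i\<in>{1..n}. (1 - fst (1, t)) * snd (1::real, t) i + fst (1, t) * stretch n (snd (1::real, t)) i) = collar n p (\<lambda>t. G (1, t)) t"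
    using s boundary_distance_nonneg[OF n t] stretch_near_boundary[OF n _ t] p
    by (auto simp: collar_def)
next
  fix s :: real and t assume s: "s \<in> {0..1}" and t: "t \<in> cube_boundary n"
  have "(\<lambda>i\<in>{1..n}. (1 - s) * t i + s * stretch n t i) \<in> cube_boundary n"
  proof -
    have "(\<lambda>i\<in>{1..n}. (1 - s) * t i + s * stretch n t i) \<in> topspace (unit_cube n)"
    proof -
      have "(1 - s) * t i + s * stretch n t i \<in> {0..1}" if i: "i \<in> {1..n}" for i
      proof -
        have "0 \<le> t i \<and> t i \<le> 1" "0 \<le> stretch n t i \<and> stretch n t i \<le> 1"
          using t i unit_cube_range[of t n i] unit_cube_range[OF stretch_in_cube i] by (auto simp: cube_boundary_def)
        then show ?thesis using s convex_bound_le[of "t i" 1 "stretch n t i" "1 - s" s] by auto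
      qed
      then show ?thesis by (auto simp: topspace_unit_cube)
    qed
    moreover obtain i where "i \<in> {1..n}" "t i = 0 \<or> t i = 1" using t by (auto simp: cube_boundary_def)
    then have "\<exists>i\<in>{1..n}. (\<lambda>i\<in>{1..n}. (1 - s) * t i + s * stretch n t i) i = 0 \<or> (\<lambda>i\<in>{1..n}. (1 - s) * t i + s * stretch n t i) i = 1"
      by (intro bexI[of _ i]) (auto simp: stretch_def)
    ultimately show ?thesis unfolding cube_boundary_def by simp
  qed
  then show "G (fst (s, t) * max 0 (min 1 (4 * boundary_distance n (snd (s, t)))),
          \<lambda>i\<in>{1..n}. (1 - fst (s, t)) * snd (s, t) i + fst (s, t) * stretch n (snd (s, t)) i) = p 0"
    using boundary_distance_zero[OF t] p by simp
qed

lemma homotopic_rel_collar_cong: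
  assumes n: "n \<ge> 1" and p: "continuous_map unit_interval X p" and h: "homotopic_rel n X (p 1) \<gamma> \<delta>"
  shows "homotopic_rel n X (p 0) (collar n p \<gamma>) (collar n p \<delta>)"
proof -
  obtain K where K: "continuous_map (prod_topology unit_interval (unit_cube n)) X K"
    "\<And>t. K (0, t) = \<gamma> t" "\<And>t. K (1, t) = \<delta> t"
    "\<And>s t. s \<in> {0..1} \<Longrightarrow> t \<in> cube_boundary n \<Longrightarrow> K (s, t) = p 1"
    using h unfolding homotopic_with_def by auto
  have P: "continuous_map (prod_topology unit_interval unit_interval) X (\<lambda>x. p (snd x))"
    by (rule continuous_map_compose'[OF p continuous_map_snd])
  show ?thesis
  proof (rule homotopic_relI)
    show "continuous_map (prod_topology unit_interval (unit_cube n)) X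
      (\<lambda>(s, t). collar n (\<lambda>\<tau>. p (snd (s, \<tau>))) (\<lambda>t. K (s, t)) t)"
      by (rule continuous_map_collar[OF n P K(1)]) (use K in auto)
    fix s :: real and t assume "t \<in> cube_boundary n"
    then show "(case (s, t) of (s, t) \<Rightarrow> collar n (\<lambda>\<tau>. p (snd (s, \<tau>))) (\<lambda>t. K (s, t)) t) = p 0"
      using boundary_distance_zero[of t n] by (simp add: collar_def)
  qed (auto simp: K)
qed

lemma cube_loops_collar:
  assumes n: "n \<ge> 1" and p: "continuous_map unit_interval X p" and g: "\<gamma> \<in> cube_loops n X (p 1)"
  shows "collar n p \<gamma> \<in> cube_loops n X (p 0)"
proof -
  have "homotopic_rel n X (p 1) \<gamma> \<gamma>" using g by (simp add: cube_loops_def)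
  from homotopic_rel_collar_cong[OF n p this] show ?thesis
    by (auto dest: homotopic_with_imp_continuous_maps homotopic_with_imp_property simp: cube_loops_def)
qed

text \<open>The final pieces of \<open>p\<close>, from \<open>p (1 - s)\<close> to \<open>p
  1\<close>, grow from a constant path to \<open>p\<close>. The collars along them form a free
  homotopy that moves the boundary along the reversed path.\<close>

lemma homotopic_rel_collar_reverse:
  assumes n: "n \<ge> 1" and p: "continuous_map unit_interval X p" and g: "\<gamma> \<in> cube_loops n X (p 1)"
  shows "homotopic_rel n X (p 1) \<gamma> (collar n (\<lambda>s. p (1 - s)) (collar n p \<gamma>))"
proof -
  have cg: "continuous_map (unit_cube n) X \<gamma>" and bg: "\<And>t. t \<in> cube_boundary n \<Longrightarrow> \<gamma> t = p 1"
    using g by (auto simp: cube_loops_def)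
  have a: "homotopic_rel n X (p 1) \<gamma> (collar n (\<lambda>s. p 1) \<gamma>)"
    using homotopic_rel_collar[OF n, of X "\<lambda>x. \<gamma> (snd x)" "\<lambda>s. p 1"] bg
      continuous_map_compose'[OF cg continuous_map_snd[of unit_interval]] by simp
  \<comment> \<open>For fixed s this path waits at p (1 - s) and then runs along p to p 1.\<close>
  let ?P = "\<lambda>x. p (max (1 - fst x) (snd x))"
  let ?G = "\<lambda>(s, t). collar n (\<lambda>\<tau>. ?P (s, \<tau>)) (\<lambda>t. (\<gamma> \<circ> snd) (s, t)) t"
  have P: "continuous_map (prod_topology unit_interval unit_interval) X ?P"
  proof (rule continuous_map_compose'[OF p])
    have "continuous_map (prod_topology unit_interval unit_interval) euclideanreal fst"
      "continuous_map (prod_topology unit_interval unit_interval) euclideanreal snd"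
      using continuous_map_fst[of unit_interval unit_interval] continuous_map_snd[of unit_interval unit_interval]
      by (simp_all add: continuous_map_in_subtopology)
    then show "continuous_map (prod_topology unit_interval unit_interval) unit_interval (\<lambda>x. max (1 - fst x) (snd x))"
      unfolding continuous_map_into_unit_interval by (intro conjI continuous_intros) auto
  qed
  have G: "continuous_map (prod_topology unit_interval (unit_cube n)) X ?G"
    by (rule continuous_map_collar[OF n P continuous_map_compose[OF continuous_map_snd cg]]) (use bg in auto)
  have b: "homotopic_rel n X (p 1) (\<lambda>t. ?G (0, t)) (collar n (\<lambda>s. p (1 - s)) (\<lambda>t. ?G (1, t)))"
    using homotopic_rel_collar[OF n G, of "\<lambda>s. p (1 - s)"] boundary_distance_zero[of _ n]
    by (auto simp: collar_def)
  have e0: "?G (0, t) = collar n (\<lambda>s. p 1) \<gamma> t" if "t \<in> topspace (unit_cube n)" for t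
    by (auto simp: collar_def max_def)
  have e1: "homotopic_rel n X (p 0) (\<lambda>t. ?G (1, t)) (collar n p \<gamma>)"
  proof (rule homotopic_with_equal)
    show "continuous_map (unit_cube n) X (\<lambda>t. ?G (1, t))"
      by (rule continuous_map_compose_pair[OF G]) auto
    show "\<forall>t\<in>cube_boundary n. ?G (1, t) = p 0" "\<forall>t\<in>cube_boundary n. collar n p \<gamma> t = p 0"
      using boundary_distance_zero[of _ n] by (auto simp: collar_def)
    show "?G (1, t) = collar n p \<gamma> t" if "t \<in> topspace (unit_cube n)" for t
      using boundary_distance_nonneg[OF n that] by (auto simp: collar_def max_def)
  qed
  have q: "continuous_map unit_interval X (\<lambda>s. p (1 - s))"
    by (rule continuous_map_compose'[OF p]) (auto simp: continuous_map_into_unit_interval intro!: continuous_intros)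
  have c: "homotopic_rel n X (p 1) (collar n (\<lambda>s. p (1 - s)) (\<lambda>t. ?G (1, t))) (collar n (\<lambda>s. p (1 - s)) (collar n p \<gamma>))"
    using homotopic_rel_collar_cong[OF n q, of "\<lambda>t. ?G (1, t)" "collar n p \<gamma>"] e1 by simp
  have d: "homotopic_rel n X (p 1) (collar n (\<lambda>s. p 1) \<gamma>) (\<lambda>t. ?G (0, t))"
  proof (rule homotopic_with_equal)
    show "continuous_map (unit_cube n) X (collar n (\<lambda>s. p 1) \<gamma>)"
      using a homotopic_with_imp_continuous_maps by blast
    show "\<forall>t\<in>cube_boundary n. ?G (0, t) = p 1" "\<forall>t\<in>cube_boundary n. collar n (\<lambda>s. p 1) \<gamma> t = p 1"
      using boundary_distance_zero[of _ n] by (auto simp: collar_def)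
    show "collar n (\<lambda>s. p 1) \<gamma> t = ?G (0, t)" if "t \<in> topspace (unit_cube n)" for t using e0[OF that] by simp
  qed
  show ?thesis by (rule homotopic_with_trans[OF homotopic_with_trans[OF homotopic_with_trans[OF a d] b] c])
qed

text \<open>Here \<open>p\<close> is the trace of the base point under the homotopy. On homotopy
  classes \<open>h\<close> thus has the collar along \<open>p\<close> as left inverse.\<close>

lemma homotopic_to_id_collar:
  assumes n: "n \<ge> 1" and h: "homotopic_with (\<lambda>_. True) X X id h" and x: "x \<in> topspace X"
  obtains p where "continuous_map unit_interval X p" "p 0 = x" "p 1 = h x"
    "\<And>\<gamma>. \<gamma> \<in> cube_loops n X x \<Longrightarrow> homotopic_rel n X x \<gamma> (collar n p (h \<circ> \<gamma>))"
proof -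
  obtain H where H: "continuous_map (prod_topology unit_interval X) X H"
    and H0: "\<And>y. H (0, y) = y" and H1: "\<And>y. H (1, y) = h y"
    using h unfolding homotopic_with_def by auto
  define p where "p = (\<lambda>s. H (s, x))"
  have "continuous_map unit_interval X p"
    unfolding p_def using x by (intro continuous_map_compose_pair[OF H]) auto
  moreover have "homotopic_rel n X x \<gamma> (collar n p (h \<circ> \<gamma>))" if "\<gamma> \<in> cube_loops n X x" for \<gamma>
  proof -
    have cg: "continuous_map (unit_cube n) X \<gamma>" and bg: "\<And>t. t \<in> cube_boundary n \<Longrightarrow> \<gamma> t = x"
      using that by (auto simp: cube_loops_def)
    have G: "continuous_map (prod_topology unit_interval (unit_cube n)) X (\<lambda>z. H (fst z, \<gamma> (snd z)))"
      by (intro continuous_map_compose_pair[OF H] continuous_intros continuous_map_compose'[OF cg])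
    show ?thesis
      using homotopic_rel_collar[OF n G, of p] bg by (simp add: p_def H0 H1 o_def)
  qed
  ultimately show thesis using that[of p] by (simp add: p_def H0 H1)
qed

lemma homotopic_rel_compose:
  assumes "homotopic_rel n X x \<gamma> \<delta>" "continuous_map X Y f"
  shows "homotopic_rel n Y (f x) (f \<circ> \<gamma>) (f \<circ> \<delta>)"
  by (rule homotopic_with_compose_continuous_map_left[OF assms]) auto

lemma cube_loops_compose:
  "\<gamma> \<in> cube_loops n X x \<Longrightarrow> continuous_map X Y f \<Longrightarrow> f \<circ> \<gamma> \<in> cube_loops n Y (f x)"
  by (auto simp: cube_loops_def intro: continuous_map_compose)

lemma homotopic_to_id_inj:
  assumes n: "n \<ge> 1" and h: "homotopic_with (\<lambda>_. True) X X id h" and x: "x \<in> topspace X"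
    and g: "\<gamma> \<in> cube_loops n X x" "\<delta> \<in> cube_loops n X x"
    and hh: "homotopic_rel n X (h x) (h \<circ> \<gamma>) (h \<circ> \<delta>)"
  shows "homotopic_rel n X x \<gamma> \<delta>"
proof -
  obtain p where p: "continuous_map unit_interval X p" "p 0 = x" "p 1 = h x"
    "\<And>\<gamma>. \<gamma> \<in> cube_loops n X x \<Longrightarrow> homotopic_rel n X x \<gamma> (collar n p (h \<circ> \<gamma>))"
    using homotopic_to_id_collar[OF n h x] by blast
  have "homotopic_rel n X x (collar n p (h \<circ> \<gamma>)) (collar n p (h \<circ> \<delta>))"
    using homotopic_rel_collar_cong[OF n p(1)] hh p by simp
  then show ?thesis
    using p(4)[OF g(1)] p(4)[OF g(2)] by (meson homotopic_with_symD homotopic_with_trans)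
qed

text \<open>Collars along a path and along the reversed path are mutually inverse, so the left
  inverse of \<open>h\<close> is also a right inverse.\<close>

lemma homotopic_to_id_surj:
  assumes n: "n \<ge> 1" and h: "homotopic_with (\<lambda>_. True) X X id h" and x: "x \<in> topspace X"
    and d: "\<delta> \<in> cube_loops n X (h x)"
  obtains \<gamma> where "\<gamma> \<in> cube_loops n X x" "homotopic_rel n X (h x) (h \<circ> \<gamma>) \<delta>"
proof -
  obtain p where p: "continuous_map unit_interval X p" "p 0 = x" "p 1 = h x"
    "\<And>\<gamma>. \<gamma> \<in> cube_loops n X x \<Longrightarrow> homotopic_rel n X x \<gamma> (collar n p (h \<circ> \<gamma>))"
    using homotopic_to_id_collar[OF n h x] by blast
  define \<gamma> where "\<gamma> = collar n p \<delta>"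
  have g: "\<gamma> \<in> cube_loops n X x"
    unfolding \<gamma>_def using cube_loops_collar[OF n p(1)] d p by simp
  have hc: "continuous_map X X h" using h homotopic_with_imp_continuous_maps by blast
  have hg: "h \<circ> \<gamma> \<in> cube_loops n X (h x)" by (rule cube_loops_compose[OF g hc])
  have q: "continuous_map unit_interval X (\<lambda>s. p (1 - s))"
    by (rule continuous_map_compose'[OF p(1)]) (auto simp: continuous_map_into_unit_interval intro!: continuous_intros)
  let ?c = "collar n (\<lambda>s. p (1 - s))"
  have "homotopic_rel n X (h x) (h \<circ> \<gamma>) (?c (collar n p (h \<circ> \<gamma>)))"
    using homotopic_rel_collar_reverse[OF n p(1), of "h \<circ> \<gamma>"] hg p by simp
  moreover have "homotopic_rel n X (h x) (?c (collar n p (h \<circ> \<gamma>))) (?c \<gamma>)"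
    using homotopic_rel_collar_cong[OF n q, of "collar n p (h \<circ> \<gamma>)" \<gamma>] homotopic_with_symD[OF p(4)[OF g]] p by simp
  moreover have "homotopic_rel n X (h x) (?c \<gamma>) \<delta>"
    unfolding \<gamma>_def using homotopic_with_symD[OF homotopic_rel_collar_reverse[OF n p(1), of \<delta>]] d p by simp
  ultimately have "homotopic_rel n X (h x) (h \<circ> \<gamma>) \<delta>" by (meson homotopic_with_trans)
  with g that show thesis by blast
qed

definition homotopy_inverse :: "'a topology \<Rightarrow> 'b topology \<Rightarrow> ('a \<Rightarrow> 'b) \<Rightarrow> ('b \<Rightarrow> 'a) \<Rightarrow> bool" where
  "homotopy_inverse X Y f g \<longleftrightarrow> continuous_map X Y f \<and> continuous_map Y X g \<and>
     homotopic_with (\<lambda>_. True) X X id (g \<circ> f) \<and> homotopic_with (\<lambda>_. True) Y Y id (f \<circ> g)"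

lemma homotopy_inverse_sym: "homotopy_inverse X Y f g \<Longrightarrow> homotopy_inverse Y X g f"
  by (auto simp: homotopy_inverse_def)

lemma homotopy_inverse_inj:
  assumes n: "n \<ge> 1" and fg: "homotopy_inverse X Y f g" and x: "x \<in> topspace X"
    and "\<gamma> \<in> cube_loops n X x" "\<delta> \<in> cube_loops n X x" "homotopic_rel n Y (f x) (f \<circ> \<gamma>) (f \<circ> \<delta>)"
  shows "homotopic_rel n X x \<gamma> \<delta>"
proof (rule homotopic_to_id_inj[OF n _ x])
  show "homotopic_with (\<lambda>_. True) X X id (g \<circ> f)" using fg by (simp add: homotopy_inverse_def)
  have "homotopic_rel n X (g (f x)) (g \<circ> (f \<circ> \<gamma>)) (g \<circ> (f \<circ> \<delta>))"
    using fg assms(6) homotopic_rel_compose by (fastforce simp: homotopy_inverse_def)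
  then show "homotopic_rel n X ((g \<circ> f) x) ((g \<circ> f) \<circ> \<gamma>) ((g \<circ> f) \<circ> \<delta>)" by (simp add: o_assoc)
qed fact+

text \<open>As \<open>g \<circ> f\<close> hits the class of \<open>g \<circ> \<delta>\<close> and
  \<open>g\<close> is injective on homotopy classes, \<open>f\<close> hits the class of
  \<open>\<delta>\<close>.\<close>

lemma homotopy_inverse_surj:
  assumes n: "n \<ge> 1" and fg: "homotopy_inverse X Y f g" and x: "x \<in> topspace X"
    and d: "\<delta> \<in> cube_loops n Y (f x)"
  obtains \<gamma> where "\<gamma> \<in> cube_loops n X x" "homotopic_rel n Y (f x) (f \<circ> \<gamma>) \<delta>"
proof -
  have f: "continuous_map X Y f" and g: "continuous_map Y X g"
    and gf: "homotopic_with (\<lambda>_. True) X X id (g \<circ> f)" using fg by (auto simp: homotopy_inverse_def)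
  have "g \<circ> \<delta> \<in> cube_loops n X ((g \<circ> f) x)" using cube_loops_compose[OF d g] by simp
  then obtain \<gamma> where \<gamma>: "\<gamma> \<in> cube_loops n X x" "homotopic_rel n X ((g \<circ> f) x) ((g \<circ> f) \<circ> \<gamma>) (g \<circ> \<delta>)"
    using homotopic_to_id_surj[OF n gf x] by blast
  have "homotopic_rel n Y (f x) (f \<circ> \<gamma>) \<delta>"
    by (rule homotopy_inverse_inj[OF n homotopy_inverse_sym[OF fg]])
      (use \<gamma> d f x cube_loops_compose[OF \<gamma>(1) f] in \<open>auto simp: o_assoc continuous_map_def\<close>)
  with \<gamma> that show thesis by blast
qed

lemma homotopy_classes_map_class:
  assumes "\<gamma> \<in> cube_loops n X x" "continuous_map X Y f"
  shows "homotopy_classes_map n Y f x (homotopic_rel_boundary n X x `` {\<gamma>})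
     = homotopic_rel_boundary n Y (f x) `` {f \<circ> \<gamma>}"
proof -
  have "homotopic_rel n X x \<gamma> \<gamma>" using assms by (simp add: cube_loops_def)
  then have refl: "\<gamma> \<in> homotopic_rel_boundary n X x `` {\<gamma>}" by (simp add: homotopic_rel_boundary_def)
  have push: "homotopic_rel n Y (f x) (f \<circ> \<gamma>) (f \<circ> \<delta>)" if "homotopic_rel n X x \<gamma> \<delta>" for \<delta>
    using homotopic_rel_compose[OF that assms(2)] .
  show ?thesis
  proof
    show "homotopy_classes_map n Y f x (homotopic_rel_boundary n X x `` {\<gamma>})
        \<subseteq> homotopic_rel_boundary n Y (f x) `` {f \<circ> \<gamma>}"
      unfolding homotopy_classes_map_def homotopic_rel_boundary_def
      using homotopic_with_trans[OF push] by auto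
    show "homotopic_rel_boundary n Y (f x) `` {f \<circ> \<gamma>}
        \<subseteq> homotopy_classes_map n Y f x (homotopic_rel_boundary n X x `` {\<gamma>})"
      using refl unfolding homotopy_classes_map_def by blast
  qed
qed

lemma homotopic_rel_boundary_class_eq:
  assumes "\<gamma> \<in> cube_loops n X x" "\<delta> \<in> cube_loops n X x"
  shows "homotopic_rel_boundary n X x `` {\<gamma>} = homotopic_rel_boundary n X x `` {\<delta>} \<longleftrightarrow> homotopic_rel n X x \<gamma> \<delta>"
proof
  assume e: "homotopic_rel_boundary n X x `` {\<gamma>} = homotopic_rel_boundary n X x `` {\<delta>}"
  have "homotopic_rel n X x \<delta> \<delta>" using assms(2) by (simp add: cube_loops_def)
  then have "\<delta> \<in> homotopic_rel_boundary n X x `` {\<gamma>}" unfolding e by (simp add: homotopic_rel_boundary_def)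
  then show "homotopic_rel n X x \<gamma> \<delta>" by (simp add: homotopic_rel_boundary_def)
next
  assume "homotopic_rel n X x \<gamma> \<delta>"
  then show "homotopic_rel_boundary n X x `` {\<gamma>} = homotopic_rel_boundary n X x `` {\<delta>}"
    unfolding homotopic_rel_boundary_def by (auto intro: homotopic_with_trans homotopic_with_symD)
qed

lemma homotopy_classes_eq:
  "homotopy_classes n X x = (\<lambda>\<gamma>. homotopic_rel_boundary n X x `` {\<gamma>}) ` cube_loops n X x"
  by (auto simp: homotopy_classes_def cube_loops_def quotient_def)

lemma pi0_map_component:
  assumes "continuous_map X Y f" "x \<in> topspace X"
  shows "pi0_map Y f (path_component_of_set X x) = path_component_of_set Y (f x)"
proof -
  have "path_component_of Y (f x) (f y)" if xy: "path_component_of X x y" for y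
  proof -
    obtain g where "pathin X g" "g 0 = x" "g 1 = y" using xy by (auto simp: path_component_of_def)
    then have "pathin Y (f \<circ> g)" "(f \<circ> g) 0 = f x" "(f \<circ> g) 1 = f y"
      using assms pathin_compose by auto
    then show ?thesis unfolding path_component_of_def by blast
  qed
  moreover have "path_component_of X x x" using assms by (simp add: path_component_of_refl)
  ultimately show ?thesis
    unfolding pi0_map_def by (auto intro: path_component_of_trans path_component_of_sym)
qed

lemma homotopic_to_id_path_component:
  assumes "homotopic_with (\<lambda>_. True) X X id h" "x \<in> topspace X"
  shows "path_component_of X x (h x)"
proof -
  obtain H where H: "continuous_map (prod_topology unit_interval X) X H"
    and H0: "\<And>y. H (0, y) = y" and H1: "\<And>y. H (1, y) = h y"
    using assms unfolding homotopic_with_def by auto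
  have "continuous_map unit_interval X (\<lambda>s. H (s, x))"
    using assms by (intro continuous_map_compose_pair[OF H]) auto
  then show ?thesis unfolding path_component_of_def pathin_def using H0 H1
    by (intro exI[of _ "\<lambda>s. H (s, x)"]) auto
qed

lemma path_component_set_eq:
  "x \<in> topspace X \<Longrightarrow> y \<in> topspace X \<Longrightarrow>
    path_component_of_set X x = path_component_of_set X y \<longleftrightarrow> path_component_of X x y"
  by (metis Collect_inj path_component_of_equiv)

theorem homotopy_inverse_imp_weak_homotopy_equivalence:
  assumes fg: "homotopy_inverse X Y f g"
  shows "weak_homotopy_equivalence X Y f"
proof -
  have f: "continuous_map X Y f" and g: "continuous_map Y X g"
    and gf: "homotopic_with (\<lambda>_. True) X X id (g \<circ> f)" and fg': "homotopic_with (\<lambda>_. True) Y Y id (f \<circ> g)"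
    using fg by (auto simp: homotopy_inverse_def)
  have fX: "f x \<in> topspace Y" if "x \<in> topspace X" for x using f that by (auto simp: continuous_map_def)
  have gY: "g y \<in> topspace X" if "y \<in> topspace Y" for y using g that by (auto simp: continuous_map_def)
  have "pi0_bijective X Y f"
    unfolding pi0_bijective_def bij_betw_def
  proof
    show "inj_on (pi0_map Y f) (path_components_of X)"
    proof (rule inj_onI)
      fix C D assume "C \<in> path_components_of X" "D \<in> path_components_of X"
      then obtain x y where x: "x \<in> topspace X" "C = path_component_of_set X x"
        and y: "y \<in> topspace X" "D = path_component_of_set X y" by (auto simp: path_components_of_def)
      assume "pi0_map Y f C = pi0_map Y f D"
      then have "path_component_of Y (f x) (f y)"
        using x y by (simp add: pi0_map_component[OF f] path_component_set_eq fX)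
      then have "path_component_of_set Y (f x) = path_component_of_set Y (f y)" 
        using x y by (simp add: path_component_set_eq fX)
      then have "pi0_map X g (path_component_of_set Y (f x)) = pi0_map X g (path_component_of_set Y (f y))" by simp
      then have "path_component_of X (g (f x)) (g (f y))"
        using x y by (simp add: pi0_map_component[OF g] path_component_set_eq fX gY)
      moreover have "path_component_of X x (g (f x))" "path_component_of X y (g (f y))"
        using homotopic_to_id_path_component[OF gf] x y by auto
      ultimately have "path_component_of X x y"
        by (meson path_component_of_trans path_component_of_sym)
      then show "C = D" using x y by (simp add: path_component_set_eq)
    qed
    show "pi0_map Y f ` path_components_of X = path_components_of Y"
    proof
      show "pi0_map Y f ` path_components_of X \<subseteq> path_components_of Y"
        using pi0_map_component[OF f] fX by (auto simp: path_components_of_def)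
      show "path_components_of Y \<subseteq> pi0_map Y f ` path_components_of X"
      proof
        fix D assume "D \<in> path_components_of Y"
        then obtain y where y: "y \<in> topspace Y" "D = path_component_of_set Y y" by (auto simp: path_components_of_def)
        have "pi0_map Y f (path_component_of_set X (g y)) = D"
          using homotopic_to_id_path_component[OF fg'] y
          by (simp add: pi0_map_component[OF f] gY fX path_component_set_eq path_component_of_sym)
        then show "D \<in> pi0_map Y f ` path_components_of X" using gY[OF y(1)] by (auto simp: path_components_of_def)
      qed
    qed
  qed
  moreover have "bij_betw (homotopy_classes_map n Y f x) (homotopy_classes n X x) (homotopy_classes n Y (f x))"
    if n: "n \<ge> 1" and x: "x \<in> topspace X" for n x
    unfolding bij_betw_def homotopy_classes_eq
  proof
    show "inj_on (homotopy_classes_map n Y f x) ((\<lambda>\<gamma>. homotopic_rel_boundary n X x `` {\<gamma>}) ` cube_loops n X x)"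
    proof (rule inj_onI)
      fix C D
      assume "C \<in> (\<lambda>\<gamma>. homotopic_rel_boundary n X x `` {\<gamma>}) ` cube_loops n X x"
        "D \<in> (\<lambda>\<gamma>. homotopic_rel_boundary n X x `` {\<gamma>}) ` cube_loops n X x"
      then obtain \<gamma> \<delta> where g: "\<gamma> \<in> cube_loops n X x" "C = homotopic_rel_boundary n X x `` {\<gamma>}"
        and d: "\<delta> \<in> cube_loops n X x" "D = homotopic_rel_boundary n X x `` {\<delta>}" by blast
      assume "homotopy_classes_map n Y f x C = homotopy_classes_map n Y f x D"
      then have "homotopic_rel n Y (f x) (f \<circ> \<gamma>) (f \<circ> \<delta>)"
        using g d cube_loops_compose[OF _ f] by (simp add: homotopy_classes_map_class[OF _ f] homotopic_rel_boundary_class_eq)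
      then have "homotopic_rel n X x \<gamma> \<delta>" by (rule homotopy_inverse_inj[OF n fg x g(1) d(1)])
      then show "C = D" using g d by (simp add: homotopic_rel_boundary_class_eq)
    qed
    show "homotopy_classes_map n Y f x ` (\<lambda>\<gamma>. homotopic_rel_boundary n X x `` {\<gamma>}) ` cube_loops n X x =
      (\<lambda>\<gamma>. homotopic_rel_boundary n Y (f x) `` {\<gamma>}) ` cube_loops n Y (f x)"
    proof (intro equalityI subsetI)
      fix C assume "C \<in> homotopy_classes_map n Y f x ` (\<lambda>\<gamma>. homotopic_rel_boundary n X x `` {\<gamma>}) ` cube_loops n X x"
      then show "C \<in> (\<lambda>\<gamma>. homotopic_rel_boundary n Y (f x) `` {\<gamma>}) ` cube_loops n Y (f x)"
        using cube_loops_compose[OF _ f] by (auto simp: homotopy_classes_map_class[OF _ f])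
    next
      fix C assume "C \<in> (\<lambda>\<gamma>. homotopic_rel_boundary n Y (f x) `` {\<gamma>}) ` cube_loops n Y (f x)"
      then obtain \<delta> where d: "\<delta> \<in> cube_loops n Y (f x)" "C = homotopic_rel_boundary n Y (f x) `` {\<delta>}" by blast
      obtain \<gamma> where \<gamma>: "\<gamma> \<in> cube_loops n X x" "homotopic_rel n Y (f x) (f \<circ> \<gamma>) \<delta>"
        using homotopy_inverse_surj[OF n fg x d(1)] by blast
      then have "homotopy_classes_map n Y f x (homotopic_rel_boundary n X x `` {\<gamma>}) = C"
        using d cube_loops_compose[OF _ f]
        by (simp add: homotopy_classes_map_class[OF _ f] homotopic_rel_boundary_class_eq)
      then show "C \<in> homotopy_classes_map n Y f x ` (\<lambda>\<gamma>. homotopic_rel_boundary n X x `` {\<gamma>}) ` cube_loops n X x"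
        using \<gamma> by blast
    qed
  qed
  ultimately show ?thesis using f by (simp add: weak_homotopy_equivalence_def)
qed

section \<open>Calculus of equivalence systems\<close>

lemma equivalence_system_continuous: "equivalence_system F \<Longrightarrow> (X, Y, f) \<in> F \<Longrightarrow> continuous_map X Y f"
  by (drule equivalence_system_def[THEN iffD1], drule conjunct1) fast

lemma equivalence_system_2of3:
  assumes "equivalence_system F" "continuous_map X Y f" "continuous_map Y Z g"
  shows "(X, Y, f) \<in> F \<Longrightarrow> (Y, Z, g) \<in> F \<Longrightarrow> (X, Z, g \<circ> f) \<in> F"
    "(X, Y, f) \<in> F \<Longrightarrow> (X, Z, g \<circ> f) \<in> F \<Longrightarrow> (Y, Z, g) \<in> F"
    "(Y, Z, g) \<in> F \<Longrightarrow> (X, Z, g \<circ> f) \<in> F \<Longrightarrow> (X, Y, f) \<in> F"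
proof -
  have "((X, Y, f) \<in> F \<and> (Y, Z, g) \<in> F \<longrightarrow> (X, Z, g \<circ> f) \<in> F) \<and>
        ((X, Y, f) \<in> F \<and> (X, Z, g \<circ> f) \<in> F \<longrightarrow> (Y, Z, g) \<in> F) \<and>
        ((Y, Z, g) \<in> F \<and> (X, Z, g \<circ> f) \<in> F \<longrightarrow> (X, Y, f) \<in> F)"
    by (rule assms(1)[unfolded equivalence_system_def, THEN conjunct2, THEN conjunct1,
          THEN spec, THEN spec, THEN spec, THEN spec, THEN spec, THEN mp, OF conjI[OF assms(2,3)]])
  then show "(X, Y, f) \<in> F \<Longrightarrow> (Y, Z, g) \<in> F \<Longrightarrow> (X, Z, g \<circ> f) \<in> F"
    "(X, Y, f) \<in> F \<Longrightarrow> (X, Z, g \<circ> f) \<in> F \<Longrightarrow> (Y, Z, g) \<in> F"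
    "(Y, Z, g) \<in> F \<Longrightarrow> (X, Z, g \<circ> f) \<in> F \<Longrightarrow> (X, Y, f) \<in> F" by blast+
qed

lemma equivalence_system_homotopic:
  assumes "equivalence_system F" "homotopic_with (\<lambda>_. True) X Y f g"
  shows "(X, Y, f) \<in> F \<longleftrightarrow> (X, Y, g) \<in> F"
  by (rule assms(1)[unfolded equivalence_system_def, THEN conjunct2, THEN conjunct2, THEN conjunct1,
          THEN spec, THEN spec, THEN spec, THEN spec, THEN mp, OF assms(2)])

lemma equivalence_system_homotopy_inverse:
  assumes "equivalence_system F" "homotopy_inverse X Y f g"
  shows "(X, Y, f) \<in> F"
  by (rule assms(1)[unfolded equivalence_system_def, THEN conjunct2, THEN conjunct2, THEN conjunct2, THEN conjunct1,
          THEN spec, THEN spec, THEN spec, THEN mp, OF homotopy_inverse_imp_weak_homotopy_equivalence[OF assms(2)]])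

lemma equivalence_system_pi0:
  assumes "equivalence_system F" "(X, Y, f) \<in> F"
  shows "pi0_bijective X Y f"
  using assms(1)[unfolded equivalence_system_def, THEN conjunct2, THEN conjunct2, THEN conjunct2, THEN conjunct2,
      THEN conjunct1, THEN bspec, OF assms(2)] by simp

lemma homeomorphic_maps_homotopy_inverse: "homeomorphic_maps X Y f g \<Longrightarrow> homotopy_inverse X Y f g"
proof -
  assume "homeomorphic_maps X Y f g"
  then have f: "continuous_map X Y f" "continuous_map Y X g"
    and eq: "\<And>x. x \<in> topspace X \<Longrightarrow> g (f x) = x" "\<And>y. y \<in> topspace Y \<Longrightarrow> f (g y) = y"
    by (simp_all add: homeomorphic_maps_def)
  have "homotopic_with (\<lambda>_. True) X X id (g \<circ> f)"
    by (rule homotopic_with_equal[OF TrueI TrueI continuous_map_id]) (simp add: eq)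
  moreover have "homotopic_with (\<lambda>_. True) Y Y id (f \<circ> g)"
    by (rule homotopic_with_equal[OF TrueI TrueI continuous_map_id]) (simp add: eq)
  ultimately show ?thesis using f by (simp add: homotopy_inverse_def)
qed

lemma equivalence_system_cong:
  assumes "equivalence_system F" "(X, Y, f) \<in> F" "\<And>x. x \<in> topspace X \<Longrightarrow> f x = g x"
  shows "(X, Y, g) \<in> F"
proof -
  have "homotopic_with (\<lambda>_. True) X Y f g"
    using assms(3) equivalence_system_continuous[OF assms(1,2)] by (intro homotopic_with_equal) auto
  from equivalence_system_homotopic[OF assms(1) this] assms(2) show ?thesis by simp
qed

lemma homotopic_compose_both:
  assumes "homotopic_with (\<lambda>_. True) X Y f g" "continuous_map Y Y' k" "continuous_map X' X h"
  shows "homotopic_with (\<lambda>_. True) X' Y' (k \<circ> f \<circ> h) (k \<circ> g \<circ> h)"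
  by (rule homotopic_with_compose_continuous_map_right[where p = "\<lambda>_. True",
        OF homotopic_with_compose_continuous_map_left[where p = "\<lambda>_. True", OF assms(1,2)] assms(3)]) simp_all

text \<open>Other choices of the copies differ by composition with homeomorphisms, and these are
  equivalences.\<close>

lemma equivalence_in_iff:
  assumes F: "equivalence_system F" and h: "homeomorphic_maps X X' h h'" and k: "homeomorphic_maps Y Y' k k'"
    and f: "continuous_map X Y f"
  shows "equivalence_in F X Y f \<longleftrightarrow> (X', Y', k \<circ> f \<circ> h') \<in> F"
proof
  assume "equivalence_in F X Y f"
  then obtain X2 Y2 h2 h2' k2 k2' where 2: "homeomorphic_maps X X2 h2 h2'" "homeomorphic_maps Y Y2 k2 k2'"
      "(X2, Y2, k2 \<circ> f \<circ> h2') \<in> F"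
    unfolding equivalence_in_def by blast
  have a: "homeomorphic_maps X' X2 (h2 \<circ> h') (h \<circ> h2')"
    by (rule homeomorphic_maps_compose) (use h 2 homeomorphic_maps_sym in blast)
  have b: "homeomorphic_maps Y2 Y' (k \<circ> k2') (k2 \<circ> k')"
    by (rule homeomorphic_maps_compose) (use k 2 homeomorphic_maps_sym in blast)
  have c: "continuous_map X' X2 (h2 \<circ> h')" "continuous_map Y2 Y' (k \<circ> k2')" "continuous_map X2 Y2 (k2 \<circ> f \<circ> h2')"
    using a b 2(3) equivalence_system_continuous[OF F] by (auto simp: homeomorphic_maps_def)
  have "(X', X2, h2 \<circ> h') \<in> F" "(Y2, Y', k \<circ> k2') \<in> F"
    by (rule equivalence_system_homotopy_inverse[OF F homeomorphic_maps_homotopy_inverse[OF a]],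
        rule equivalence_system_homotopy_inverse[OF F homeomorphic_maps_homotopy_inverse[OF b]])
  then have "(X', Y', (k \<circ> k2') \<circ> ((k2 \<circ> f \<circ> h2') \<circ> (h2 \<circ> h'))) \<in> F"
    using equivalence_system_2of3(1)[OF F c(1,3) _ 2(3)]
      equivalence_system_2of3(1)[OF F continuous_map_compose[OF c(1,3)] c(2)] by simp
  then show "(X', Y', k \<circ> f \<circ> h') \<in> F"
  proof (rule equivalence_system_cong[OF F])
    fix x assume x: "x \<in> topspace X'"
    have "h' x \<in> topspace X" using h x by (auto simp: homeomorphic_maps_def continuous_map_def)
    moreover then have "f (h' x) \<in> topspace Y" using f by (auto simp: continuous_map_def)
    ultimately show "((k \<circ> k2') \<circ> ((k2 \<circ> f \<circ> h2') \<circ> (h2 \<circ> h'))) x = (k \<circ> f \<circ> h') x"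
      using 2 by (auto simp: homeomorphic_maps_def)
  qed
next
  assume "(X', Y', k \<circ> f \<circ> h') \<in> F"
  then show "equivalence_in F X Y f" unfolding equivalence_in_def using h k by blast
qed

text \<open>The topology is transported along \<open>e\<close>: an injective quotient map is a
  homeomorphism.\<close>

lemma homeomorphic_copy:
  assumes "inj e"
  obtains X' h' where "homeomorphic_maps X X' e h'"
proof -
  have "homeomorphic_map X (quotient_topology X e) e"
    unfolding homeomorphic_map_def using assms quotient_map_quotient_topology by (auto intro: inj_on_subset)
  then show thesis using that homeomorphic_map_maps by blast
qed

lemma equivalence_in_copies:
  fixes ea :: "'a \<Rightarrow> 'u" and eb :: "'b \<Rightarrow> 'u" and F :: "'u morphism_family"
    and X :: "'a topology" and Y :: "'b topology"
  assumes F: "equivalence_system F" and "inj ea" "inj eb"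
  obtains X' h h' Y' k k' where "homeomorphic_maps X X' h h'" "homeomorphic_maps Y Y' k k'"
    "\<And>f. continuous_map X Y f \<Longrightarrow> equivalence_in F X Y f \<longleftrightarrow> (X', Y', k \<circ> f \<circ> h') \<in> F"
proof -
  obtain X' h' where h: "homeomorphic_maps X X' ea h'" using homeomorphic_copy[OF assms(2)] .
  obtain Y' k' where k: "homeomorphic_maps Y Y' eb k'" using homeomorphic_copy[OF assms(3)] .
  show thesis using that[OF h k] equivalence_in_iff[OF F h k] by blast
qed

lemma equivalence_in_2of3:
  fixes ea :: "'a \<Rightarrow> 'u" and eb :: "'b \<Rightarrow> 'u" and ec :: "'c \<Rightarrow> 'u" and F :: "'u morphism_family"
    and X :: "'a topology" and Y :: "'b topology" and Z :: "'c topology"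
  assumes F: "equivalence_system F" and inj: "inj ea" "inj eb" "inj ec"
    and f: "continuous_map X Y f" and g: "continuous_map Y Z g"
  shows "equivalence_in F X Y f \<Longrightarrow> equivalence_in F Y Z g \<Longrightarrow> equivalence_in F X Z (\<lambda>x. g (f x))"
    "equivalence_in F X Y f \<Longrightarrow> equivalence_in F X Z (\<lambda>x. g (f x)) \<Longrightarrow> equivalence_in F Y Z g"
    "equivalence_in F Y Z g \<Longrightarrow> equivalence_in F X Z (\<lambda>x. g (f x)) \<Longrightarrow> equivalence_in F X Y f"
proof -
  obtain X' h' where h: "homeomorphic_maps X X' ea h'" using homeomorphic_copy[OF inj(1)] .
  obtain Y' k' where k: "homeomorphic_maps Y Y' eb k'" using homeomorphic_copy[OF inj(2)] .
  obtain Z' l' where l: "homeomorphic_maps Z Z' ec l'" using homeomorphic_copy[OF inj(3)] .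
  have gf: "continuous_map X Z (\<lambda>x. g (f x))" using continuous_map_compose'[OF g f] .
  let ?f = "eb \<circ> f \<circ> h'" and ?g = "ec \<circ> g \<circ> k'" and ?gf = "ec \<circ> (\<lambda>x. g (f x)) \<circ> h'"
  have f': "continuous_map X' Y' ?f" and g': "continuous_map Y' Z' ?g"
    using f g h k l by (auto simp: homeomorphic_maps_def intro!: continuous_map_compose)
  have eq: "(?g \<circ> ?f) x = ?gf x" if "x \<in> topspace X'" for x
  proof -
    have "h' x \<in> topspace X" using h that by (auto simp: homeomorphic_maps_def continuous_map_def)
    then have "f (h' x) \<in> topspace Y" using f by (auto simp: continuous_map_def)
    then show ?thesis using k by (auto simp: homeomorphic_maps_def)
  qed
  have C: "(X', Z', ?g \<circ> ?f) \<in> F \<longleftrightarrow> (X', Z', ?gf) \<in> F"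
    by (rule iffI; erule equivalence_system_cong[OF F]) (simp_all only: eq)
  note iffs = equivalence_in_iff[OF F h k f] equivalence_in_iff[OF F k l g] equivalence_in_iff[OF F h l gf]
  show "equivalence_in F X Y f \<Longrightarrow> equivalence_in F Y Z g \<Longrightarrow> equivalence_in F X Z (\<lambda>x. g (f x))"
    "equivalence_in F X Y f \<Longrightarrow> equivalence_in F X Z (\<lambda>x. g (f x)) \<Longrightarrow> equivalence_in F Y Z g"
    "equivalence_in F Y Z g \<Longrightarrow> equivalence_in F X Z (\<lambda>x. g (f x)) \<Longrightarrow> equivalence_in F X Y f"
    unfolding iffs
    by (erule C[THEN iffD1, OF equivalence_system_2of3(1)[OF F f' g']], assumption,
        erule equivalence_system_2of3(2)[OF F f' g'], erule C[THEN iffD2],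
        erule equivalence_system_2of3(3)[OF F f' g'], erule C[THEN iffD2])
qed

lemma equivalence_in_homotopic:
  fixes ea :: "'a \<Rightarrow> 'u" and eb :: "'b \<Rightarrow> 'u" and F :: "'u morphism_family"
    and X :: "'a topology" and Y :: "'b topology"
  assumes F: "equivalence_system F" and inj: "inj ea" "inj eb"
    and fg: "homotopic_with (\<lambda>_. True) X Y f g"
  shows "equivalence_in F X Y f \<longleftrightarrow> equivalence_in F X Y g"
proof -
  obtain X' h h' Y' k k' where h: "homeomorphic_maps X X' h h'" "homeomorphic_maps Y Y' k k'"
    and iff: "\<And>f. continuous_map X Y f \<Longrightarrow> equivalence_in F X Y f \<longleftrightarrow> (X', Y', k \<circ> f \<circ> h') \<in> F"
    using equivalence_in_copies[OF F inj, of X Y] by blast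
  have k: "continuous_map Y Y' k" "continuous_map X' X h'" using h by (auto simp: homeomorphic_maps_def)
  have "homotopic_with (\<lambda>_. True) X' Y' (k \<circ> f \<circ> h') (k \<circ> g \<circ> h')"
    by (rule homotopic_compose_both[OF fg k])
  then show ?thesis
    using homotopic_with_imp_continuous_maps[OF fg] iff equivalence_system_homotopic[OF F] by simp
qed

lemma equivalence_in_homotopy_inverse:
  fixes ea :: "'a \<Rightarrow> 'u" and eb :: "'b \<Rightarrow> 'u" and F :: "'u morphism_family"
    and X :: "'a topology" and Y :: "'b topology"
  assumes F: "equivalence_system F" and inj: "inj ea" "inj eb"
    and fg: "homotopy_inverse X Y f g"
  shows "equivalence_in F X Y f"
proof -
  obtain X' h h' Y' k k' where h: "homeomorphic_maps X X' h h'" "homeomorphic_maps Y Y' k k'"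
    and iff: "\<And>f. continuous_map X Y f \<Longrightarrow> equivalence_in F X Y f \<longleftrightarrow> (X', Y', k \<circ> f \<circ> h') \<in> F"
    using equivalence_in_copies[OF F inj, of X Y] by blast
  have c: "continuous_map Y Y' k" "continuous_map Y' Y k'" "continuous_map X' X h'" "continuous_map X X' h"
    using h by (auto simp: homeomorphic_maps_def)
  have f: "continuous_map X Y f" "continuous_map Y X g"
    and gf: "homotopic_with (\<lambda>_. True) X X id (g \<circ> f)" "homotopic_with (\<lambda>_. True) Y Y id (f \<circ> g)"
    using fg by (auto simp: homotopy_inverse_def)
  have X: "\<And>x. x \<in> topspace X' \<Longrightarrow> h' x \<in> topspace X" and Y: "\<And>x. x \<in> topspace Y' \<Longrightarrow> k' x \<in> topspace Y"
    and fX: "\<And>x. x \<in> topspace X \<Longrightarrow> f x \<in> topspace Y" and gY: "\<And>y. y \<in> topspace Y \<Longrightarrow> g y \<in> topspace X"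
    using continuous_map_funspace[OF c(3)] continuous_map_funspace[OF c(2)] continuous_map_funspace[OF f(1)]
      continuous_map_funspace[OF f(2)] by (auto simp: Pi_iff)
  have eq: "\<And>x. x \<in> topspace X \<Longrightarrow> h' (h x) = x" "\<And>y. y \<in> topspace X' \<Longrightarrow> h (h' y) = y"
    "\<And>x. x \<in> topspace Y \<Longrightarrow> k' (k x) = x" "\<And>y. y \<in> topspace Y' \<Longrightarrow> k (k' y) = y"
    using h by (simp_all add: homeomorphic_maps_def)
  have "homotopy_inverse X' Y' (k \<circ> f \<circ> h') (h \<circ> g \<circ> k')"
    unfolding homotopy_inverse_def
  proof (intro conjI)
    show f': "continuous_map X' Y' (k \<circ> f \<circ> h')" "continuous_map Y' X' (h \<circ> g \<circ> k')"
      by (rule continuous_map_compose[OF c(3) continuous_map_compose[OF f(1) c(1)]],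
          rule continuous_map_compose[OF c(2) continuous_map_compose[OF f(2) c(4)]])
    have gf': "continuous_map X' X' (h \<circ> (g \<circ> f) \<circ> h')" "continuous_map Y' Y' (k \<circ> (f \<circ> g) \<circ> k')"
      by (rule continuous_map_compose[OF c(3) continuous_map_compose[OF continuous_map_compose[OF f] c(4)]],
          rule continuous_map_compose[OF c(2) continuous_map_compose[OF continuous_map_compose[OF f(2,1)] c(1)]])
    have 1: "homotopic_with (\<lambda>_. True) X' X' (h \<circ> id \<circ> h') (h \<circ> (g \<circ> f) \<circ> h')"
      by (rule homotopic_compose_both[OF gf(1) c(4) c(3)])
    have 2: "homotopic_with (\<lambda>_. True) X' X' id (h \<circ> id \<circ> h')"
      by (rule homotopic_with_equal[OF TrueI TrueI continuous_map_id]) (simp add: eq)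
    have "homotopic_with (\<lambda>_. True) X' X' (h \<circ> (g \<circ> f) \<circ> h') ((h \<circ> g \<circ> k') \<circ> (k \<circ> f \<circ> h'))"
      by (rule homotopic_with_equal[OF TrueI TrueI gf'(1)]) (simp add: eq X fX)
    from homotopic_with_trans[OF homotopic_with_trans[OF 2 1] this] show "homotopic_with (\<lambda>_. True) X' X' id ((h \<circ> g \<circ> k') \<circ> (k \<circ> f \<circ> h'))" .
    have 1: "homotopic_with (\<lambda>_. True) Y' Y' (k \<circ> id \<circ> k') (k \<circ> (f \<circ> g) \<circ> k')"
      by (rule homotopic_compose_both[OF gf(2) c(1) c(2)])
    have 2: "homotopic_with (\<lambda>_. True) Y' Y' id (k \<circ> id \<circ> k')"
      by (rule homotopic_with_equal[OF TrueI TrueI continuous_map_id]) (simp add: eq)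
    have "homotopic_with (\<lambda>_. True) Y' Y' (k \<circ> (f \<circ> g) \<circ> k') ((k \<circ> f \<circ> h') \<circ> (h \<circ> g \<circ> k'))"
      by (rule homotopic_with_equal[OF TrueI TrueI gf'(2)]) (simp add: eq Y gY)
    from homotopic_with_trans[OF homotopic_with_trans[OF 2 1] this] show "homotopic_with (\<lambda>_. True) Y' Y' id ((k \<circ> f \<circ> h') \<circ> (h \<circ> g \<circ> k'))" .
  qed
  from equivalence_system_homotopy_inverse[OF F this] show ?thesis by (simp add: iff[OF f(1)])
qed

lemma equivalence_in_pi0:
  fixes ea :: "'a \<Rightarrow> 'u" and eb :: "'b \<Rightarrow> 'u" and F :: "'u morphism_family"
    and X :: "'a topology" and Y :: "'b topology"
  assumes F: "equivalence_system F" and inj: "inj ea" "inj eb"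
    and f: "continuous_map X Y f" "equivalence_in F X Y f"
  shows "topspace X = {} \<longleftrightarrow> topspace Y = {}" "path_connected_space X \<longleftrightarrow> path_connected_space Y"
proof -
  obtain X' h h' Y' k k' where h: "homeomorphic_maps X X' h h'" "homeomorphic_maps Y Y' k k'"
    and iff: "\<And>f. continuous_map X Y f \<Longrightarrow> equivalence_in F X Y f \<longleftrightarrow> (X', Y', k \<circ> f \<circ> h') \<in> F"
    using equivalence_in_copies[OF F inj, of X Y] by blast
  have hs: "X homeomorphic_space X'" "Y homeomorphic_space Y'" using h by (auto simp: homeomorphic_space_def)
  have "pi0_bijective X' Y' (k \<circ> f \<circ> h')" by (rule equivalence_system_pi0[OF F iff[OF f(1), THEN iffD1, OF f(2)]])
  then have b: "bij_betw (pi0_map Y' (k \<circ> f \<circ> h')) (path_components_of X') (path_components_of Y')"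
    by (simp add: pi0_bijective_def)
  have "topspace X' = {} \<longleftrightarrow> topspace Y' = {}"
    using b path_components_of_eq_empty[of X'] path_components_of_eq_empty[of Y']
    by (auto simp: bij_betw_def)
  moreover have "topspace X = {} \<longleftrightarrow> topspace X' = {}" "topspace Y = {} \<longleftrightarrow> topspace Y' = {}"
    using homeomorphic_empty_space[OF hs(1)] homeomorphic_empty_space[OF hs(2)] by simp_all
  ultimately show "topspace X = {} \<longleftrightarrow> topspace Y = {}" by simp
  have "path_connected_space X' \<longleftrightarrow> path_connected_space Y'"
    unfolding path_connected_space_iff_components_eq bij_betw_imp_surj_on[OF b, symmetric]
    using bij_betw_imp_inj_on[OF b] by (simp add: inj_on_eq_iff)
  then show "path_connected_space X \<longleftrightarrow> path_connected_space Y"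
    using homeomorphic_path_connected_space[OF hs(1)] homeomorphic_path_connected_space[OF hs(2)] by simp
qed

lemma F_contractible_transfer:
  fixes ea :: "'a \<Rightarrow> 'u" and eb :: "'b \<Rightarrow> 'u" and F :: "'u morphism_family"
    and X :: "'a topology" and Y :: "'b topology"
  assumes F: "equivalence_system F" and inj: "inj ea" "inj eb"
    and f: "continuous_map X Y f" "equivalence_in F X Y f"
  shows "F_contractible F X \<longleftrightarrow> F_contractible F Y"
proof -
  have u: "inj (\<lambda>_::unit. undefined :: 'u)" by (auto simp: inj_on_def)
  have g: "continuous_map Y (discrete_topology {()}) (\<lambda>_. ())" by simp
  show ?thesis unfolding F_contractible_def
    by (rule iffI, erule equivalence_in_2of3(2)[OF F inj u f(1) g f(2)],
        erule equivalence_in_2of3(1)[OF F inj u f(1) g f(2)])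
qed

lemma F_contractible_nonempty_path_connected:
  fixes ea :: "'a \<Rightarrow> 'u" and F :: "'u morphism_family" and X :: "'a topology"
  assumes F: "equivalence_system F" and inj: "inj ea" and "F_contractible F X"
  shows "topspace X \<noteq> {}" "path_connected_space X"
proof -
  have u: "inj (\<lambda>_::unit. undefined :: 'u)" by (auto simp: inj_on_def)
  have g: "continuous_map X (discrete_topology {()}) (\<lambda>_. ())" by simp
  note * = equivalence_in_pi0[OF F inj u g assms(3)[unfolded F_contractible_def]]
  show "topspace X \<noteq> {}" using *(1) by simp
  show "path_connected_space X" using *(2) by (simp add: path_connected_space_discrete_topology)
qed

lemma F_contractible_singleton:
  fixes ea :: "'a \<Rightarrow> 'u" and F :: "'u morphism_family" and X :: "'a topology"
  assumes F: "equivalence_system F" and inj: "inj ea" and X: "topspace X = {a}"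
  shows "F_contractible F X"
proof -
  have u: "inj (\<lambda>_::unit. undefined :: 'u)" by (auto simp: inj_on_def)
  have "homotopy_inverse X (discrete_topology {()}) (\<lambda>_. ()) (\<lambda>_. a)"
  proof -
    have "homotopic_with (\<lambda>_. True) X X id ((\<lambda>_. a) \<circ> (\<lambda>_. ()))"
      by (rule homotopic_with_equal[OF TrueI TrueI continuous_map_id]) (use X in simp)
    moreover have "homotopic_with (\<lambda>_. True) (discrete_topology {()}) (discrete_topology {()}) id ((\<lambda>_. ()) \<circ> (\<lambda>_. a))"
      by (rule homotopic_with_equal[OF TrueI TrueI continuous_map_id]) simp
    ultimately show ?thesis using X by (simp add: homotopy_inverse_def)
  qed
  from equivalence_in_homotopy_inverse[OF F inj u this] show ?thesis by (simp add: F_contractible_def)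
qed

section \<open>Spaces of paths\<close>

lemma topspace_compact_open:
  "topspace (compact_open_topology X Y) = {f \<in> extensional (topspace X). continuous_map X Y f}"
proof -
  have "compactin X {}" "openin Y {}" by auto
  then have "{f \<in> extensional (topspace X). continuous_map X Y f} \<in>
      {{f \<in> extensional (topspace X). continuous_map X Y f \<and> f ` C \<subseteq> U} | C U. compactin X C \<and> openin Y U}"
    by (intro CollectI exI[of _ "{}"]) auto
  then show ?thesis unfolding compact_open_topology_def topology_generated_by_topspace by blast
qed

text \<open>If \<open>g a\<close> maps the compact set \<open>C\<close> into the open set
  \<open>V\<close>, then by the tube lemma so does \<open>g x\<close> for all \<open>x\<close>
  near \<open>a\<close>.\<close>

lemma continuous_map_into_compact_open:
  assumes g: "continuous_map (prod_topology T X) Y (\<lambda>p. g (fst p) (snd p))"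
    and ext: "\<And>a. a \<in> topspace T \<Longrightarrow> g a \<in> extensional (topspace X)"
  shows "continuous_map T (compact_open_topology X Y) g"
proof -
  have cont: "continuous_map X Y (g a)" if "a \<in> topspace T" for a
    using continuous_map_compose_pair[OF g, of X "\<lambda>_. a" "\<lambda>t. t"] that by simp
  let ?S = "{{f \<in> extensional (topspace X). continuous_map X Y f \<and> f ` C \<subseteq> U} | C U. compactin X C \<and> openin Y U}"
  have "continuous_map T (topology_generated_by ?S) g"
  proof (rule continuous_on_generated_topo)
    show "g ` topspace T \<subseteq> \<Union> ?S"
      using topspace_compact_open[of X Y] cont ext
      unfolding compact_open_topology_def topology_generated_by_topspace by blast
    fix U assume "U \<in> ?S"
    then obtain C V where U: "U = {f \<in> extensional (topspace X). continuous_map X Y f \<and> f ` C \<subseteq> V}"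
      and C: "compactin X C" and V: "openin Y V" by blast
    define W where "W = {p \<in> topspace (prod_topology T X). g (fst p) (snd p) \<in> V}"
    have W: "openin (prod_topology T X) W"
      unfolding W_def using openin_continuous_map_preimage[OF g V] .
    show "openin T (g -` U \<inter> topspace T)"
    proof (subst openin_subopen, intro ballI)
      fix a assume a: "a \<in> g -` U \<inter> topspace T"
      have "{a} \<times> C \<subseteq> W" using a compactin_subset_topspace[OF C] by (auto simp: W_def U)
      then obtain A B where AB: "openin T A" "a \<in> A" "C \<subseteq> B" "A \<times> B \<subseteq> W"
        using tube_lemma_right[OF W C, of a] a by blast
      have "A \<subseteq> g -` U \<inter> topspace T"
      proof
        fix x assume x: "x \<in> A"
        then have xT: "x \<in> topspace T" using openin_subset[OF AB(1)] by blast
        have "g x c \<in> V" if "c \<in> C" for c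
        proof -
          have "(x, c) \<in> W" using x that AB by blast
          then show ?thesis by (simp add: W_def)
        qed
        then show "x \<in> g -` U \<inter> topspace T" using cont[OF xT] ext[OF xT] xT by (auto simp: U)
      qed
      then show "\<exists>A. openin T A \<and> a \<in> A \<and> A \<subseteq> g -` U \<inter> topspace T" using AB by blast
    qed
  qed
  then show ?thesis by (simp add: compact_open_topology_def)
qed

text \<open>A path maps a compact neighbourhood of \<open>t\<close> into a given neighbourhood of
  its value at \<open>t\<close>, and this is an open condition on the path.\<close>

lemma continuous_map_eval:
  "continuous_map (prod_topology (compact_open_topology unit_interval Y) unit_interval) Y (\<lambda>p. fst p (snd p))"
proof (unfold continuous_map, intro conjI allI impI)
  let ?C = "compact_open_topology unit_interval Y"
  have top: "topspace ?C = {f \<in> extensional {0..1}. continuous_map unit_interval Y f}"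
    by (simp add: topspace_compact_open)
  show "(\<lambda>p. fst p (snd p)) ` topspace (prod_topology ?C unit_interval) \<subseteq> topspace Y"
    using continuous_map_funspace[of unit_interval Y] by (fastforce simp: top)
  fix V assume V: "openin Y V"
  show "openin (prod_topology ?C unit_interval) {p \<in> topspace (prod_topology ?C unit_interval). fst p (snd p) \<in> V}"
  proof (subst openin_subopen, intro ballI)
    fix p assume p: "p \<in> {p \<in> topspace (prod_topology ?C unit_interval). fst p (snd p) \<in> V}"
    obtain f t where ft: "p = (f, t)" by fastforce
    have f: "f \<in> extensional {0..1}" "continuous_map unit_interval Y f" and t: "t \<in> {0..1}" "f t \<in> V"
      using p by (auto simp: ft top)
    have "openin unit_interval {s \<in> {0..1}. f s \<in> V}"
      using openin_continuous_map_preimage[OF f(2) V] by simp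
    then obtain e where e: "e > 0" "\<And>s. s \<in> {0..1} \<Longrightarrow> dist s t < e \<Longrightarrow> f s \<in> V"
      using t unfolding openin_euclidean_subtopology_iff by blast
    define C where "C = {0..1} \<inter> cball t (e/2)"
    define B where "B = {0..1} \<inter> ball t (e/2)"
    have C: "compactin unit_interval C"
      by (auto simp: C_def compactin_subtopology compact_Int_closed)
    have B: "openin unit_interval B" unfolding B_def by (intro openin_open_Int) auto
    define A where "A = {h \<in> extensional (topspace unit_interval). continuous_map unit_interval Y h \<and> h ` C \<subseteq> V}"
    have A: "openin ?C A"
      unfolding compact_open_topology_def A_def by (rule topology_generated_by_Basis) (use C V in blast)
    have "f ` C \<subseteq> V" using e by (auto simp: C_def dist_commute)
    then have "p \<in> A \<times> B" using f t e(1) by (simp add: ft A_def B_def)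
    moreover have "A \<times> B \<subseteq> {p \<in> topspace (prod_topology ?C unit_interval). fst p (snd p) \<in> V}"
      using openin_subset[OF A] by (auto simp: A_def B_def C_def)
    ultimately show "\<exists>T. openin (prod_topology ?C unit_interval) T \<and> p \<in> T \<and>
        T \<subseteq> {p \<in> topspace (prod_topology ?C unit_interval). fst p (snd p) \<in> V}"
      using A B by (intro exI[of _ "A \<times> B"]) (auto simp: openin_prod_Times_iff)
  qed
qed

lemma continuous_map_fst_real: "continuous_map (prod_topology unit_interval Z) euclideanreal fst"
  using continuous_map_fst[of unit_interval Z] by (simp add: continuous_map_in_subtopology)

lemma continuous_map_snd_real: "continuous_map (prod_topology Z unit_interval) euclideanreal snd"
  using continuous_map_snd[of Z unit_interval] by (simp add: continuous_map_in_subtopology)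

lemma continuous_map_path_concat:
  assumes a: "continuous_map (prod_topology Z unit_interval) Y (\<lambda>p. a (fst p) (snd p))"
    and b: "continuous_map (prod_topology Z unit_interval) Y (\<lambda>p. b (fst p) (snd p))"
    and ab: "\<And>z. z \<in> topspace Z \<Longrightarrow> a z 1 = b z 0"
  shows "continuous_map (prod_topology Z unit_interval) Y (\<lambda>p. path_concat (a (fst p)) (b (fst p)) (snd p))"
proof -
  let ?P = "prod_topology Z unit_interval"
  have "continuous_map ?P Y (\<lambda>p. if snd p \<le> 1/2 then a (fst p) (2 * snd p) else b (fst p) (2 * snd p - 1))"
  proof (rule continuous_map_cases_le[OF continuous_map_snd_real])
    show "continuous_map ?P euclideanreal (\<lambda>x. 1/2)" by simp
    have "continuous_map (subtopology ?P {x \<in> topspace ?P. snd x \<le> 1/2}) unit_interval (\<lambda>p. 2 * snd p)"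
      unfolding continuous_map_into_unit_interval
      by (intro conjI continuous_map_from_subtopology continuous_intros continuous_map_snd_real) auto
    then show "continuous_map (subtopology ?P {x \<in> topspace ?P. snd x \<le> 1/2}) Y (\<lambda>p. a (fst p) (2 * snd p))"
      using continuous_map_compose_pair[OF a continuous_map_from_subtopology[OF continuous_map_fst]] by fastforce
    have "continuous_map (subtopology ?P {x \<in> topspace ?P. 1/2 \<le> snd x}) unit_interval (\<lambda>p. 2 * snd p - 1)"
      unfolding continuous_map_into_unit_interval
      by (intro conjI continuous_map_from_subtopology continuous_intros continuous_map_snd_real) auto
    then show "continuous_map (subtopology ?P {x \<in> topspace ?P. 1/2 \<le> snd x}) Y (\<lambda>p. b (fst p) (2 * snd p - 1))"
      using continuous_map_compose_pair[OF b continuous_map_from_subtopology[OF continuous_map_fst]] by fastforce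
    fix p assume p: "p \<in> topspace ?P" "snd p = 1/2"
    show "a (fst p) (2 * snd p) = b (fst p) (2 * snd p - 1)" unfolding p(2) using ab p(1) by auto
  qed
  then show ?thesis
    by (rule continuous_map_eq) (auto simp: path_concat_def)
qed

lemma path_concat_ends [simp]: "path_concat \<alpha> \<beta> 0 = \<alpha> 0" "path_concat \<alpha> \<beta> 1 = \<beta> 1"
  by (simp_all add: path_concat_def)

lemma const_path_ends [simp]: "const_path x 0 = x" "const_path x 1 = x"
  by (simp_all add: const_path_def)

section \<open>Concatenation with a fixed d-path\<close>

definition dpaths_from_to :: "'a dspace \<Rightarrow> 'a \<Rightarrow> 'a \<Rightarrow> (real \<Rightarrow> 'a) set" where
  "dpaths_from_to X x y = {\<alpha> \<in> dpaths X. \<alpha> 0 = x \<and> \<alpha> 1 = y}"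

locale dspace =
  fixes X :: "'a dspace"
  assumes d_space: "d_space X"
begin

lemma dpath_continuous: "\<alpha> \<in> dpaths X \<Longrightarrow> continuous_map unit_interval (dtop X) \<alpha>"
  using d_space by (auto simp: d_space_def pathin_def)

lemma dpath_extensional: "\<alpha> \<in> dpaths X \<Longrightarrow> \<alpha> \<in> extensional {0..1}"
  using d_space by (auto simp: d_space_def)

lemma dpath_in_space: "\<alpha> \<in> dpaths X \<Longrightarrow> t \<in> {0..1} \<Longrightarrow> \<alpha> t \<in> topspace (dtop X)"
  using continuous_map_funspace[OF dpath_continuous] by fastforce

lemma dpaths_const: "x \<in> topspace (dtop X) \<Longrightarrow> const_path x \<in> dpaths_from_to X x x"
  using d_space by (simp add: d_space_def dpaths_from_to_def)

lemma dpaths_concat: 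
  "\<alpha> \<in> dpaths_from_to X x y \<Longrightarrow> \<beta> \<in> dpaths_from_to X y z \<Longrightarrow> path_concat \<alpha> \<beta> \<in> dpaths_from_to X x z"
  using d_space by (auto simp: d_space_def dpaths_from_to_def)

lemma dpaths_reparam: 
  "\<alpha> \<in> dpaths X \<Longrightarrow> continuous_on {0..1} \<phi> \<Longrightarrow> \<phi> ` {0..1} \<subseteq> {0..1} \<Longrightarrow> mono_on {0..1} \<phi>
    \<Longrightarrow> restrict (\<alpha> \<circ> \<phi>) {0..1} \<in> dpaths X"
  using d_space by (auto simp: d_space_def)

lemma dpaths_between_eq: "dpaths_between X (topspace (dtop X)) {x} {y} = dpaths_from_to X x y"
  using dpath_in_space by (auto simp: dpaths_between_def dpaths_in_def dpaths_from_to_def)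

lemma dpaths_from_to_ends:
  "\<alpha> \<in> dpaths_from_to X x y \<Longrightarrow> x \<in> topspace (dtop X)" "\<alpha> \<in> dpaths_from_to X x y \<Longrightarrow> y \<in> topspace (dtop X)"
  using dpath_in_space[of \<alpha> 0] dpath_in_space[of \<alpha> 1] by (auto simp: dpaths_from_to_def)

lemma topspace_dpath_space [simp]: "topspace (dpath_space X x y) = dpaths_from_to X x y"
  unfolding dpath_space_def dpaths_between_eq
  using dpath_continuous dpath_extensional by (auto simp: topspace_compact_open dpaths_from_to_def)

lemma continuous_map_into_dpath_space:
  assumes "continuous_map (prod_topology Z unit_interval) (dtop X) (\<lambda>p. g (fst p) (snd p))"
    and "\<And>z. z \<in> topspace Z \<Longrightarrow> g z \<in> dpaths_from_to X x y"
  shows "continuous_map Z (dpath_space X x y) g"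
  unfolding dpath_space_def dpaths_between_eq
  by (rule continuous_map_into_subtopology, rule continuous_map_into_compact_open)
    (use assms dpath_extensional in \<open>auto simp: dpaths_from_to_def\<close>)

lemma continuous_map_eval_dpath_space:
  assumes "continuous_map Z (dpath_space X x y) g" "continuous_map Z unit_interval h"
  shows "continuous_map Z (dtop X) (\<lambda>z. g z (h z))"
proof -
  have "continuous_map Z (compact_open_topology unit_interval (dtop X)) g"
    using assms(1) unfolding dpath_space_def by (rule continuous_map_into_fulltopology)
  from continuous_map_compose_pair[OF continuous_map_eval this assms(2)] show ?thesis by simp
qed

lemma continuous_map_uncurry_dpath_space:
  assumes "continuous_map Z (dpath_space X x y) g"
  shows "continuous_map (prod_topology Z unit_interval) (dtop X) (\<lambda>p. g (fst p) (snd p))"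
  by (rule continuous_map_eval_dpath_space[OF continuous_map_compose'[OF assms continuous_map_fst] continuous_map_snd])

lemma continuous_map_into_dpath_space_in:
  assumes "continuous_map Z (dpath_space X x y) g" "z \<in> topspace Z"
  shows "g z \<in> dpaths_from_to X x y"
  using continuous_map_funspace[OF assms(1)] assms(2) by auto

lemma continuous_map_concat:
  assumes a: "continuous_map Z (dpath_space X x y) a" and b: "continuous_map Z (dpath_space X y w) b"
  shows "continuous_map Z (dpath_space X x w) (\<lambda>z. path_concat (a z) (b z))"
proof (rule continuous_map_into_dpath_space)
  show "continuous_map (prod_topology Z unit_interval) (dtop X) (\<lambda>p. path_concat (a (fst p)) (b (fst p)) (snd p))"
    by (rule continuous_map_path_concat[OF continuous_map_uncurry_dpath_space[OF a] continuous_map_uncurry_dpath_space[OF b]])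
      (use continuous_map_into_dpath_space_in[OF a] continuous_map_into_dpath_space_in[OF b] in \<open>simp add: dpaths_from_to_def\<close>)
  show "path_concat (a z) (b z) \<in> dpaths_from_to X x w" if "z \<in> topspace Z" for z
    by (rule dpaths_concat[OF continuous_map_into_dpath_space_in[OF a that] continuous_map_into_dpath_space_in[OF b that]])
qed

lemma continuous_map_concat_left:
  "\<alpha> \<in> dpaths_from_to X x y \<Longrightarrow> continuous_map (dpath_space X y z) (dpath_space X x z) (path_concat \<alpha>)"
  using continuous_map_concat[of _ x y "\<lambda>_. \<alpha>" z "\<lambda>\<omega>. \<omega>"] by simp

lemma continuous_map_concat_right:
  "\<beta> \<in> dpaths_from_to X y z \<Longrightarrow> continuous_map (dpath_space X x y) (dpath_space X x z) (\<lambda>\<omega>. path_concat \<omega> \<beta>)"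
  using continuous_map_concat[of _ x y "\<lambda>\<omega>. \<omega>" z "\<lambda>_. \<beta>"] by simp

lemma homotopic_into_dpath_space:
  assumes "continuous_map (prod_topology (prod_topology unit_interval Z) unit_interval) (dtop X)
      (\<lambda>p. h (fst (fst p)) (snd (fst p)) (snd p))"
    and "\<And>s z. s \<in> {0..1} \<Longrightarrow> z \<in> topspace Z \<Longrightarrow> h s z \<in> dpaths_from_to X x y"
    and "\<And>z. z \<in> topspace Z \<Longrightarrow> h 0 z = f z" "\<And>z. z \<in> topspace Z \<Longrightarrow> h 1 z = g z"
  shows "homotopic_with (\<lambda>_. True) Z (dpath_space X x y) f g"
proof (subst homotopic_with)
  have "continuous_map (prod_topology unit_interval Z) (dpath_space X x y) (\<lambda>p. h (fst p) (snd p))"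
    by (rule continuous_map_into_dpath_space) (use assms in auto)
  then show "\<exists>h. continuous_map (prod_topology unit_interval Z) (dpath_space X x y) h \<and>
        (\<forall>x\<in>topspace Z. h (0, x) = f x) \<and> (\<forall>x\<in>topspace Z. h (1, x) = g x) \<and> (\<forall>t\<in>{0..1}. True)"
    using assms(3,4) by (intro exI[of _ "\<lambda>p. h (fst p) (snd p)"]) auto
qed auto

text \<open>Convex combinations of the identity and \<open>\<phi>\<close> are non-decreasing, so
  the straight homotopy runs through d-paths. This provides the associativity and unit laws of
  concatenation up to homotopy.\<close>

lemma homotopic_reparam:
  assumes J: "continuous_map Z (dpath_space X x y) J"
    and \<phi>: "continuous_on {0..1} \<phi>" "\<phi> ` {0..1} \<subseteq> {0..1}" "mono_on {0..1} \<phi>" "\<phi> 0 = 0" "\<phi> 1 = 1"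
    and eq: "\<And>z t. z \<in> topspace Z \<Longrightarrow> t \<in> {0..1} \<Longrightarrow> J' z t = J z (\<phi> t)"
    and ext: "\<And>z. z \<in> topspace Z \<Longrightarrow> J' z \<in> extensional {0..1}"
  shows "homotopic_with (\<lambda>_. True) Z (dpath_space X x y) J J'"
proof (rule homotopic_into_dpath_space)
  let ?m = "\<lambda>s t. (1 - s) * t + s * \<phi> t"
  let ?h = "\<lambda>s z. restrict (J z \<circ> ?m s) {0..1}"
  have range: "?m s t \<in> {0..1}" if "s \<in> {0..1}" "t \<in> {0..1}" for s t
  proof -
    have "\<phi> t \<in> {0..1}" using \<phi>(2) that by blast
    then show ?thesis using that convex_bound_le[of t 1 "\<phi> t" "1 - s" s] by auto
  qed
  let ?P = "prod_topology (prod_topology unit_interval Z) unit_interval"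
  have c\<phi>: "continuous_map ?P euclideanreal (\<lambda>p. \<phi> (snd p))"
    by (rule continuous_map_compose'[of unit_interval]) (use \<phi>(1) in \<open>auto intro: continuous_intros\<close>)
  have ff: "continuous_map ?P euclideanreal (\<lambda>p. fst (fst p))"
    by (rule continuous_map_compose'[OF continuous_map_fst_real]) (rule continuous_map_fst)
  have "continuous_map ?P unit_interval (\<lambda>p. ?m (fst (fst p)) (snd p))"
    unfolding continuous_map_into_unit_interval
    by (intro conjI continuous_intros c\<phi> ff continuous_map_snd_real) (use range in auto)
  then have "continuous_map ?P (dtop X) (\<lambda>p. J (snd (fst p)) (?m (fst (fst p)) (snd p)))"
    by (rule continuous_map_eval_dpath_space[OF continuous_map_compose'[OF J
          continuous_map_compose'[OF continuous_map_snd continuous_map_fst]]])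
  then show "continuous_map ?P (dtop X) (\<lambda>p. ?h (fst (fst p)) (snd (fst p)) (snd p))"
    by (rule continuous_map_eq) auto
  show "?h s z \<in> dpaths_from_to X x y" if s: "s \<in> {0..1}" and z: "z \<in> topspace Z" for s z
  proof -
    have "mono_on {0..1} (?m s)"
      using s monotone_onD[OF \<phi>(3)] by (intro mono_onI add_mono mult_left_mono) auto
    then have "?h s z \<in> dpaths X"
      using range s continuous_map_into_dpath_space_in[OF J z]
      by (intro dpaths_reparam continuous_intros \<phi>) (auto simp: dpaths_from_to_def)
    then show ?thesis using continuous_map_into_dpath_space_in[OF J z] \<phi> by (simp add: dpaths_from_to_def)
  qed
  show "?h 0 z = J z" if z: "z \<in> topspace Z" for z
    using continuous_map_into_dpath_space_in[OF J z] dpath_extensional[of "J z"]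
    by (auto simp: dpaths_from_to_def intro!: extensionalityI[of _ "{0..1}"])
  show "?h 1 z = J' z" if z: "z \<in> topspace Z" for z
    using eq[OF z] ext[OF z] by (intro extensionalityI[of _ "{0..1}"]) auto
qed

lemma path_concat_extensional: "path_concat \<alpha> \<beta> \<in> extensional {0..1}"
  by (simp add: path_concat_def)

lemma homotopic_concat_assoc:
  assumes a: "continuous_map Z (dpath_space X x y) a" and b: "continuous_map Z (dpath_space X y w) b"
    and c: "continuous_map Z (dpath_space X w v) c"
  shows "homotopic_with (\<lambda>_. True) Z (dpath_space X x v)
    (\<lambda>z. path_concat (a z) (path_concat (b z) (c z))) (\<lambda>z. path_concat (path_concat (a z) (b z)) (c z))"
\<comment> \<open>The reparametrization takes the breakpoints 1/4 and 1/2 of the left-nested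
  concatenation to the breakpoints 1/2 and 3/4 of the right-nested one.\<close>
proof (rule homotopic_reparam[where \<phi> = "\<lambda>t. min (2*t) (min (t + 1/4) ((t+1)/2))"])
  show "continuous_map Z (dpath_space X x v) (\<lambda>z. path_concat (a z) (path_concat (b z) (c z)))"
    by (intro continuous_map_concat[OF a] continuous_map_concat[OF b c])
  show "mono_on {0..1} (\<lambda>t::real. min (2*t) (min (t + 1/4) ((t+1)/2)))"
    by (intro mono_onI min.mono) auto
next
  fix z and t :: real assume z: "z \<in> topspace Z" and t: "t \<in> {0..1}"
  have ab: "a z 1 = b z 0" "b z 1 = c z 0"
    using continuous_map_into_dpath_space_in[OF a z] continuous_map_into_dpath_space_in[OF b z]
      continuous_map_into_dpath_space_in[OF c z] by (auto simp: dpaths_from_to_def)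
  consider "t \<le> 1/4" | "1/4 < t" "t \<le> 1/2" | "t > 1/2" by linarith
  then show "path_concat (path_concat (a z) (b z)) (c z) t =
      path_concat (a z) (path_concat (b z) (c z)) (min (2*t) (min (t + 1/4) ((t+1)/2)))"
  proof cases
    case 1
    then have "min (2*t) (min (t + 1/4) ((t+1)/2)) = 2*t" by auto
    then show ?thesis using 1 t by (simp add: path_concat_def)
  next
    case 2
    then have m: "min (2*t) (min (t + 1/4) ((t+1)/2)) = t + 1/4" by auto
    show ?thesis unfolding m using 2 t by (simp add: path_concat_def algebra_simps)
  next
    case 3
    then have m: "min (2*t) (min (t + 1/4) ((t+1)/2)) = (t+1)/2" by auto
    show ?thesis unfolding m using 3 t by (simp add: path_concat_def field_simps)
  qed
next
  show "(\<lambda>t::real. min (2*t) (min (t + 1/4) ((t+1)/2))) ` {0..1} \<subseteq> {0..1}"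
    by (auto simp: min_def)
qed (auto intro!: continuous_intros simp: path_concat_extensional)

lemma homotopic_concat_const_left:
  assumes x: "x \<in> topspace (dtop X)" and a: "continuous_map Z (dpath_space X x y) a"
  shows "homotopic_with (\<lambda>_. True) Z (dpath_space X x y) a (\<lambda>z. path_concat (const_path x) (a z))"
proof (rule homotopic_reparam[OF a, where \<phi> = "\<lambda>t. max 0 (2*t - 1)"])
  show "mono_on {0..1} (\<lambda>t::real. max 0 (2*t - 1))" by (intro mono_onI max.mono) auto
  fix z and t :: real assume z: "z \<in> topspace Z" and t: "t \<in> {0..1}"
  have "a z 0 = x" using continuous_map_into_dpath_space_in[OF a z] by (auto simp: dpaths_from_to_def)
  then show "path_concat (const_path x) (a z) t = a z (max 0 (2*t - 1))"
    using t by (cases "2 * t = 1") (auto simp: path_concat_def const_path_def max_def)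
qed (auto intro!: continuous_intros simp: path_concat_extensional)

lemma homotopic_concat_const_right:
  assumes y: "y \<in> topspace (dtop X)" and a: "continuous_map Z (dpath_space X x y) a"
  shows "homotopic_with (\<lambda>_. True) Z (dpath_space X x y) a (\<lambda>z. path_concat (a z) (const_path y))"
proof (rule homotopic_reparam[OF a, where \<phi> = "\<lambda>t. min 1 (2*t)"])
  show "mono_on {0..1} (\<lambda>t::real. min 1 (2*t))" by (intro mono_onI min.mono) auto
  fix z and t :: real assume z: "z \<in> topspace Z" and t: "t \<in> {0..1}"
  have "a z 1 = y" using continuous_map_into_dpath_space_in[OF a z] by (auto simp: dpaths_from_to_def)
  then show "path_concat (a z) (const_path y) t = a z (min 1 (2*t))"
    using t by (cases "2 * t = 1") (auto simp: path_concat_def const_path_def min_def)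
qed (auto intro!: continuous_intros simp: path_concat_extensional)

end

text \<open>The injection makes the members of \<open>F\<close> decide which maps between path
  spaces are equivalences: every path space has a copy on a subset of \<open>'u\<close>.\<close>

locale equivalence_setting = dspace X for X :: "'a dspace" +
  fixes F :: "'u morphism_family"
  assumes F: "equivalence_system F"
    and no_loop: "\<And>\<alpha> x. \<alpha> \<in> dpaths_from_to X x x \<Longrightarrow> \<alpha> = const_path x"
    and universe: "\<exists>e :: (real \<Rightarrow> 'a) \<Rightarrow> 'u. inj e"
begin

abbreviation paths :: "'a \<Rightarrow> 'a \<Rightarrow> (real \<Rightarrow> 'a) set" where "paths \<equiv> dpaths_from_to X"
abbreviation path_space :: "'a \<Rightarrow> 'a \<Rightarrow> (real \<Rightarrow> 'a) topology" where "path_space \<equiv> dpath_space X"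

definition embedding :: "(real \<Rightarrow> 'a) \<Rightarrow> 'u" where "embedding = (SOME e. inj e)"

lemma inj_embedding: "inj embedding"
  unfolding embedding_def using someI_ex[OF universe] .

abbreviation equiv_in :: "(real \<Rightarrow> 'a) topology \<Rightarrow> (real \<Rightarrow> 'a) topology \<Rightarrow> ((real \<Rightarrow> 'a) \<Rightarrow> (real \<Rightarrow> 'a)) \<Rightarrow> bool" where
  "equiv_in \<equiv> equivalence_in F"

lemmas equiv_2of3 = equivalence_in_2of3[OF F inj_embedding inj_embedding inj_embedding]
lemmas equiv_homotopic = equivalence_in_homotopic[OF F inj_embedding inj_embedding]
lemmas equiv_homotopy_inverse = equivalence_in_homotopy_inverse[OF F inj_embedding inj_embedding]
lemmas equiv_pi0 = equivalence_in_pi0[OF F inj_embedding inj_embedding]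
lemmas contractible_transfer = F_contractible_transfer[OF F inj_embedding inj_embedding]
lemmas contractible_pi0 = F_contractible_nonempty_path_connected[OF F inj_embedding]

lemma equiv_id: "equiv_in Y Y (\<lambda>\<omega>. \<omega>)"
  by (rule equiv_homotopy_inverse[of _ _ _ id])
    (simp add: homotopy_inverse_def o_def flip: id_def)

text \<open>The map \<open>\<omega> \<mapsto> \<alpha> * \<omega> * \<beta>\<close> is studied
  through its two halves, prepending \<open>\<alpha>\<close> to d-paths with endpoint
  \<open>z\<close> and appending \<open>\<beta>\<close> to d-paths with starting point
  \<open>x\<close>.\<close>

definition pre_equiv :: "(real \<Rightarrow> 'a) \<Rightarrow> 'a \<Rightarrow> bool" where
  "pre_equiv \<alpha> z \<longleftrightarrow> equiv_in (path_space (\<alpha> 1) z) (path_space (\<alpha> 0) z) (path_concat \<alpha>)"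

definition post_equiv :: "'a \<Rightarrow> (real \<Rightarrow> 'a) \<Rightarrow> bool" where
  "post_equiv x \<beta> \<longleftrightarrow> equiv_in (path_space x (\<beta> 0)) (path_space x (\<beta> 1)) (\<lambda>\<omega>. path_concat \<omega> \<beta>)"

lemma pathsD: "\<alpha> \<in> paths x y \<Longrightarrow> \<alpha> 0 = x \<and> \<alpha> 1 = y" by (simp add: dpaths_from_to_def)

lemma pre_equiv_iff: "\<alpha> \<in> paths x y \<Longrightarrow> pre_equiv \<alpha> z \<longleftrightarrow> equiv_in (path_space y z) (path_space x z) (path_concat \<alpha>)"
  by (simp add: pre_equiv_def pathsD)

lemma post_equiv_iff: "\<beta> \<in> paths b b' \<Longrightarrow> post_equiv x \<beta> \<longleftrightarrow> equiv_in (path_space x b) (path_space x b') (\<lambda>\<omega>. path_concat \<omega> \<beta>)"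
  by (simp add: post_equiv_def pathsD)

lemma pre_equiv_concat:
  assumes a: "\<alpha> \<in> paths x y" and g: "\<gamma> \<in> paths y w" and "pre_equiv \<gamma> z"
  shows "pre_equiv (path_concat \<alpha> \<gamma>) z \<longleftrightarrow> pre_equiv \<alpha> z"
proof -
  have cg: "continuous_map (path_space w z) (path_space y z) (path_concat \<gamma>)"
    and ca: "continuous_map (path_space y z) (path_space x z) (path_concat \<alpha>)"
    using a g by (auto intro: continuous_map_concat_left)
  have "homotopic_with (\<lambda>_. True) (path_space w z) (path_space x z)
      (\<lambda>\<omega>. path_concat \<alpha> (path_concat \<gamma> \<omega>)) (\<lambda>\<omega>. path_concat (path_concat \<alpha> \<gamma>) \<omega>)"
    using homotopic_concat_assoc[of "path_space w z" x y "\<lambda>_. \<alpha>" w "\<lambda>_. \<gamma>" z "\<lambda>\<omega>. \<omega>"] a g by simp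
  from equiv_homotopic[OF this]
  have "pre_equiv (path_concat \<alpha> \<gamma>) z \<longleftrightarrow> equiv_in (path_space w z) (path_space x z) (\<lambda>\<omega>. path_concat \<alpha> (path_concat \<gamma> \<omega>))"
    using pre_equiv_iff[OF dpaths_concat[OF a g]] by simp
  also have "\<dots> \<longleftrightarrow> pre_equiv \<alpha> z"
  proof -
    have g': "equiv_in (path_space w z) (path_space y z) (path_concat \<gamma>)" using assms(3) by (simp add: pre_equiv_iff[OF g])
    show ?thesis unfolding pre_equiv_iff[OF a]
      by (rule iffI, erule equiv_2of3(2)[OF cg ca g'], erule equiv_2of3(1)[OF cg ca g'])
  qed
  finally show ?thesis .
qed

lemma pre_equiv_homotopic:
  assumes "path_component_of (path_space x y) \<alpha> \<alpha>'"
  shows "pre_equiv \<alpha> z \<longleftrightarrow> pre_equiv \<alpha>' z"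
proof -
  obtain c where c: "continuous_map unit_interval (path_space x y) c" "c 0 = \<alpha>" "c 1 = \<alpha>'"
    using assms by (auto simp: path_component_of_def pathin_def)
  have a: "\<alpha> \<in> paths x y" "\<alpha>' \<in> paths x y"
    using continuous_map_into_dpath_space_in[OF c(1), of 0] continuous_map_into_dpath_space_in[OF c(1), of 1] c(2,3) by auto
  have "continuous_map (prod_topology unit_interval (path_space y z)) (path_space x z) (\<lambda>p. path_concat (c (fst p)) (snd p))"
    by (rule continuous_map_concat[OF continuous_map_compose'[OF c(1) continuous_map_fst] continuous_map_snd])
  then have "homotopic_with (\<lambda>_. True) (path_space y z) (path_space x z) (path_concat \<alpha>) (path_concat \<alpha>')"
    unfolding homotopic_with_def using c by (intro exI[of _ "\<lambda>p. path_concat (c (fst p)) (snd p)"]) auto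
  from equiv_homotopic[OF this] show ?thesis by (simp add: pre_equiv_iff[OF a(1)] pre_equiv_iff[OF a(2)])
qed

lemma extension_equiv_pre:
  assumes a: "\<alpha> \<in> paths x y" and b: "\<beta> \<in> paths b b'" and p: "pre_equiv \<alpha> b"
  shows "extension_equivalence F X \<alpha> \<beta> \<longleftrightarrow> post_equiv x \<beta>"
proof -
  have ca: "continuous_map (path_space y b) (path_space x b) (path_concat \<alpha>)"
    and cb: "continuous_map (path_space x b) (path_space x b') (\<lambda>\<omega>. path_concat \<omega> \<beta>)"
    using a b by (auto intro: continuous_map_concat_left continuous_map_concat_right)
  show ?thesis
  proof -
    have p': "equiv_in (path_space y b) (path_space x b) (path_concat \<alpha>)" using p by (simp add: pre_equiv_iff[OF a])
    show ?thesis unfolding post_equiv_iff[OF b] extension_equivalence_def using pathsD[OF a] pathsD[OF b]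
      by (simp, intro iffI) (rule equiv_2of3(2)[OF ca cb p'], assumption, rule equiv_2of3(1)[OF ca cb p'], assumption)
  qed
qed

lemma extension_equiv_assoc:
  assumes a: "\<alpha> \<in> paths x y" and b: "\<beta> \<in> paths b b'"
  shows "extension_equivalence F X \<alpha> \<beta> \<longleftrightarrow>
    equiv_in (path_space y b) (path_space x b') (\<lambda>\<omega>. path_concat \<alpha> (path_concat \<omega> \<beta>))"
  using equiv_homotopic[OF homotopic_concat_assoc[of "path_space y b" x y "\<lambda>_. \<alpha>" b "\<lambda>\<omega>. \<omega>" b' "\<lambda>_. \<beta>"]] a b
    pathsD[OF a] pathsD[OF b]
  by (simp add: extension_equivalence_def)

lemma extension_equiv_post:
  assumes a: "\<alpha> \<in> paths x y" and b: "\<beta> \<in> paths b b'" and p: "post_equiv y \<beta>"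
  shows "extension_equivalence F X \<alpha> \<beta> \<longleftrightarrow> pre_equiv \<alpha> b'"
proof -
  have ca: "continuous_map (path_space y b') (path_space x b') (path_concat \<alpha>)"
    and cb: "continuous_map (path_space y b) (path_space y b') (\<lambda>\<omega>. path_concat \<omega> \<beta>)"
    using a b by (auto intro: continuous_map_concat_left continuous_map_concat_right)
  have p': "equiv_in (path_space y b) (path_space y b') (\<lambda>\<omega>. path_concat \<omega> \<beta>)" using p b by (simp add: post_equiv_iff)
  show ?thesis unfolding extension_equiv_assoc[OF a b] pre_equiv_iff[OF a]
    by (rule iffI, erule equiv_2of3(2)[OF cb ca p'], erule equiv_2of3(1)[OF cb ca p'])
qed

lemma pre_equiv_const:
  assumes "x \<in> topspace (dtop X)" shows "pre_equiv (const_path x) z"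
proof -
  have "homotopic_with (\<lambda>_. True) (path_space x z) (path_space x z) (\<lambda>\<omega>. \<omega>) (path_concat (const_path x))"
    using homotopic_concat_const_left[OF assms, of "path_space x z" z "\<lambda>\<omega>. \<omega>"] by simp
  from equiv_homotopic[OF this] show ?thesis by (simp add: pre_equiv_def equiv_id)
qed

lemma post_equiv_const:
  assumes "y \<in> topspace (dtop X)" shows "post_equiv x (const_path y)"
proof -
  have "homotopic_with (\<lambda>_. True) (path_space x y) (path_space x y) (\<lambda>\<omega>. \<omega>) (\<lambda>\<omega>. path_concat \<omega> (const_path y))"
    using homotopic_concat_const_right[OF assms, of "path_space x y" x "\<lambda>\<omega>. \<omega>"] by simp
  from equiv_homotopic[OF this] show ?thesis by (simp add: post_equiv_def equiv_id)
qed

lemma extension_equiv_const_right: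
  "\<alpha> \<in> paths x y \<Longrightarrow> b \<in> topspace (dtop X) \<Longrightarrow> extension_equivalence F X \<alpha> (const_path b) \<longleftrightarrow> pre_equiv \<alpha> b"
  by (rule extension_equiv_post[OF _ dpaths_const post_equiv_const])

text \<open>Prepending \<open>\<alpha>\<close> and appending \<open>\<beta>\<close> commute up to
  homotopy; three sides of the square are equivalences.\<close>

lemma pre_equiv_square:
  assumes a: "\<alpha> \<in> paths x y" and b: "\<beta> \<in> paths b b'"
    and "pre_equiv \<alpha> b'" "post_equiv x \<beta>" "post_equiv y \<beta>"
  shows "pre_equiv \<alpha> b"
proof -
  have ca: "continuous_map (path_space y b) (path_space x b) (path_concat \<alpha>)"
    and cb: "continuous_map (path_space x b) (path_space x b') (\<lambda>\<omega>. path_concat \<omega> \<beta>)"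
    using a b by (auto intro: continuous_map_concat_left continuous_map_concat_right)
  have "extension_equivalence F X \<alpha> \<beta>" using extension_equiv_post[OF a b] assms by simp
  then have e: "equiv_in (path_space y b) (path_space x b') (\<lambda>\<omega>. path_concat (path_concat \<alpha> \<omega>) \<beta>)"
    using pathsD[OF a] pathsD[OF b] by (simp add: extension_equivalence_def)
  show ?thesis unfolding pre_equiv_iff[OF a]
    by (rule equiv_2of3(3)[OF ca cb _ e]) (use assms(4) in \<open>simp add: post_equiv_iff[OF b]\<close>)
qed

lemma pre_equiv_nonempty:
  assumes "\<alpha> \<in> paths x y" "pre_equiv \<alpha> z" shows "paths x z = {} \<longleftrightarrow> paths y z = {}"
  using equiv_pi0(1)[OF continuous_map_concat_left[OF assms(1)]] assms by (simp add: pre_equiv_iff)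

lemma pre_equiv_contractible:
  assumes "\<alpha> \<in> paths x y" "pre_equiv \<alpha> z"
  shows "F_contractible F (path_space x z) \<longleftrightarrow> F_contractible F (path_space y z)"
  using contractible_transfer[OF continuous_map_concat_left[OF assms(1)]] assms by (simp add: pre_equiv_iff)

lemma post_equiv_contractible:
  assumes "\<beta> \<in> paths b b'" "post_equiv x \<beta>"
  shows "F_contractible F (path_space x b) \<longleftrightarrow> F_contractible F (path_space x b')"
  using contractible_transfer[OF continuous_map_concat_right[OF assms(1)]] assms by (simp add: post_equiv_iff)

lemma contractible_homotopic:
  assumes "F_contractible F (path_space x y)" "\<alpha> \<in> paths x y" "\<alpha>' \<in> paths x y"
  shows "path_component_of (path_space x y) \<alpha> \<alpha>'"
  using contractible_pi0(2)[OF assms(1)] assms(2,3) by (auto simp: path_connected_space_iff_path_component)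

text \<open>Without loops the space of d-paths from \<open>x\<close> to \<open>x\<close> has just
  one point.\<close>

lemma contractible_loops:
  assumes "x \<in> topspace (dtop X)" shows "F_contractible F (path_space x x)"
proof (rule F_contractible_singleton[OF F inj_embedding])
  show "topspace (path_space x x) = {const_path x}"
    unfolding topspace_dpath_space using dpaths_const[OF assms] no_loop by blast
qed

text \<open>The d-paths \<open>\<alpha> * \<gamma>\<close> and \<open>\<delta>\<close> lie in the
  same path component, since an \<open>F\<close>-contractible space is path connected; so
  prepending them gives homotopic maps, and 2-out-of-3 applies.\<close>

lemma pre_equiv_via:
  assumes a: "\<alpha> \<in> paths x y" and "F_contractible F (path_space x w)"
    and g: "\<gamma> \<in> paths y w" "pre_equiv \<gamma> z" and d: "\<delta> \<in> paths x w" "pre_equiv \<delta> z"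
  shows "pre_equiv \<alpha> z"
proof -
  have "pre_equiv (path_concat \<alpha> \<gamma>) z \<longleftrightarrow> pre_equiv \<delta> z"
    by (rule pre_equiv_homotopic[OF contractible_homotopic[OF assms(2) dpaths_concat[OF a g(1)] d(1)]])
  then show ?thesis using pre_equiv_concat[OF a g] d(2) by simp
qed

text \<open>The homotopy inverse of prepending the trace of \<open>x\<close> is to apply the final
  map of the flow. One composite is deformed to the identity by prepending only the part of the
  trace up to time \<open>s\<close> and applying the flow at time \<open>s\<close>. For the other
  one, the final map turns the trace into a loop, because the endpoint \<open>y\<close> is fixed,
  and this loop is constant.\<close>

lemma pre_equiv_flow:
  assumes H: "continuous_map (prod_topology unit_interval (dtop X)) (dtop X) H"
    and H0: "\<And>p. p \<in> topspace (dtop X) \<Longrightarrow> H (0, p) = p"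
    and dmap: "\<And>s \<alpha>. s \<in> {0..1} \<Longrightarrow> \<alpha> \<in> dpaths X \<Longrightarrow> (\<lambda>t\<in>{0..1}. H (s, \<alpha> t)) \<in> dpaths X"
    and trace: "\<And>p. p \<in> topspace (dtop X) \<Longrightarrow> (\<lambda>s\<in>{0..1}. H (s, p)) \<in> dpaths X"
    and z: "\<And>s. s \<in> {0..1} \<Longrightarrow> H (s, z) = z" and y: "\<And>s. s \<in> {0..1} \<Longrightarrow> H (s, y) = y"
    and x: "x \<in> topspace (dtop X)" "H (1, x) = y"
  shows "pre_equiv (\<lambda>s\<in>{0..1}. H (s, x)) z"
proof -
  define \<gamma> where "\<gamma> = (\<lambda>s\<in>{0..1}. H (s, x))"
  have g: "\<gamma> \<in> paths x y" using trace[OF x(1)] H0 x by (simp add: dpaths_from_to_def \<gamma>_def)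
  define \<Phi> where "\<Phi> = (\<lambda>s \<omega>. \<lambda>t\<in>{0..1::real}. H (s, \<omega> t) :: 'a)"
  let ?Q = "\<lambda>Z. prod_topology (prod_topology unit_interval Z) unit_interval"
  have ff: "continuous_map (?Q Z) unit_interval (\<lambda>p. fst (fst p))" for Z :: "(real \<Rightarrow> 'a) topology"
    by (rule continuous_map_compose'[OF continuous_map_fst]) (rule continuous_map_fst)
  have cont_flow: "continuous_map (?Q (path_space u v)) (dtop X) (\<lambda>p. \<Phi> (fst (fst p)) (snd (fst p)) (snd p))" for u v
  proof (rule continuous_map_eq)
    show "continuous_map (?Q (path_space u v)) (dtop X) (\<lambda>p. H (fst (fst p), snd (fst p) (snd p)))"
      by (rule continuous_map_compose_pair[OF H ff continuous_map_eval_dpath_space[OF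
            continuous_map_compose'[OF continuous_map_snd continuous_map_fst] continuous_map_snd]])
  qed (auto simp: \<Phi>_def)
  have flow_path: "\<Phi> s \<omega> \<in> paths (H (s, u)) (H (s, v))" if "s \<in> {0..1}" "\<omega> \<in> paths u v" for s \<omega> u v
    using dmap[OF that(1), of \<omega>] that(2) by (simp add: dpaths_from_to_def \<Phi>_def)
  have cflow1: "continuous_map (path_space x z) (path_space y z) (\<Phi> 1)"
  proof (rule continuous_map_into_dpath_space)
    show "continuous_map (prod_topology (path_space x z) unit_interval) (dtop X) (\<lambda>p. \<Phi> 1 (fst p) (snd p))"
    proof (rule continuous_map_eq)
      show "continuous_map (prod_topology (path_space x z) unit_interval) (dtop X) (\<lambda>p. H (1, fst p (snd p)))"
        by (rule continuous_map_compose_pair[OF H _ continuous_map_eval_dpath_space[OF continuous_map_fst continuous_map_snd]]) simp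
    qed (auto simp: \<Phi>_def)
    show "\<Phi> 1 \<omega> \<in> paths y z" if "\<omega> \<in> topspace (path_space x z)" for \<omega>
      using flow_path[of 1 \<omega> x z] that x z by auto
  qed
  have cg: "continuous_map (path_space y z) (path_space x z) (path_concat \<gamma>)"
    by (rule continuous_map_concat_left[OF g])
  have Hx: "H (s, x) \<in> topspace (dtop X)" if "s \<in> {0..1}" for s
    using continuous_map_funspace[OF H] that x by auto
  have const_ext: "\<omega> \<in> extensional {0..1}" if "\<omega> \<in> paths u v" for \<omega> u v
    using dpath_extensional that by (auto simp: dpaths_from_to_def)
  have "homotopic_with (\<lambda>_. True) (path_space x z) (path_space x z)
      (\<lambda>\<omega>. path_concat (const_path x) \<omega>) (path_concat \<gamma> \<circ> \<Phi> 1)"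
  proof (rule homotopic_into_dpath_space)
    let ?g = "\<lambda>s. \<lambda>t\<in>{0..1}. H (s * t, x)"
    have "continuous_map (?Q (path_space x z)) (dtop X) (\<lambda>p. ?g (fst (fst p)) (snd p))"
    proof (rule continuous_map_eq)
      have "continuous_map (?Q (path_space x z)) unit_interval (\<lambda>p. fst (fst p) * snd p)"
        unfolding continuous_map_into_unit_interval
        using ff[of "path_space x z"] continuous_map_snd_real
        by (intro conjI continuous_intros) (auto simp: continuous_map_in_subtopology mult_le_one)
      then show "continuous_map (?Q (path_space x z)) (dtop X) (\<lambda>p. H (fst (fst p) * snd p, x))"
        using x by (intro continuous_map_compose_pair[OF H]) auto
    qed auto
    then show "continuous_map (?Q (path_space x z)) (dtop X)
        (\<lambda>p. path_concat (?g (fst (fst p))) (\<Phi> (fst (fst p)) (snd (fst p))) (snd p))"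
      by (rule continuous_map_path_concat[where a = "\<lambda>q. ?g (fst q)" and b = "\<lambda>q. \<Phi> (fst q) (snd q)", OF _ cont_flow])
        (auto simp: \<Phi>_def dest: pathsD)
    show "path_concat (?g s) (\<Phi> s \<omega>) \<in> paths x z" if s: "s \<in> {0..1}" and w: "\<omega> \<in> topspace (path_space x z)" for s \<omega>
    proof (rule dpaths_concat)
      have "restrict (\<gamma> \<circ> (\<lambda>t. s * t)) {0..1} \<in> dpaths X"
        using g s by (intro dpaths_reparam continuous_intros mono_onI mult_left_mono)
          (auto simp: dpaths_from_to_def mult_le_one)
      moreover have "restrict (\<gamma> \<circ> (\<lambda>t. s * t)) {0..1} = ?g s"
        using s by (auto simp: \<gamma>_def fun_eq_iff mult_le_one)
      ultimately show "?g s \<in> paths x (H (s, x))" using H0 x by (simp add: dpaths_from_to_def)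
      show "\<Phi> s \<omega> \<in> paths (H (s, x)) z" using flow_path[OF s, of \<omega> x z] w z s by simp
    qed
    fix \<omega> assume w: "\<omega> \<in> topspace (path_space x z)"
    have "\<Phi> 0 \<omega> = \<omega>"
      using w const_ext[of \<omega> x z] dpath_in_space[of \<omega>] H0
      by (intro extensionalityI[of _ "{0..1}"]) (auto simp: \<Phi>_def dpaths_from_to_def)
    moreover have "?g 0 = const_path x" using H0 x by (auto simp: const_path_def)
    ultimately show "path_concat (?g 0) (\<Phi> 0 \<omega>) = path_concat (const_path x) \<omega>" by simp
    show "path_concat (?g 1) (\<Phi> 1 \<omega>) = (path_concat \<gamma> \<circ> \<Phi> 1) \<omega>" by (simp add: \<gamma>_def)
  qed
  moreover have "homotopic_with (\<lambda>_. True) (path_space x z) (path_space x z) (\<lambda>\<omega>. \<omega>) (\<lambda>\<omega>. path_concat (const_path x) \<omega>)"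
    using homotopic_concat_const_left[OF x(1), of "path_space x z" z "\<lambda>\<omega>. \<omega>"] by simp
  ultimately have 1: "homotopic_with (\<lambda>_. True) (path_space x z) (path_space x z) id (path_concat \<gamma> \<circ> \<Phi> 1)"
    unfolding id_def by (rule homotopic_with_trans[rotated])
  have y': "y \<in> topspace (dtop X)" using dpaths_from_to_ends(2)[OF g] .
  have g1: "\<Phi> 1 \<gamma> = const_path y"
    using flow_path[of 1 \<gamma> x y] g x y by (intro no_loop) auto
  have "homotopic_with (\<lambda>_. True) (path_space y z) (path_space y z)
      (\<lambda>\<omega>. path_concat (const_path y) \<omega>) (\<Phi> 1 \<circ> path_concat \<gamma>)"
  proof (rule homotopic_into_dpath_space)
    have "continuous_map (?Q (path_space y z)) (dtop X) (\<lambda>p. const_path y (snd p))"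
      by (rule continuous_map_eq[of _ _ "\<lambda>_. y"]) (use y' in \<open>auto simp: const_path_def\<close>)
    then show "continuous_map (?Q (path_space y z)) (dtop X)
        (\<lambda>p. path_concat (const_path y) (\<Phi> (fst (fst p)) (snd (fst p))) (snd p))"
      by (rule continuous_map_path_concat[where a = "\<lambda>q. const_path y" and b = "\<lambda>q. \<Phi> (fst q) (snd q)", OF _ cont_flow])
        (use y in \<open>auto simp: \<Phi>_def dpaths_from_to_def\<close>)
    show "path_concat (const_path y) (\<Phi> s \<omega>) \<in> paths y z" if s: "s \<in> {0..1}" and w: "\<omega> \<in> topspace (path_space y z)" for s \<omega>
      using flow_path[OF s, of \<omega> y z] w z y s by (intro dpaths_concat[OF dpaths_const[OF y']]) simp
    fix \<omega> assume w: "\<omega> \<in> topspace (path_space y z)"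
    have "\<Phi> 0 \<omega> = \<omega>"
      using w const_ext[of \<omega> y z] dpath_in_space[of \<omega>] H0
      by (intro extensionalityI[of _ "{0..1}"]) (auto simp: \<Phi>_def dpaths_from_to_def)
    then show "path_concat (const_path y) (\<Phi> 0 \<omega>) = path_concat (const_path y) \<omega>" by simp
    have "\<Phi> 1 (path_concat \<gamma> \<omega>) = path_concat (\<Phi> 1 \<gamma>) (\<Phi> 1 \<omega>)"
      by (auto simp: \<Phi>_def path_concat_def fun_eq_iff)
    then show "path_concat (const_path y) (\<Phi> 1 \<omega>) = (\<Phi> 1 \<circ> path_concat \<gamma>) \<omega>" by (simp add: g1)
  qed
  moreover have "homotopic_with (\<lambda>_. True) (path_space y z) (path_space y z) (\<lambda>\<omega>. \<omega>) (\<lambda>\<omega>. path_concat (const_path y) \<omega>)"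
    using homotopic_concat_const_left[OF y', of "path_space y z" z "\<lambda>\<omega>. \<omega>"] by simp
  ultimately have 2: "homotopic_with (\<lambda>_. True) (path_space y z) (path_space y z) id (\<Phi> 1 \<circ> path_concat \<gamma>)"
    unfolding id_def by (rule homotopic_with_trans[rotated])
  have "homotopy_inverse (path_space y z) (path_space x z) (path_concat \<gamma>) (\<Phi> 1)"
    unfolding homotopy_inverse_def using cg cflow1 1 2 by blast
  from equiv_homotopy_inverse[OF this] have "pre_equiv \<gamma> z" using pre_equiv_iff[OF g] by simp
  then show ?thesis by (simp add: \<gamma>_def)
qed

end

section \<open>Reversal of time\<close>

definition reverse_path :: "(real \<Rightarrow> 'a) \<Rightarrow> real \<Rightarrow> 'a" where
  "reverse_path \<alpha> = (\<lambda>t\<in>{0..1}. \<alpha> (1 - t))"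

text \<open>All past notions of \<open>X\<close> are future notions of \<open>opposite X\<close>,
  so that only the future case has to be proved.\<close>

definition opposite :: "'a dspace \<Rightarrow> 'a dspace" where
  "opposite X = \<lparr>dtop = dtop X, dpaths = reverse_path ` dpaths X\<rparr>"

lemma reverse_path_ends [simp]: "reverse_path \<alpha> 0 = \<alpha> 1" "reverse_path \<alpha> 1 = \<alpha> 0"
  by (simp_all add: reverse_path_def)

lemma reverse_reverse: "\<alpha> \<in> extensional {0..1} \<Longrightarrow> reverse_path (reverse_path \<alpha>) = \<alpha>"
  by (auto simp: reverse_path_def fun_eq_iff extensional_def)

lemma reverse_const [simp]: "reverse_path (const_path x) = const_path x"
  by (auto simp: reverse_path_def const_path_def)

lemma reverse_image [simp]: "reverse_path \<alpha> ` {0..1} = \<alpha> ` {0..1}"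
proof -
  have "(\<lambda>t::real. 1 - t) ` {0..1} = {0..1}" by simp
  then have "\<alpha> ` (\<lambda>t. 1 - t) ` {0..1} = \<alpha> ` {0..1}" by (rule arg_cong)
  then show ?thesis by (simp add: reverse_path_def image_comp o_def del: image_diff_atLeastAtMost)
qed

lemma reverse_concat:
  assumes "\<alpha> 1 = \<beta> 0" shows "reverse_path (path_concat \<alpha> \<beta>) = path_concat (reverse_path \<beta>) (reverse_path \<alpha>)"
proof
  fix t :: real
  show "reverse_path (path_concat \<alpha> \<beta>) t = path_concat (reverse_path \<beta>) (reverse_path \<alpha>) t"
  proof (cases "t = 1/2")
    case True
    show ?thesis unfolding True using assms by (simp add: reverse_path_def path_concat_def)
  next
    case False
    then show ?thesis by (auto simp: reverse_path_def path_concat_def algebra_simps)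
  qed
qed

context dspace begin

lemma reverse_paths_iff: "\<alpha> \<in> dpaths_from_to (opposite X) y x \<longleftrightarrow> \<alpha> \<in> extensional {0..1} \<and> reverse_path \<alpha> \<in> dpaths_from_to X x y"
proof
  assume "\<alpha> \<in> dpaths_from_to (opposite X) y x"
  then show "\<alpha> \<in> extensional {0..1} \<and> reverse_path \<alpha> \<in> dpaths_from_to X x y"
    using dpath_extensional by (auto simp: dpaths_from_to_def opposite_def reverse_reverse) (simp add: reverse_path_def)
next
  assume a: "\<alpha> \<in> extensional {0..1} \<and> reverse_path \<alpha> \<in> dpaths_from_to X x y"
  then have "reverse_path (reverse_path \<alpha>) \<in> dpaths (opposite X)"
    by (simp add: opposite_def dpaths_from_to_def)
  then show "\<alpha> \<in> dpaths_from_to (opposite X) y x" using a by (simp add: reverse_reverse dpaths_from_to_def)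
qed

lemma reverse_in_opposite: "\<alpha> \<in> dpaths_from_to X x y \<Longrightarrow> reverse_path \<alpha> \<in> dpaths_from_to (opposite X) y x"
  by (auto simp: dpaths_from_to_def opposite_def)

lemma opposite_d_space: "d_space (opposite X)"
  unfolding d_space_def
proof (intro conjI ballI allI impI)
  fix \<alpha> assume "\<alpha> \<in> dpaths (opposite X)"
  then obtain a where a: "a \<in> dpaths X" "\<alpha> = reverse_path a" by (auto simp: opposite_def)
  have "continuous_map unit_interval (dtop X) (\<lambda>t. a (1 - t))"
    by (rule continuous_map_compose'[OF dpath_continuous[OF a(1)]])
      (auto simp: continuous_map_into_unit_interval intro!: continuous_intros)
  then have "continuous_map unit_interval (dtop X) \<alpha>"
    by (rule continuous_map_eq) (auto simp: a reverse_path_def)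
  then show "pathin (dtop (opposite X)) \<alpha>" by (simp add: pathin_def opposite_def)
  show "\<alpha> \<in> extensional {0..1}" by (simp add: a reverse_path_def)
next
  fix x assume "x \<in> topspace (dtop (opposite X))"
  then have "const_path x \<in> dpaths X" using dpaths_const by (simp add: opposite_def dpaths_from_to_def)
  then show "const_path x \<in> dpaths (opposite X)" using reverse_const[of x] unfolding opposite_def by (metis dspace.select_convs(2) image_eqI)
next
  fix \<alpha> \<beta> assume "\<alpha> \<in> dpaths (opposite X)" "\<beta> \<in> dpaths (opposite X)" and e: "\<alpha> 1 = \<beta> 0"
  then obtain a b where ab: "a \<in> dpaths X" "\<alpha> = reverse_path a" "b \<in> dpaths X" "\<beta> = reverse_path b"
    by (auto simp: opposite_def)
  then have "path_concat b a \<in> dpaths X" using dpaths_concat[of b "b 0" "b 1" a "a 1"] e by (auto simp: dpaths_from_to_def)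
  moreover have "path_concat \<alpha> \<beta> = reverse_path (path_concat b a)" using e ab by (simp add: reverse_concat)
  ultimately show "path_concat \<alpha> \<beta> \<in> dpaths (opposite X)" by (simp add: opposite_def)
next
  fix \<alpha> \<phi> assume "\<alpha> \<in> dpaths (opposite X)"
    and \<phi>: "continuous_on {0..1} \<phi> \<and> \<phi> ` {0..1} \<subseteq> {0..1} \<and> mono_on {0..1} (\<phi> :: real \<Rightarrow> real)"
  then obtain a where a: "a \<in> dpaths X" "\<alpha> = reverse_path a" by (auto simp: opposite_def)
  let ?\<psi> = "\<lambda>t. 1 - \<phi> (1 - t)"
  have "restrict (a \<circ> ?\<psi>) {0..1} \<in> dpaths X"
  proof (rule dpaths_reparam[OF a(1)])
    show "continuous_on {0..1} ?\<psi>" 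
      by (intro continuous_intros continuous_on_compose2[OF conjunct1[OF \<phi>]]) auto
    show "?\<psi> ` {0..1} \<subseteq> {0..1}" using \<phi> by (auto simp: image_subset_iff)
    show "mono_on {0..1} ?\<psi>"
      using \<phi> monotone_onD[of "{0..1}" "(\<le>)" "(\<le>)" \<phi>] by (intro mono_onI) (simp add: diff_left_mono)
  qed
  moreover have "restrict (\<alpha> \<circ> \<phi>) {0..1} = reverse_path (restrict (a \<circ> ?\<psi>) {0..1})"
    using \<phi> by (auto simp: a reverse_path_def fun_eq_iff image_subset_iff)
  ultimately show "restrict (\<alpha> \<circ> \<phi>) {0..1} \<in> dpaths (opposite X)" by (simp add: opposite_def)
qed

lemma opposite_dspace: "dspace (opposite X)" using opposite_d_space by unfold_locales

lemma continuous_map_reverse: "continuous_map (dpath_space X x y) (dpath_space (opposite X) y x) reverse_path"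
proof -
  interpret op: dspace "opposite X" by (rule opposite_dspace)
  show ?thesis
  proof (rule op.continuous_map_into_dpath_space)
    have "continuous_map (prod_topology (dpath_space X x y) unit_interval) (dtop X) (\<lambda>p. fst p (1 - snd p))"
      by (rule continuous_map_eval_dpath_space[of _ x y])
        (auto simp: continuous_map_into_unit_interval intro!: continuous_intros continuous_map_snd_real)
    then show "continuous_map (prod_topology (dpath_space X x y) unit_interval) (dtop (opposite X)) (\<lambda>p. reverse_path (fst p) (snd p))"
      by (auto simp: opposite_def reverse_path_def intro: continuous_map_eq)
  qed (auto intro: reverse_in_opposite)
qed

lemma opposite_opposite: "opposite (opposite X) = X"
proof -
  have "reverse_path ` reverse_path ` dpaths X = dpaths X"
    using dpath_extensional reverse_reverse by (force simp: image_iff)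
  then show ?thesis by (simp add: opposite_def)
qed

lemma homeomorphic_reverse:
  "homeomorphic_maps (dpath_space X x y) (dpath_space (opposite X) y x) reverse_path reverse_path"
proof -
  interpret op: dspace "opposite X" by (rule opposite_dspace)
  show ?thesis
    unfolding homeomorphic_maps_def
    using continuous_map_reverse[of x y] op.continuous_map_reverse[of y x]
      dpath_extensional op.dpath_extensional
    by (auto simp: opposite_opposite reverse_reverse dpaths_from_to_def)
qed

end

context equivalence_setting begin

lemma opposite_setting: "equivalence_setting (opposite X) F"
proof (intro equivalence_setting.intro opposite_dspace equivalence_setting_axioms.intro F universe)
  fix \<alpha> x assume "\<alpha> \<in> dpaths_from_to (opposite X) x x"
  then have "\<alpha> \<in> extensional {0..1}" "reverse_path \<alpha> = const_path x"
    using no_loop[of "reverse_path \<alpha>" x] by (auto simp: reverse_paths_iff)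
  then show "\<alpha> = const_path x" using reverse_reverse[of \<alpha>] by simp
qed

lemma opposite_equivalence:
  assumes f: "continuous_map (path_space x y) (path_space x' y') f"
    and g: "\<And>\<omega>. \<omega> \<in> paths x y \<Longrightarrow> g (reverse_path \<omega>) = reverse_path (f \<omega>)"
  shows "equivalence_in F (dpath_space (opposite X) y x) (dpath_space (opposite X) y' x') g
     \<longleftrightarrow> equiv_in (path_space x y) (path_space x' y') f"
proof -
  interpret op: equivalence_setting "opposite X" F by (rule opposite_setting)
  have f': "continuous_map (path_space x y) (dpath_space (opposite X) y' x') (\<lambda>\<omega>. reverse_path (f \<omega>))"
    by (rule continuous_map_compose'[OF continuous_map_reverse f])
  have g': "continuous_map (dpath_space (opposite X) y x) (dpath_space (opposite X) y' x') g"
  proof (rule continuous_map_eq)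
    show "continuous_map (dpath_space (opposite X) y x) (dpath_space (opposite X) y' x') (\<lambda>\<omega>. reverse_path (f (reverse_path \<omega>)))"
      using op.continuous_map_reverse[of y x] by (intro continuous_map_compose'[OF f']) (simp add: opposite_opposite)
    fix \<omega> assume "\<omega> \<in> topspace (dpath_space (opposite X) y x)"
    then have w: "\<omega> \<in> extensional {0..1}" "reverse_path \<omega> \<in> paths x y" by (auto simp: reverse_paths_iff)
    show "reverse_path (f (reverse_path \<omega>)) = g \<omega>" using g[OF w(2)] w(1) by (simp add: reverse_reverse)
  qed
  have r: "equivalence_in F (path_space u v) (dpath_space (opposite X) v u) reverse_path" for u v
    by (rule equiv_homotopy_inverse[OF homeomorphic_maps_homotopy_inverse[OF homeomorphic_reverse]])
  have "equivalence_in F (dpath_space (opposite X) y x) (dpath_space (opposite X) y' x') g \<longleftrightarrow>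
      equivalence_in F (path_space x y) (dpath_space (opposite X) y' x') (\<lambda>\<omega>. g (reverse_path \<omega>))"
    by (rule iffI, erule equiv_2of3(1)[OF continuous_map_reverse g' r],
        erule equiv_2of3(2)[OF continuous_map_reverse g' r])
  also have "\<dots> \<longleftrightarrow> equivalence_in F (path_space x y) (dpath_space (opposite X) y' x') (\<lambda>\<omega>. reverse_path (f \<omega>))"
    by (rule equiv_homotopic, rule homotopic_with_equal[where P = "\<lambda>_. True"])
      (use continuous_map_compose'[OF g' continuous_map_reverse] g in auto)
  also have "\<dots> \<longleftrightarrow> equiv_in (path_space x y) (path_space x' y') f"
    by (rule iffI, erule equiv_2of3(3)[OF f continuous_map_reverse r],
        erule equiv_2of3(1)[OF f continuous_map_reverse _ r])
  finally show ?thesis .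
qed

lemma opposite_extension_equivalence:
  assumes a: "\<alpha> \<in> paths x y" and b: "\<beta> \<in> paths b b'"
  shows "extension_equivalence F (opposite X) (reverse_path \<beta>) (reverse_path \<alpha>) \<longleftrightarrow> extension_equivalence F X \<alpha> \<beta>"
proof -
  have c: "continuous_map (path_space y b) (path_space x b') (\<lambda>\<omega>. path_concat \<alpha> (path_concat \<omega> \<beta>))"
    using a b by (intro continuous_map_compose'[OF continuous_map_concat_left[OF a] continuous_map_concat_right])
  have "equivalence_in F (dpath_space (opposite X) b y) (dpath_space (opposite X) b' x)
      (\<lambda>\<omega>. path_concat (path_concat (reverse_path \<beta>) \<omega>) (reverse_path \<alpha>))
    \<longleftrightarrow> equiv_in (path_space y b) (path_space x b') (\<lambda>\<omega>. path_concat \<alpha> (path_concat \<omega> \<beta>))"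
  proof (rule opposite_equivalence[OF c])
    fix \<omega> assume w: "\<omega> \<in> paths y b"
    show "path_concat (path_concat (reverse_path \<beta>) (reverse_path \<omega>)) (reverse_path \<alpha>) =
        reverse_path (path_concat \<alpha> (path_concat \<omega> \<beta>))"
      using pathsD[OF a] pathsD[OF b] pathsD[OF w] by (simp add: reverse_concat)
  qed
  then show ?thesis using extension_equiv_assoc[OF a b] pathsD[OF a] pathsD[OF b]
    by (simp add: extension_equivalence_def)
qed

lemma opposite_pre_equiv:
  assumes "\<beta> \<in> paths b b'"
  shows "equivalence_setting.pre_equiv (opposite X) F (reverse_path \<beta>) x \<longleftrightarrow> post_equiv x \<beta>"
proof -
  interpret op: equivalence_setting "opposite X" F by (rule opposite_setting)
  show ?thesis
    using opposite_equivalence[OF continuous_map_concat_right[OF assms, of x], of "path_concat (reverse_path \<beta>)"] pathsD[OF assms]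
    by (simp add: op.pre_equiv_def post_equiv_def reverse_concat pathsD)
qed

lemma opposite_contractible: "F_contractible F (dpath_space (opposite X) y x) \<longleftrightarrow> F_contractible F (path_space x y)"
  by (rule contractible_transfer[OF continuous_map_reverse
        equiv_homotopy_inverse[OF homeomorphic_maps_homotopy_inverse[OF homeomorphic_reverse]], symmetric])

end

section \<open>The order of a d-space and stable future systems\<close>

context equivalence_setting begin

abbreviation space :: "'a set" where "space \<equiv> topspace (dtop X)"
abbreviation le :: "'a \<Rightarrow> 'a \<Rightarrow> bool" where "le \<equiv> dle X"

lemma le_iff: "le x y \<longleftrightarrow> paths x y \<noteq> {}"
  by (simp add: dle_def dpaths_between_eq)

lemma le_refl: "x \<in> space \<Longrightarrow> le x x"
  using dpaths_const by (auto simp: le_iff)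

lemma le_trans: "le x y \<Longrightarrow> le y z \<Longrightarrow> le x z"
  using dpaths_concat by (fastforce simp: le_iff)

lemma le_space: "le x y \<Longrightarrow> x \<in> space" "le x y \<Longrightarrow> y \<in> space"
  using dpaths_from_to_ends by (auto simp: le_iff)

text \<open>The two d-paths compose to a loop, which is constant and passes through
  \<open>y\<close>.\<close>

lemma le_antisym:
  assumes "le x y" "le y x" shows "x = y"
proof -
  obtain \<alpha> \<beta> where a: "\<alpha> \<in> paths x y" and b: "\<beta> \<in> paths y x" using assms by (auto simp: le_iff)
  have "path_concat \<alpha> \<beta> (1/2) = const_path x (1/2)" using no_loop[OF dpaths_concat[OF a b]] by simp
  then show ?thesis using pathsD[OF a] by (simp add: path_concat_def const_path_def)
qed

lemma path_le:
  assumes a: "\<alpha> \<in> paths x y" and t: "t \<in> {0..1}"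
  shows "le x (\<alpha> t)" "le (\<alpha> t) y"
proof -
  \<comment> \<open>The initial and the final piece of a d-path are reparametrizations of it.\<close>
  have "restrict (\<alpha> \<circ> (\<lambda>s. s * t)) {0..1} \<in> dpaths X"
    using a t by (intro dpaths_reparam continuous_intros mono_onI mult_right_mono) (auto simp: dpaths_from_to_def mult_le_one)
  then have "restrict (\<alpha> \<circ> (\<lambda>s. s * t)) {0..1} \<in> paths x (\<alpha> t)" using pathsD[OF a] by (simp add: dpaths_from_to_def)
  then show "le x (\<alpha> t)" by (auto simp: le_iff)
  have r: "(1 - s) * t + s \<in> {0..1}" if "s \<in> {0..1}" for s
    using that t convex_bound_le[of t 1 1 "1 - s" s] by auto
  have "mono_on {0..1} (\<lambda>s. (1 - s) * t + s)"
  proof (rule mono_onI)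
    fix r s :: real assume "r \<le> s"
    then have "0 \<le> (s - r) * (1 - t)" using t by (intro mult_nonneg_nonneg) auto
    then show "(1 - r) * t + r \<le> (1 - s) * t + s" by (simp add: algebra_simps)
  qed
  then have "restrict (\<alpha> \<circ> (\<lambda>s. (1 - s) * t + s)) {0..1} \<in> dpaths X"
    using a r by (intro dpaths_reparam continuous_intros) (auto simp: dpaths_from_to_def)
  then have "restrict (\<alpha> \<circ> (\<lambda>s. (1 - s) * t + s)) {0..1} \<in> paths (\<alpha> t) y" using pathsD[OF a] by (simp add: dpaths_from_to_def)
  then show "le (\<alpha> t) y" by (auto simp: le_iff)
qed

lemma d_convexD:
  assumes "d_convex X A" "x \<in> A" "y \<in> A" "le x w" "le w y"
  shows "w \<in> A"
proof -
  obtain \<alpha> \<beta> where a: "\<alpha> \<in> paths x w" and b: "\<beta> \<in> paths w y" using assms by (auto simp: le_iff)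
  let ?c = "path_concat \<alpha> \<beta>"
  have c: "?c \<in> paths x y" using dpaths_concat[OF a b] .
  then have "?c \<in> dpaths_between X space A A"
    using assms dpath_in_space by (auto simp: dpaths_between_def dpaths_in_def dpaths_from_to_def)
  then have "?c \<in> dpaths_between X A A A" using assms(1) by (simp add: d_convex_def)
  then have "?c (1/2) \<in> A" unfolding dpaths_between_def dpaths_in_def by (simp add: image_subset_iff)
  moreover have "?c (1/2) = w" using pathsD[OF a] by (simp add: path_concat_def)
  ultimately show ?thesis by simp
qed

lemma d_convexI:
  assumes "\<And>x y w. x \<in> A \<Longrightarrow> y \<in> A \<Longrightarrow> le x w \<Longrightarrow> le w y \<Longrightarrow> w \<in> A" "A \<subseteq> space"
  shows "d_convex X A"
proof -
  have "\<alpha> ` {0..1} \<subseteq> A" if "\<alpha> \<in> dpaths X" "\<alpha> 0 \<in> A" "\<alpha> 1 \<in> A" for \<alpha>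
  proof
    fix w assume "w \<in> \<alpha> ` {0..1}"
    then obtain t where t: "t \<in> {0..1}" "w = \<alpha> t" by blast
    have "\<alpha> \<in> paths (\<alpha> 0) (\<alpha> 1)" using that(1) by (simp add: dpaths_from_to_def)
    from path_le[OF this t(1)] show "w \<in> A" unfolding t(2) by (rule assms(1)[OF that(2,3)])
  qed
  then show ?thesis using assms(2) unfolding d_convex_def dpaths_between_def dpaths_in_def by auto
qed

lemma future_connectedD:
  assumes "future_connected X A" "x \<in> A" "y \<in> A" obtains z where "z \<in> A" "le x z" "le y z"
proof -
  obtain z where z: "z \<in> A" "dpaths_between X A {x} {z} \<noteq> {}" "dpaths_between X A {y} {z} \<noteq> {}"
    using assms unfolding future_connected_def by blast
  then have "le x z" "le y z"
    unfolding le_iff by (auto simp: dpaths_between_def dpaths_in_def dpaths_from_to_def)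
  with z that show thesis by blast
qed

lemma path_in_convex:
  assumes "d_convex X A" "\<alpha> \<in> paths x y" "x \<in> A" "y \<in> A"
  shows "\<alpha> \<in> dpaths_in X A"
  using d_convexD[OF assms(1,3,4) path_le[OF assms(2)]] assms(2) by (auto simp: dpaths_in_def dpaths_from_to_def)

lemma future_connectedI:
  assumes "d_convex X A" "\<And>x y. x \<in> A \<Longrightarrow> y \<in> A \<Longrightarrow> \<exists>z\<in>A. le x z \<and> le y z"
  shows "future_connected X A"
  unfolding future_connected_def
proof (intro ballI)
  fix x y assume xy: "x \<in> A" "y \<in> A"
  then obtain z where z: "z \<in> A" "le x z" "le y z" using assms(2) by blast
  then obtain \<alpha> \<beta> where "\<alpha> \<in> paths x z" "\<beta> \<in> paths y z" by (auto simp: le_iff)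
  then have "\<alpha> \<in> dpaths_between X A {x} {z}" "\<beta> \<in> dpaths_between X A {y} {z}"
    using path_in_convex[OF assms(1)] xy z pathsD by (auto simp: dpaths_between_def)
  then show "\<exists>z\<in>A. dpaths_between X A {x} {z} \<noteq> {} \<and> dpaths_between X A {y} {z} \<noteq> {}" using z by blast
qed

lemma St_futureI:
  assumes a: "\<alpha> \<in> paths x y" and z: "z \<in> B"
    and "\<And>b. b \<in> B \<Longrightarrow> le z b \<Longrightarrow> pre_equiv \<alpha> b"
    and "\<And>b b' \<beta>. b \<in> B \<Longrightarrow> b' \<in> B \<Longrightarrow> le z b \<Longrightarrow> \<beta> \<in> paths b b' \<Longrightarrow> post_equiv x \<beta>"
  shows "z \<in> St_future F X \<alpha> B"
  unfolding St_future_def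
proof (intro CollectI conjI z ballI)
  fix \<beta> assume "\<beta> \<in> dpaths_in X (upper_part X B z)"
  then have b: "\<beta> \<in> paths (\<beta> 0) (\<beta> 1)" "\<beta> 0 \<in> B" "\<beta> 1 \<in> B" "le z (\<beta> 0)"
    by (auto simp: dpaths_in_def upper_part_def dpaths_from_to_def image_subset_iff)
  then show "extension_equivalence F X \<alpha> \<beta>"
    using extension_equiv_pre[OF a b(1)] assms(3,4) by blast
qed

text \<open>Taking a constant d-path for \<open>\<beta>\<close> isolates prepending
  \<open>\<alpha>\<close>, and then 2-out-of-3 isolates appending \<open>\<beta>\<close>.
  Convexity ensures that d-paths between points of \<open>B\<close> are among the
  \<open>\<beta>\<close> of the definition.\<close>

lemma St_futureD:
  assumes a: "\<alpha> \<in> paths x y" and z: "z \<in> St_future F X \<alpha> B" and B: "d_convex X B"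
  shows "z \<in> B" "\<And>b. b \<in> B \<Longrightarrow> le z b \<Longrightarrow> pre_equiv \<alpha> b"
    "\<And>b b' \<beta>. b \<in> B \<Longrightarrow> b' \<in> B \<Longrightarrow> le z b \<Longrightarrow> \<beta> \<in> paths b b' \<Longrightarrow> post_equiv x \<beta>"
proof -
  show "z \<in> B" using z by (simp add: St_future_def)
  have pre: "pre_equiv \<alpha> b" if b: "b \<in> B" "le z b" for b
  proof -
    have bs: "b \<in> space" using b le_space by blast
    have "const_path b \<in> dpaths_in X (upper_part X B z)"
      using dpaths_const[OF bs] b by (auto simp: dpaths_in_def upper_part_def dpaths_from_to_def const_path_def)
    then have "extension_equivalence F X \<alpha> (const_path b)" using z by (simp add: St_future_def)
    then show ?thesis using extension_equiv_const_right[OF a bs] by simp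
  qed
  show "pre_equiv \<alpha> b" if "b \<in> B" "le z b" for b using pre that .
  show "post_equiv x \<beta>" if b: "b \<in> B" "b' \<in> B" "le z b" "\<beta> \<in> paths b b'" for b b' \<beta>
  proof -
    have "\<beta> ` {0..1} \<subseteq> upper_part X B z"
      using path_in_convex[OF B b(4,1,2)] le_trans[OF b(3)] path_le[OF b(4)] by (auto simp: dpaths_in_def upper_part_def)
    then have "\<beta> \<in> dpaths_in X (upper_part X B z)" using b(4) by (simp add: dpaths_in_def dpaths_from_to_def)
    then have "extension_equivalence F X \<alpha> \<beta>" using z by (simp add: St_future_def)
    then show ?thesis using extension_equiv_pre[OF a b(4)] pre[OF b(1,3)] by simp
  qed
qed

end

locale future_system = equivalence_setting X F for X :: "'a dspace" and F :: "'u morphism_family" +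
  fixes \<S> :: "'a set set"
  assumes system: "stable_future_component_system F X \<S>"
begin

lemma disjoint: "pairwise disjnt \<S>" and cover: "\<Union>\<S> = space"
  and convex: "A \<in> \<S> \<Longrightarrow> d_convex X A" and connected: "A \<in> \<S> \<Longrightarrow> future_connected X A"
  and trivial: "A \<in> \<S> \<Longrightarrow> future_trivial F X A"
  and stable: "A \<in> \<S> \<Longrightarrow> B \<in> \<S> \<Longrightarrow> future_stable F X A B"
  using system by (auto simp: stable_future_component_system_def)

lemma member_nonempty: "A \<in> \<S> \<Longrightarrow> A \<noteq> {}"
  using trivial[of A] by (auto simp: future_trivial_def future_stable_path_spaces_def)

lemma member_space: "A \<in> \<S> \<Longrightarrow> x \<in> A \<Longrightarrow> x \<in> space"
  using cover by blast

definition comp :: "'a \<Rightarrow> 'a set" where "comp x = (THE A. A \<in> \<S> \<and> x \<in> A)"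

lemma comp_eq: "A \<in> \<S> \<Longrightarrow> x \<in> A \<Longrightarrow> comp x = A"
  unfolding comp_def by (rule the_equality) (use disjoint in \<open>auto simp: pairwise_def disjnt_iff\<close>)

lemma comp_in: assumes "x \<in> space" shows "comp x \<in> \<S>" "x \<in> comp x"
proof -
  obtain A where "A \<in> \<S>" "x \<in> A" using assms cover by blast
  then show "comp x \<in> \<S>" "x \<in> comp x" using comp_eq by auto
qed

lemma directed2:
  assumes "A \<in> \<S>" "x \<in> A" "y \<in> A" obtains z where "z \<in> A" "le x z" "le y z"
  using future_connectedD[OF connected[OF assms(1)] assms(2,3)] .

lemma directed3:
  assumes A: "A \<in> \<S>" and "w \<in> A" "x \<in> A" "y \<in> A" obtains z where "z \<in> A" "le w z" "le x z" "le y z"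
proof -
  obtain u where u: "u \<in> A" "le w u" "le x u" using directed2[OF A assms(2,3)] .
  obtain z where "z \<in> A" "le u z" "le y z" using directed2[OF A u(1) assms(4)] .
  then show thesis using that u le_trans by blast
qed

lemma directed4:
  assumes A: "A \<in> \<S>" and "v \<in> A" "w \<in> A" "x \<in> A" "y \<in> A"
  obtains z where "z \<in> A" "le v z" "le w z" "le x z" "le y z"
proof -
  obtain u where u: "u \<in> A" "le v u" "le w u" using directed2[OF A assms(2,3)] .
  obtain z where "z \<in> A" "le u z" "le x z" "le y z" using directed3[OF A u(1) assms(4,5)] .
  then show thesis using that u le_trans by blast
qed

text \<open>Together with \<open>far_post\<close> and \<open>far_contractible\<close> this says
  what stability and triviality mean for all sufficiently late points of a member. As members are
  directed, finitely many statements of this form hold from a common point on.\<close>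

lemma far_pre:
  assumes A: "A \<in> \<S>" "B \<in> \<S>" and a: "\<alpha> \<in> paths x y" "x \<in> A" "y \<in> A"
  obtains z where "z \<in> B" "\<And>b. b \<in> B \<Longrightarrow> le z b \<Longrightarrow> pre_equiv \<alpha> b"
proof -
  have "\<alpha> \<in> dpaths_in X A" using path_in_convex[OF convex[OF A(1)] a] .
  then obtain z where "z \<in> St_future F X \<alpha> B" using stable[OF A] by (auto simp: future_stable_def)
  from St_futureD(1,2)[OF a(1) this convex[OF A(2)]] that show thesis by blast
qed

lemma far_post:
  assumes A: "B \<in> \<S>" and x: "x \<in> space"
  obtains z where "z \<in> B" "\<And>b b' \<beta>. b \<in> B \<Longrightarrow> b' \<in> B \<Longrightarrow> le z b \<Longrightarrow> \<beta> \<in> paths b b' \<Longrightarrow> post_equiv x \<beta>"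
proof -
  have a: "const_path x \<in> paths x x" using dpaths_const[OF x] .
  have "const_path x \<in> dpaths_in X (comp x)" using path_in_convex[OF convex a] comp_in[OF x] by blast
  then obtain z where "z \<in> St_future F X (const_path x) B"
    using stable[OF comp_in(1)[OF x] A] by (auto simp: future_stable_def)
  from St_futureD(1,3)[OF a this convex[OF A]] that show thesis by blast
qed

text \<open>Stability and convexity make this a partial order on the members of the system.\<close>

definition ale :: "'a set \<Rightarrow> 'a set \<Rightarrow> bool" where "ale A B \<longleftrightarrow> (\<exists>x\<in>A. \<exists>y\<in>B. le x y)"

text \<open>A d-path from \<open>x\<close> in \<open>A\<close> to \<open>B\<close> shows that the
  path spaces from \<open>x\<close> to late points of \<open>B\<close> are not empty. Stability
  transports this to a point \<open>w\<close> of \<open>A\<close> above both \<open>x\<close> and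
  \<open>y\<close>, as equivalences detect emptiness.\<close>

lemma ale_above:
  assumes A: "A \<in> \<S>" "B \<in> \<S>" and "ale A B" "y \<in> A" "b0 \<in> B"
  obtains b where "b \<in> B" "le y b" "le b0 b"
proof -
  obtain x b1 where x: "x \<in> A" "b1 \<in> B" "le x b1" using assms by (auto simp: ale_def)
  obtain w where w: "w \<in> A" "le x w" "le y w" using future_connectedD[OF connected[OF A(1)] x(1) assms(4)] .
  obtain \<alpha> where a: "\<alpha> \<in> paths x w" using w by (auto simp: le_iff)
  obtain z where z: "z \<in> B" "\<And>b. b \<in> B \<Longrightarrow> le z b \<Longrightarrow> pre_equiv \<alpha> b" by (rule far_pre[OF A a x(1) w(1)]) (rule that)
  obtain b where b: "b \<in> B" "le z b" "le b1 b" "le b0 b" using directed3[OF A(2) z(1) x(2) assms(5)] .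
  have "paths x b \<noteq> {}" using le_trans[OF x(3) b(3)] by (simp add: le_iff)
  then have "le w b" using pre_equiv_nonempty[OF a z(2)[OF b(1,2)]] by (simp add: le_iff)
  with le_trans[OF w(3)] that b show thesis by blast
qed

lemma ale_refl: "A \<in> \<S> \<Longrightarrow> ale A A"
  using member_nonempty member_space le_refl unfolding ale_def by blast

lemma ale_trans: assumes "A \<in> \<S>" "B \<in> \<S>" "C \<in> \<S>" "ale A B" "ale B C" shows "ale A C"
proof -
  obtain x y where x: "x \<in> A" "y \<in> B" "le x y" using assms by (auto simp: ale_def)
  obtain c where "c \<in> C" "le y c" using ale_above[OF assms(2,3,5) x(2)] assms(3) member_nonempty by blast
  then show ?thesis using x le_trans unfolding ale_def by blast
qed

text \<open>From \<open>x\<close> in \<open>A\<close> one reaches \<open>y\<close> in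
  \<open>B\<close> and from there \<open>A\<close> again, so \<open>y\<close> lies in
  \<open>A\<close> by convexity.\<close>

lemma ale_antisym: assumes "A \<in> \<S>" "B \<in> \<S>" "ale A B" "ale B A" shows "A = B"
proof -
  obtain x y where x: "x \<in> A" "y \<in> B" "le x y" using assms by (auto simp: ale_def)
  obtain a where a: "a \<in> A" "le y a" using ale_above[OF assms(2,1,4) x(2) x(1)] by blast
  have "y \<in> A" using d_convexD[OF convex[OF assms(1)] x(1) a(1) x(3) a(2)] .
  then show ?thesis using comp_eq assms(1,2) x(2) by blast
qed

lemma comp_mono: "le x y \<Longrightarrow> ale (comp x) (comp y)"
  using comp_in le_space unfolding ale_def by blast

text \<open>Triviality provides one contractible path space, starting at \<open>a0\<close>. A
  zigzag from \<open>a0\<close> to \<open>a\<close> through a common upper bound in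
  \<open>A\<close>, whose two legs give equivalences for late endpoints, moves the starting point.\<close>

lemma far_contractible:
  assumes A: "A \<in> \<S>" and a: "a \<in> A"
  obtains z where "z \<in> A" "\<And>b. b \<in> A \<Longrightarrow> le z b \<Longrightarrow> F_contractible F (path_space a b)"
proof -
  obtain a0 z0 where a0: "a0 \<in> A" "z0 \<in> St_future F X (const_path a0) A" "F_contractible F (path_space a0 z0)"
    using trivial[OF A] by (auto simp: future_trivial_def future_stable_path_spaces_def)
  note St = St_futureD[OF dpaths_const[OF member_space[OF A a0(1)]] a0(2) convex[OF A]]
  obtain w where w: "w \<in> A" "le a w" "le a0 w" using future_connectedD[OF connected[OF A] a a0(1)] .
  obtain \<alpha> \<alpha>0 where p: "\<alpha> \<in> paths a w" "\<alpha>0 \<in> paths a0 w" using w by (auto simp: le_iff)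
  obtain z1 where z1: "z1 \<in> A" "\<And>b. b \<in> A \<Longrightarrow> le z1 b \<Longrightarrow> pre_equiv \<alpha> b" by (rule far_pre[OF A A p(1) a w(1)]) (rule that)
  obtain z2 where z2: "z2 \<in> A" "\<And>b. b \<in> A \<Longrightarrow> le z2 b \<Longrightarrow> pre_equiv \<alpha>0 b" by (rule far_pre[OF A A p(2) a0(1) w(1)]) (rule that)
  obtain z where z: "z \<in> A" "le z0 z" "le z1 z" "le z2 z" using directed3[OF A St(1) z1(1) z2(1)] .
  have "F_contractible F (path_space a b)" if b: "b \<in> A" "le z b" for b
  proof -
    obtain \<beta> where "\<beta> \<in> paths z0 b" using le_trans[OF z(2) b(2)] by (auto simp: le_iff)
    then have "F_contractible F (path_space a0 b)"
      using post_equiv_contractible[of _ z0 b a0] St(3)[OF St(1) b(1) le_refl[OF member_space[OF A St(1)]]] a0(3) by simp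
    then show ?thesis
      using pre_equiv_contractible[OF p(1) z1(2)[OF b(1) le_trans[OF z(3) b(2)]]]
        pre_equiv_contractible[OF p(2) z2(2)[OF b(1) le_trans[OF z(4) b(2)]]] by simp
  qed
  with z(1) that show thesis by blast
qed

end

section \<open>Joining a finite system with another one\<close>

definition meets :: "'a set set \<Rightarrow> 'a set set \<Rightarrow> ('a \<times> 'a) set" where
  "meets \<A> \<B> = {(x, y). \<exists>S\<in>\<A> \<union> \<B>. x \<in> S \<and> y \<in> S}"

text \<open>The relation \<open>meets\<close> is symmetric, so its reflexive transitive closure is
  the equivalence relation it generates on \<open>U\<close>.\<close>

definition join_partition :: "'a set \<Rightarrow> 'a set set \<Rightarrow> 'a set set \<Rightarrow> 'a set set" where
  "join_partition U \<A> \<B> = (\<lambda>x. {y \<in> U. (x, y) \<in> (meets \<A> \<B>)\<^sup>*}) ` U"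

locale two_future_systems = equivalence_setting X F + A: future_system X F \<A> + B: future_system X F \<B>
  for X :: "'a dspace" and F :: "'u morphism_family" and \<A> \<B> +
  assumes finite_\<A>: "finite \<A>"
begin

text \<open>The members above \<open>C\<close> become fewer when \<open>C\<close> is replaced by a
  strictly larger member.\<close>

lemma upward_induct [consumes 1, case_names up]:
  assumes "C \<in> \<A>" and step: "\<And>C. C \<in> \<A> \<Longrightarrow> (\<And>E. E \<in> \<A> \<Longrightarrow> A.ale C E \<Longrightarrow> E \<noteq> C \<Longrightarrow> P E) \<Longrightarrow> P C"
  shows "P C"
  using assms(1)
proof (induction "card {E \<in> \<A>. A.ale C E}" arbitrary: C rule: less_induct)
  case less
  show ?case
  proof (rule step[OF less.prems])
    fix E assume E: "E \<in> \<A>" "A.ale C E" "E \<noteq> C"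
    have "{D \<in> \<A>. A.ale E D} \<subset> {D \<in> \<A>. A.ale C D}"
      using A.ale_trans[OF less.prems E(1)] E A.ale_refl[OF less.prems] A.ale_antisym[OF less.prems E(1)] less.prems by blast
    then have "card {D \<in> \<A>. A.ale E D} < card {D \<in> \<A>. A.ale C D}"
      using finite_\<A> by (intro psubset_card_mono) auto
    then show "P E" using less.hyps E(1) by blast
  qed
qed

text \<open>A step goes up in the order of \<open>\<A>\<close> along a d-path that stays in one
  member of \<open>\<B>\<close>. It does not leave the class of the join.\<close>

definition step :: "('a set \<times> 'a set) set" where
  "step = {(C, E). C \<in> \<A> \<and> E \<in> \<A> \<and> (\<exists>x\<in>C. \<exists>y\<in>E. le x y \<and> B.comp x = B.comp y)}"

definition final :: "'a set \<Rightarrow> bool" where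
  "final D \<longleftrightarrow> D \<in> \<A> \<and> (\<forall>E. (D, E) \<in> step \<longrightarrow> E = D)"

lemma step_ale: "(C, E) \<in> step \<Longrightarrow> C \<in> \<A> \<and> E \<in> \<A> \<and> A.ale C E"
  unfolding step_def A.ale_def by blast

lemma steps_ale: "(C, E) \<in> step\<^sup>* \<Longrightarrow> C \<in> \<A> \<Longrightarrow> E \<in> \<A> \<and> A.ale C E"
proof (induction rule: rtrancl_induct)
  case base then show ?case using A.ale_refl by blast
next
  case (step D E) then show ?case using A.ale_trans step_ale by blast
qed

lemma step_into_final:
  assumes D: "final D" and a: "a \<in> D" "le a b" "B.comp a = B.comp b"
  shows "b \<in> D"
proof -
  have "b \<in> space" using a le_space by blast
  then have "(D, A.comp b) \<in> step" using a D A.comp_in[of b] by (auto simp: step_def final_def)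
  then show ?thesis using D A.comp_in(2)[OF \<open>b \<in> space\<close>] by (auto simp: final_def)
qed

text \<open>The step is pushed up along a d-path to \<open>D\<close>: some \<open>a\<close> in
  \<open>D\<close> lies above the source of the step, and stability of \<open>\<B>\<close>
  provides \<open>b\<close> above both \<open>a\<close> and the target of the step, in the
  \<open>\<B>\<close>-member of \<open>a\<close>. Since \<open>D\<close> is final,
  \<open>b\<close> lies in \<open>D\<close>.\<close>

lemma final_absorbs_step:
  assumes D: "final D" and CD: "A.ale C D" and st: "(C, E) \<in> step"
  shows "A.ale E D"
proof -
  obtain x y where x: "C \<in> \<A>" "E \<in> \<A>" "x \<in> C" "y \<in> E" "le x y" "B.comp x = B.comp y"
    using st by (auto simp: step_def)
  have DA: "D \<in> \<A>" using D by (simp add: final_def)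
  obtain a where a: "a \<in> D" "le x a" using A.ale_above[OF x(1) DA CD x(3)] A.member_nonempty[OF DA] by blast
  have sp: "x \<in> space" "a \<in> space" "y \<in> space" using le_space a(2) x(5) by blast+
  obtain b where b: "b \<in> B.comp a" "le y b" "le a b"
    using B.ale_above[OF B.comp_in(1)[OF sp(1)] B.comp_in(1)[OF sp(2)] B.comp_mono[OF a(2)], of y a]
      B.comp_in(2)[OF sp(2)] B.comp_in(2)[OF sp(3)] x(6) by auto
  have "B.comp b = B.comp a" using B.comp_eq[OF B.comp_in(1)[OF sp(2)] b(1)] .
  then have "b \<in> D" using step_into_final[OF D a(1) b(3)] by simp
  then show ?thesis using b(2) x(4) unfolding A.ale_def by blast
qed

lemma final_absorbs_steps: "(C, E) \<in> step\<^sup>* \<Longrightarrow> final D \<Longrightarrow> A.ale C D \<Longrightarrow> A.ale E D"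
  by (induction rule: rtrancl_induct) (auto intro: final_absorbs_step)

lemma ex_final: assumes "C \<in> \<A>" shows "\<exists>D. final D \<and> (C, D) \<in> step\<^sup>*"
  using assms
proof (induction rule: upward_induct)
  case (up C)
  show ?case
  proof (cases "final C")
    case False
    then obtain E where "(C, E) \<in> step" "E \<noteq> C" using up(1) by (auto simp: final_def)
    then show ?thesis using up(2)[of E] step_ale by (meson converse_rtrancl_into_rtrancl)
  qed auto
qed

text \<open>The final member to which steps from \<open>C\<close> lead. It is independent of the
  choice: two such members lie below each other by absorption (\<open>hat_unique\<close>).\<close>

definition hat :: "'a set \<Rightarrow> 'a set" where "hat C = (SOME D. final D \<and> (C, D) \<in> step\<^sup>*)"

lemma hat: assumes "C \<in> \<A>" shows "final (hat C)" "(C, hat C) \<in> step\<^sup>*" "hat C \<in> \<A>" "A.ale C (hat C)"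
proof -
  show 1: "final (hat C)" and 2: "(C, hat C) \<in> step\<^sup>*"
    using someI_ex[OF ex_final[OF assms]] by (auto simp: hat_def)
  show "hat C \<in> \<A>" "A.ale C (hat C)" using steps_ale[OF 2 assms] by auto
qed

lemma hat_mono:
  assumes "C \<in> \<A>" "E \<in> \<A>" "A.ale C E" shows "A.ale (hat C) (hat E)"
  using final_absorbs_steps[OF hat(2)[OF assms(1)] hat(1)[OF assms(2)]]
    A.ale_trans[OF assms(1,2) hat(3)[OF assms(2)] assms(3) hat(4)[OF assms(2)]] by blast

lemma hat_unique:
  assumes "C \<in> \<A>" "(C, D) \<in> step\<^sup>*" "final D" shows "hat C = D"
proof -
  have D: "D \<in> \<A>" "A.ale C D" using steps_ale[OF assms(2,1)] by auto
  have "A.ale (hat C) D" by (rule final_absorbs_steps[OF hat(2)[OF assms(1)] assms(3) D(2)])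
  moreover have "A.ale D (hat C)" by (rule final_absorbs_steps[OF assms(2) hat(1)[OF assms(1)] hat(4)[OF assms(1)]])
  ultimately show ?thesis using A.ale_antisym hat(3)[OF assms(1)] D(1) by blast
qed

lemma hat_step: assumes "(C, E) \<in> step" shows "hat C = hat E"
proof -
  have "C \<in> \<A>" "E \<in> \<A>" using step_ale[OF assms] by auto
  then show ?thesis using hat_unique[of C "hat E"] hat[of E] assms by (meson converse_rtrancl_into_rtrancl)
qed

lemma hat_final: "final D \<Longrightarrow> hat D = D"
  using hat_unique[of D D] by (simp add: final_def)

text \<open>Two points are in the same class of the join if and only if this member of
  \<open>\<A>\<close> is the same for both (\<open>meets_iff\<close>).\<close>

definition end_of :: "'a \<Rightarrow> 'a set" where "end_of x = hat (A.comp x)"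

lemma end_of: assumes "x \<in> space"
  shows "final (end_of x)" "end_of x \<in> \<A>" "A.ale (A.comp x) (end_of x)"
  using hat[OF A.comp_in(1)[OF assms]] by (auto simp: end_of_def)

lemma end_of_mono: "le x y \<Longrightarrow> A.ale (end_of x) (end_of y)"
  unfolding end_of_def using hat_mono A.comp_mono A.comp_in(1) le_space by blast

text \<open>The \<open>\<B>\<close>-member of the two points contains an upper bound of them, so
  both \<open>\<A>\<close>-members have a step to the \<open>\<A>\<close>-member of that bound.\<close>

lemma end_of_same_B:
  assumes "x \<in> space" "y \<in> space" "B.comp x = B.comp y" shows "end_of x = end_of y"
proof -
  obtain w where w: "w \<in> B.comp x" "le x w" "le y w"
    using future_connectedD[OF B.connected[OF B.comp_in(1)[OF assms(1)]], of x y] B.comp_in(2) assms by blast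
  have e: "B.comp w = B.comp x" using B.comp_eq[OF B.comp_in(1)[OF assms(1)] w(1)] .
  have ws: "w \<in> space" using le_space w by blast
  have "(A.comp x, A.comp w) \<in> step" "(A.comp y, A.comp w) \<in> step"
    using e w assms A.comp_in[OF ws] A.comp_in[OF assms(1)] A.comp_in[OF assms(2)] unfolding step_def by auto
  then show ?thesis using hat_step unfolding end_of_def by blast
qed

lemma reach_end:
  assumes x: "x \<in> space" and b0: "b0 \<in> end_of x"
  obtains b where "b \<in> end_of x" "le x b" "le b0 b"
  using A.ale_above[OF A.comp_in(1)[OF x] end_of(2)[OF x] end_of(3)[OF x] A.comp_in(2)[OF x] b0] .

text \<open>Nothing of a class lies above its last member except this member itself. Stability of
  a class therefore involves only endpoints in its last member, to which stability of
  \<open>\<A>\<close> applies.\<close>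

lemma above_end:
  assumes D: "final D" "z \<in> D" and w: "le z w" "end_of w = D"
  shows "w \<in> D"
proof -
  have ws: "w \<in> space" using le_space w by blast
  have zs: "A.comp z = D" using A.comp_eq D by (simp add: final_def)
  have "A.ale D (A.comp w)" "A.ale (A.comp w) D"
    using A.comp_mono[OF w(1)] zs end_of(3)[OF ws] w(2) by auto
  then have "A.comp w = D" using A.ale_antisym A.comp_in(1)[OF ws] D(1) by (auto simp: final_def)
  then show ?thesis using A.comp_in(2)[OF ws] by simp
qed

lemma end_of_in_final: "final D \<Longrightarrow> a \<in> D \<Longrightarrow> end_of a = D"
  unfolding end_of_def using hat_final A.comp_eq by (auto simp: final_def)

text \<open>Stability of \<open>\<B>\<close> gives this for endpoints \<open>b'\<close> that are
  late in the \<open>\<B>\<close>-member of \<open>b\<close>. These still lie in the final member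
  \<open>D\<close>, so that appending a d-path from \<open>b\<close> to \<open>b'\<close> is an
  equivalence by stability of \<open>\<A>\<close>, and the square can be completed.\<close>

lemma far_pre_B:
  assumes d: "\<delta> \<in> paths u v" "B.comp u = B.comp v" and D: "final D"
  obtains z where "z \<in> D" "\<And>b. b \<in> D \<Longrightarrow> le z b \<Longrightarrow> pre_equiv \<delta> b"
proof -
  have DA: "D \<in> \<A>" using D by (simp add: final_def)
  have uv: "u \<in> space" "v \<in> space" using dpaths_from_to_ends[OF d(1)] .
  obtain z1 where z1: "z1 \<in> D" "\<And>b b' \<beta>. b \<in> D \<Longrightarrow> b' \<in> D \<Longrightarrow> le z1 b \<Longrightarrow> \<beta> \<in> paths b b' \<Longrightarrow> post_equiv u \<beta>"
    using A.far_post[OF DA uv(1)] by blast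
  obtain z2 where z2: "z2 \<in> D" "\<And>b b' \<beta>. b \<in> D \<Longrightarrow> b' \<in> D \<Longrightarrow> le z2 b \<Longrightarrow> \<beta> \<in> paths b b' \<Longrightarrow> post_equiv v \<beta>"
    using A.far_post[OF DA uv(2)] by blast
  obtain z where z: "z \<in> D" "le z1 z" "le z2 z" using A.directed2[OF DA z1(1) z2(1)] .
  have "pre_equiv \<delta> b" if b: "b \<in> D" "le z b" for b
  proof -
    have bs: "b \<in> space" using b le_space by blast
    note B' = B.comp_in[OF bs] and U = B.comp_in[OF uv(1)]
    have vU: "v \<in> B.comp u" using B.comp_in(2)[OF uv(2)] d(2) by simp
    obtain z3 where z3: "z3 \<in> B.comp b" "\<And>b'. b' \<in> B.comp b \<Longrightarrow> le z3 b' \<Longrightarrow> pre_equiv \<delta> b'"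
      using B.far_pre[OF U(1) B'(1) d(1) U(2) vU] by blast
    obtain b' where b': "b' \<in> B.comp b" "le z3 b'" "le b b'"
      using future_connectedD[OF B.connected[OF B'(1)] z3(1) B'(2)] .
    have "b' \<in> D" using step_into_final[OF D b(1) b'(3)] B.comp_eq[OF B'(1) b'(1)] by simp
    obtain \<beta> where \<beta>: "\<beta> \<in> paths b b'" using b'(3) by (auto simp: le_iff)
    have "post_equiv u \<beta>" "post_equiv v \<beta>"
      using z1(2)[OF b(1) \<open>b' \<in> D\<close> le_trans[OF z(2) b(2)] \<beta>] z2(2)[OF b(1) \<open>b' \<in> D\<close> le_trans[OF z(3) b(2)] \<beta>] by auto
    then show ?thesis using pre_equiv_square[OF d(1) \<beta> z3(2)[OF b'(1,2)]] by blast
  qed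
  with z(1) that show thesis by blast
qed

text \<open>Induction from the top. If the member \<open>C\<close> of \<open>x\<close> is not
  final, a step leads out of it. Go up from \<open>x\<close> within \<open>C\<close> beyond the
  source of the step, then within a member of \<open>\<B>\<close> to a point of a larger member of
  \<open>\<A>\<close>, and continue from there by the induction hypothesis.\<close>

lemma equivalence_into_end:
  assumes D: "final D" and x: "x \<in> space"
  obtains w \<gamma> z where "w \<in> end_of x" "\<gamma> \<in> paths x w" "z \<in> D" "\<And>b. b \<in> D \<Longrightarrow> le z b \<Longrightarrow> pre_equiv \<gamma> b"
proof -
  have DA: "D \<in> \<A>" using D by (simp add: final_def)
  have "\<forall>x\<in>C. \<exists>w\<in>end_of x. \<exists>\<gamma>\<in>paths x w. \<exists>z\<in>D. \<forall>b\<in>D. le z b \<longrightarrow> pre_equiv \<gamma> b" if "C \<in> \<A>" for C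
    using that
  proof (induction rule: upward_induct)
    case (up C)
    show ?case
    proof
      fix x assume x: "x \<in> C"
      have xs: "x \<in> space" using A.member_space[OF up(1) x] .
      have ex: "end_of x = hat C" using A.comp_eq[OF up(1) x] by (simp add: end_of_def)
      show "\<exists>w\<in>end_of x. \<exists>\<gamma>\<in>paths x w. \<exists>z\<in>D. \<forall>b\<in>D. le z b \<longrightarrow> pre_equiv \<gamma> b"
      proof (cases "final C")
        case True
        then show ?thesis
          using hat_final ex x dpaths_const[OF xs] pre_equiv_const[OF xs] A.member_nonempty[OF DA] by blast
      next
        case False
        then obtain E where E: "(C, E) \<in> step" "E \<noteq> C" using up(1) by (auto simp: final_def)
        then obtain x1 y1 where xy: "x1 \<in> C" "y1 \<in> E" "le x1 y1" "B.comp x1 = B.comp y1" by (auto simp: step_def)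
        have EA: "E \<in> \<A>" "A.ale C E" using step_ale[OF E(1)] by auto
        obtain w0 where w0: "w0 \<in> C" "le x w0" "le x1 w0" using future_connectedD[OF A.connected[OF up(1)] x xy(1)] .
        have sp: "w0 \<in> space" "x1 \<in> space" "y1 \<in> space" using le_space w0 xy by blast+
        \<comment> \<open>The step is transported from x1 to w0, as in the proof of
          final_absorbs_step.\<close>
        obtain b3 where b3: "b3 \<in> B.comp w0" "le y1 b3" "le w0 b3"
          using B.ale_above[OF B.comp_in(1)[OF sp(2)] B.comp_in(1)[OF sp(1)] B.comp_mono[OF w0(3)], of y1 w0]
            B.comp_in(2)[OF sp(3)] B.comp_in(2)[OF sp(1)] xy(4) by auto
        have b3s: "b3 \<in> space" using b3 le_space by blast
        have same: "B.comp w0 = B.comp b3" using B.comp_eq[OF B.comp_in(1)[OF sp(1)] b3(1)] by simp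
        note E2 = A.comp_in[OF b3s]
        have "A.ale E (A.comp b3)" using A.comp_mono[OF b3(2)] A.comp_eq[OF EA(1) xy(2)] by simp
        then have "A.comp b3 \<noteq> C" using A.ale_antisym[OF up(1) EA(1) EA(2)] E(2) by auto
        moreover have "A.ale C (A.comp b3)" using A.comp_mono[OF b3(3)] A.comp_eq[OF up(1) w0(1)] by simp
        ultimately obtain w \<gamma> z3 where g: "w \<in> end_of b3" "\<gamma> \<in> paths b3 w" "z3 \<in> D" "\<And>b. b \<in> D \<Longrightarrow> le z3 b \<Longrightarrow> pre_equiv \<gamma> b"
          using up(2)[OF E2(1), THEN bspec, OF _ _ E2(2)] by blast
        have "end_of b3 = end_of x" using end_of_same_B[OF sp(1) b3s same] A.comp_eq[OF up(1) w0(1)] ex by (simp add: end_of_def)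
        obtain \<alpha> where a: "\<alpha> \<in> paths x w0" using w0(2) by (auto simp: le_iff)
        obtain \<delta> where d: "\<delta> \<in> paths w0 b3" using b3(3) by (auto simp: le_iff)
        obtain z1 where z1: "z1 \<in> D" "\<And>b. b \<in> D \<Longrightarrow> le z1 b \<Longrightarrow> pre_equiv \<alpha> b" by (rule A.far_pre[OF up(1) DA a x w0(1)]) (rule that)
        obtain z2 where z2: "z2 \<in> D" "\<And>b. b \<in> D \<Longrightarrow> le z2 b \<Longrightarrow> pre_equiv \<delta> b" by (rule far_pre_B[OF d same D]) (rule that)
        obtain z where z: "z \<in> D" "le z1 z" "le z2 z" "le z3 z" using A.directed3[OF DA z1(1) z2(1) g(3)] .
        have "pre_equiv (path_concat \<alpha> (path_concat \<delta> \<gamma>)) b" if b: "b \<in> D" "le z b" for b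
          using pre_equiv_concat[OF a dpaths_concat[OF d g(2)]] pre_equiv_concat[OF d g(2)]
            g(4)[OF b(1) le_trans[OF z(4) b(2)]] z1(2)[OF b(1) le_trans[OF z(2) b(2)]] z2(2)[OF b(1) le_trans[OF z(3) b(2)]] by simp
        moreover have "path_concat \<alpha> (path_concat \<delta> \<gamma>) \<in> paths x w" using dpaths_concat[OF a dpaths_concat[OF d g(2)]] .
        ultimately show ?thesis using g(1) \<open>end_of b3 = end_of x\<close> z(1) by blast
      qed
    qed
  qed
  from this[OF A.comp_in(1)[OF x]] A.comp_in(2)[OF x] that show thesis by blast
qed

text \<open>Triviality of the last member of \<open>\<A>\<close> is transported along the d-path
  just constructed.\<close>

lemma contractible_into_end:
  assumes x: "x \<in> space"
  obtains z where "z \<in> end_of x" "\<And>b. b \<in> end_of x \<Longrightarrow> le z b \<Longrightarrow> F_contractible F (path_space x b)"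
proof -
  note D = end_of[OF x]
  obtain w \<gamma> z1 where g: "w \<in> end_of x" "\<gamma> \<in> paths x w" "z1 \<in> end_of x" "\<And>b. b \<in> end_of x \<Longrightarrow> le z1 b \<Longrightarrow> pre_equiv \<gamma> b"
    by (rule equivalence_into_end[OF D(1) x]) (rule that)
  obtain z2 where z2: "z2 \<in> end_of x" "\<And>b. b \<in> end_of x \<Longrightarrow> le z2 b \<Longrightarrow> F_contractible F (path_space w b)"
    by (rule A.far_contractible[OF D(2) g(1)]) (rule that)
  obtain z where z: "z \<in> end_of x" "le z1 z" "le z2 z" using A.directed2[OF D(2) g(3) z2(1)] .
  have "F_contractible F (path_space x b)" if b: "b \<in> end_of x" "le z b" for b
    using pre_equiv_contractible[OF g(2) g(4)[OF b(1) le_trans[OF z(2) b(2)]]] z2(2)[OF b(1) le_trans[OF z(3) b(2)]] by simp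
  with z(1) that show thesis by blast
qed

text \<open>Both ends of \<open>\<alpha>\<close> have equivalences into the last member of their
  class, and these may be continued to a common point \<open>w'\<close> that is so late that the
  path space from \<open>x\<close> to \<open>w'\<close> is contractible. Hence the two ways from
  \<open>x\<close> to \<open>w'\<close>, one of them through \<open>\<alpha>\<close>, can be
  compared.\<close>

lemma far_pre_join:
  assumes a: "\<alpha> \<in> paths x y" "end_of x = end_of y" and D: "final D"
  obtains z where "z \<in> D" "\<And>b. b \<in> D \<Longrightarrow> le z b \<Longrightarrow> pre_equiv \<alpha> b"
proof -
  have DA: "D \<in> \<A>" using D by (simp add: final_def)
  have xy: "x \<in> space" "y \<in> space" using dpaths_from_to_ends[OF a(1)] .
  note C = end_of[OF xy(1)]
  obtain w \<gamma> z1 where g: "w \<in> end_of x" "\<gamma> \<in> paths y w" "z1 \<in> D" "\<And>b. b \<in> D \<Longrightarrow> le z1 b \<Longrightarrow> pre_equiv \<gamma> b"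
    by (rule equivalence_into_end[OF D xy(2), folded a(2)]) (rule that)
  obtain w0 \<gamma>0 z2 where g0: "w0 \<in> end_of x" "\<gamma>0 \<in> paths x w0" "z2 \<in> D" "\<And>b. b \<in> D \<Longrightarrow> le z2 b \<Longrightarrow> pre_equiv \<gamma>0 b"
    by (rule equivalence_into_end[OF D xy(1)]) (rule that)
  obtain z3 where z3: "z3 \<in> end_of x" "\<And>b. b \<in> end_of x \<Longrightarrow> le z3 b \<Longrightarrow> F_contractible F (path_space x b)"
    by (rule contractible_into_end[OF xy(1)]) (rule that)
  obtain w' where w': "w' \<in> end_of x" "le w w'" "le w0 w'" "le z3 w'"
    using A.directed3[OF C(2) g(1) g0(1) z3(1)] .
  obtain \<eta> \<eta>0 where e: "\<eta> \<in> paths w w'" "\<eta>0 \<in> paths w0 w'" using w' by (auto simp: le_iff)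
  obtain z4 where z4: "z4 \<in> D" "\<And>b. b \<in> D \<Longrightarrow> le z4 b \<Longrightarrow> pre_equiv \<eta> b" by (rule A.far_pre[OF C(2) DA e(1) g(1) w'(1)]) (rule that)
  obtain z5 where z5: "z5 \<in> D" "\<And>b. b \<in> D \<Longrightarrow> le z5 b \<Longrightarrow> pre_equiv \<eta>0 b" by (rule A.far_pre[OF C(2) DA e(2) g0(1) w'(1)]) (rule that)
  obtain z where z: "z \<in> D" "le z1 z" "le z2 z" "le z4 z" "le z5 z"
    using A.directed4[OF DA g(3) g0(3) z4(1) z5(1)] .
  have "pre_equiv \<alpha> b" if b: "b \<in> D" "le z b" for b
  proof -
    have "pre_equiv (path_concat \<gamma> \<eta>) b" "pre_equiv (path_concat \<gamma>0 \<eta>0) b"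
      using pre_equiv_concat[OF g(2) e(1) z4(2)[OF b(1) le_trans[OF z(4) b(2)]]] g(4)[OF b(1) le_trans[OF z(2) b(2)]]
        pre_equiv_concat[OF g0(2) e(2) z5(2)[OF b(1) le_trans[OF z(5) b(2)]]] g0(4)[OF b(1) le_trans[OF z(3) b(2)]] by simp_all
    then show ?thesis
      using pre_equiv_via[OF a(1) z3(2)[OF w'(1,4)] dpaths_concat[OF g(2) e(1)] _ dpaths_concat[OF g0(2) e(2)]] by blast
  qed
  with z(1) that show thesis by blast
qed

lemma meets_end_of: "(x, y) \<in> (meets \<A> \<B>)\<^sup>* \<Longrightarrow> x \<in> space \<Longrightarrow> y \<in> space \<and> end_of x = end_of y"
proof (induction rule: rtrancl_induct)
  case (step y z)
  then obtain S where S: "S \<in> \<A> \<or> S \<in> \<B>" "y \<in> S" "z \<in> S" by (auto simp: meets_def)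
  then have zs: "z \<in> space" using A.member_space B.member_space by blast
  have "end_of y = end_of z"
    using S A.comp_eq[of S y] A.comp_eq[of S z] B.comp_eq[of S y] B.comp_eq[of S z] end_of_same_B[of y z] step zs
    by (auto simp: end_of_def)
  then show ?case using step zs by auto
qed auto

lemma sym_meets: "sym ((meets \<A> \<B>)\<^sup>*)"
  by (rule sym_rtrancl) (auto simp: sym_def meets_def)

lemma steps_meets: "(C, E) \<in> step\<^sup>* \<Longrightarrow> C \<in> \<A> \<Longrightarrow> x \<in> C \<Longrightarrow> y \<in> E \<Longrightarrow> (x, y) \<in> (meets \<A> \<B>)\<^sup>*"
proof (induction arbitrary: y rule: rtrancl_induct)
  case base
  then have "(x, y) \<in> meets \<A> \<B>" by (auto simp: meets_def)
  then show ?case by blast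
next
  case (step D E)
  then obtain u v where uv: "D \<in> \<A>" "E \<in> \<A>" "u \<in> D" "v \<in> E" "B.comp u = B.comp v" by (auto simp: step_def)
  have "u \<in> space" "v \<in> space" using uv A.member_space by auto
  then have "(u, v) \<in> meets \<A> \<B>" using B.comp_in[of u] B.comp_in[of v] uv(5) by (auto simp: meets_def)
  moreover have "(v, y) \<in> meets \<A> \<B>" using uv step.prems by (auto simp: meets_def)
  moreover have "(x, u) \<in> (meets \<A> \<B>)\<^sup>*" using step uv by blast
  ultimately show ?case by (meson rtrancl.rtrancl_into_rtrancl)
qed

text \<open>Points and steps in a common member do not change \<open>end_of\<close>; conversely,
  both points are related to each point of the last member through the steps that lead there.\<close>

lemma meets_iff:
  assumes x: "x \<in> space" shows "(x, y) \<in> (meets \<A> \<B>)\<^sup>* \<longleftrightarrow> y \<in> space \<and> end_of x = end_of y"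
proof
  assume y: "y \<in> space \<and> end_of x = end_of y"
  obtain d where d: "d \<in> end_of x" using end_of(2)[OF x] A.member_nonempty by blast
  have "(x, d) \<in> (meets \<A> \<B>)\<^sup>*"
    using steps_meets[OF hat(2)[OF A.comp_in(1)[OF x]]] A.comp_in[OF x] d by (auto simp: end_of_def)
  moreover have "(y, d) \<in> (meets \<A> \<B>)\<^sup>*"
    using steps_meets[OF hat(2)[OF A.comp_in(1)[of y]]] A.comp_in[of y] d y by (auto simp: end_of_def)
  ultimately show "(x, y) \<in> (meets \<A> \<B>)\<^sup>*" using symD[OF sym_meets] by (meson rtrancl_trans)
qed (use meets_end_of x in blast)

lemma join_partition_eq: "join_partition space \<A> \<B> = (\<lambda>x. {y \<in> space. end_of x = end_of y}) ` space"
  unfolding join_partition_def by (rule image_cong) (use meets_iff in auto)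

lemma join_member:
  assumes "C \<in> join_partition space \<A> \<B>"
  obtains D where "final D" "D \<in> \<A>" "D \<subseteq> C" "C = {y \<in> space. end_of y = D}"
proof -
  obtain x where x: "x \<in> space" "C = {y \<in> space. end_of y = end_of x}" using assms by (auto simp: join_partition_eq)
  have "end_of x \<subseteq> C" unfolding x(2) using end_of_in_final[OF end_of(1)[OF x(1)]] A.member_space[OF end_of(2)[OF x(1)]] by auto
  then show thesis using that[OF end_of(1,2)[OF x(1)]] x(2) by blast
qed

lemma join_end:
  assumes "C \<in> join_partition space \<A> \<B>"
  obtains D where "D \<in> \<A>" "D \<subseteq> C" "\<And>a w. a \<in> D \<Longrightarrow> w \<in> C \<Longrightarrow> le a w \<Longrightarrow> w \<in> D"
proof -
  obtain D where D: "final D" "D \<in> \<A>" "D \<subseteq> C" "C = {y \<in> space. end_of y = D}" using join_member[OF assms] .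
  then have "\<And>a w. a \<in> D \<Longrightarrow> w \<in> C \<Longrightarrow> le a w \<Longrightarrow> w \<in> D" using above_end by blast
  with D that show thesis by blast
qed

text \<open>The last members of the classes along a d-path increase, so they are constant if both
  ends have the same one.\<close>

lemma join_convex:
  assumes "C \<in> join_partition space \<A> \<B>" shows "d_convex X C"
proof -
  obtain D where D: "final D" "D \<in> \<A>" "D \<subseteq> C" "C = {y \<in> space. end_of y = D}" using join_member[OF assms] .
  show ?thesis
  proof (rule d_convexI)
    fix x y w assume "x \<in> C" "y \<in> C" and w: "le x w" "le w y"
    then have e: "A.ale D (end_of w)" "A.ale (end_of w) D" using end_of_mono[OF w(1)] end_of_mono[OF w(2)] D(4) by auto
    have ws: "w \<in> space" using le_space w by blast
    have "end_of w = D" using A.ale_antisym[OF end_of(2)[OF ws] D(2) e(2,1)] .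
    then show "w \<in> C" using ws D(4) by simp
  qed (use D in auto)
qed

lemma join_connected:
  assumes C: "C \<in> join_partition space \<A> \<B>" shows "future_connected X C"
proof (rule future_connectedI[OF join_convex[OF C]])
  obtain D where D: "final D" "D \<in> \<A>" "D \<subseteq> C" "C = {y \<in> space. end_of y = D}" using join_member[OF C] .
  fix x y assume xy: "x \<in> C" "y \<in> C"
  then have e: "x \<in> space" "end_of x = D" "y \<in> space" "end_of y = D" using D(4) by auto
  obtain d where d: "d \<in> D" using A.member_nonempty[OF D(2)] by blast
  obtain a where a: "a \<in> D" "le x a" "le d a" using reach_end[OF e(1), unfolded e(2), OF d] .
  obtain b where "b \<in> D" "le y b" "le a b" using reach_end[OF e(3), unfolded e(4), OF a(1)] .
  then show "\<exists>z\<in>C. le x z \<and> le y z" using a D(3) le_trans by blast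
qed

lemma join_St:
  assumes D: "final D" "D' = {y \<in> space. end_of y = D}"
    and a: "\<alpha> \<in> paths x y" "end_of x = end_of y"
  obtains z where "z \<in> D" "\<And>z'. z' \<in> D \<Longrightarrow> le z z' \<Longrightarrow> z' \<in> St_future F X \<alpha> D'"
proof -
  have DA: "D \<in> \<A>" using D by (simp add: final_def)
  have x: "x \<in> space" using dpaths_from_to_ends[OF a(1)] by simp
  have sub: "D \<subseteq> D'" using D end_of_in_final A.member_space[OF DA] by blast
  obtain z1 where z1: "z1 \<in> D" "\<And>b. b \<in> D \<Longrightarrow> le z1 b \<Longrightarrow> pre_equiv \<alpha> b" by (rule far_pre_join[OF a D(1)]) (rule that)
  obtain z2 where z2: "z2 \<in> D" "\<And>b b' \<beta>. b \<in> D \<Longrightarrow> b' \<in> D \<Longrightarrow> le z2 b \<Longrightarrow> \<beta> \<in> paths b b' \<Longrightarrow> post_equiv x \<beta>"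
    using A.far_post[OF DA x] by blast
  obtain z where z: "z \<in> D" "le z1 z" "le z2 z" using A.directed2[OF DA z1(1) z2(1)] .
  have "z' \<in> St_future F X \<alpha> D'" if z': "z' \<in> D" "le z z'" for z'
  proof (rule St_futureI[OF a(1)])
    show "z' \<in> D'" using sub z' by blast
    have in_D: "b \<in> D" if "b \<in> D'" "le z' b" for b using above_end[OF D(1) z'(1) that(2)] that(1) D(2) by blast
    show "pre_equiv \<alpha> b" if b: "b \<in> D'" "le z' b" for b
      using z1(2)[OF in_D[OF b] le_trans[OF z(2) le_trans[OF z'(2) b(2)]]] .
    show "post_equiv x \<beta>" if b: "b \<in> D'" "b' \<in> D'" "le z' b" "\<beta> \<in> paths b b'" for b b' \<beta>
    proof -
      have "le b b'" using b(4) by (auto simp: le_iff)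
      then show ?thesis
        using z2(2)[OF in_D[OF b(1,3)] in_D[OF b(2) le_trans[OF b(3)]] le_trans[OF z(3) le_trans[OF z'(2) b(3)]] b(4)] by blast
    qed
  qed
  with z(1) that show thesis by blast
qed

lemma join_stable:
  assumes C: "C \<in> join_partition space \<A> \<B>" and D': "D' \<in> join_partition space \<A> \<B>"
  shows "future_stable F X C D'"
proof -
  obtain E where E: "C = {y \<in> space. end_of y = E}" using join_member[OF C] .
  obtain D where D: "final D" "D' = {y \<in> space. end_of y = D}" using join_member[OF D'] .
  have "St_future F X \<alpha> D' \<noteq> {}" if a: "\<alpha> \<in> dpaths_in X C" for \<alpha>
  proof -
    have "\<alpha> \<in> paths (\<alpha> 0) (\<alpha> 1)" "end_of (\<alpha> 0) = end_of (\<alpha> 1)"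
      using a E by (auto simp: dpaths_in_def dpaths_from_to_def image_subset_iff)
    from join_St[OF D this] obtain z where "z \<in> D" "\<And>z'. z' \<in> D \<Longrightarrow> le z z' \<Longrightarrow> z' \<in> St_future F X \<alpha> D'" by blast
    moreover have "le z z" using \<open>z \<in> D\<close> D(1) A.member_space le_refl by (auto simp: final_def)
    ultimately show ?thesis by blast
  qed
  then show ?thesis using join_connected[OF C] join_connected[OF D'] by (simp add: future_stable_def)
qed

lemma join_trivial:
  assumes C: "C \<in> join_partition space \<A> \<B>" shows "future_trivial F X C"
proof -
  obtain D where D: "final D" "D \<in> \<A>" "D \<subseteq> C" "C = {y \<in> space. end_of y = D}" using join_member[OF C] .
  obtain x where x: "x \<in> D" using A.member_nonempty[OF D(2)] by blast
  have xs: "x \<in> space" "end_of x = D" using D x by auto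
  obtain z1 where z1: "z1 \<in> D" "\<And>b. b \<in> D \<Longrightarrow> le z1 b \<Longrightarrow> F_contractible F (path_space x b)"
    by (rule contractible_into_end[OF xs(1), unfolded xs(2)]) (rule that)
  obtain z2 where z2: "z2 \<in> D" "\<And>z'. z' \<in> D \<Longrightarrow> le z2 z' \<Longrightarrow> z' \<in> St_future F X (const_path x) C"
    by (rule join_St[OF D(1,4) dpaths_const[OF xs(1)] refl]) (rule that)
  obtain z where z: "z \<in> D" "le z1 z" "le z2 z" using A.directed2[OF D(2) z1(1) z2(1)] .
  have "path_space x z \<in> future_stable_path_spaces F X C C"
    using z2(2)[OF z(1,3)] D(3) x unfolding future_stable_path_spaces_def by blast
  then show ?thesis
    using z1(2)[OF z(1,2)] join_connected[OF C] join_stable[OF C C] unfolding future_trivial_def by blast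
qed

theorem join_future_system: "stable_future_component_system F X (join_partition space \<A> \<B>)"
  unfolding stable_future_component_system_def
proof (intro conjI ballI)
  show "pairwise disjnt (join_partition space \<A> \<B>)"
    unfolding join_partition_eq by (auto simp: pairwise_def disjnt_iff)
  show "\<Union> (join_partition space \<A> \<B>) = space" unfolding join_partition_eq by auto
qed (use join_convex join_connected join_trivial join_stable in auto)

end

section \<open>Past and total systems\<close>

context equivalence_setting begin

lemma reverse_inj: "inj_on reverse_path (extensional {0..1})"
  by (rule inj_on_inverseI[where g = reverse_path]) (simp add: reverse_reverse)

lemma opposite_le: "dle (opposite X) x y \<longleftrightarrow> le y x"
proof -
  interpret op: equivalence_setting "opposite X" F by (rule opposite_setting)
  show ?thesis unfolding le_iff op.le_iff
  proof
    assume "op.paths x y \<noteq> {}"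
    then show "paths y x \<noteq> {}" by (auto simp: reverse_paths_iff)
  next
    assume "paths y x \<noteq> {}"
    then show "op.paths x y \<noteq> {}" using reverse_in_opposite by blast
  qed
qed

lemma opposite_top [simp]: "dtop (opposite X) = dtop X"
  by (simp add: opposite_def)

lemma opposite_dpaths_in: "dpaths_in (opposite X) A = reverse_path ` dpaths_in X A"
proof -
  have "reverse_path \<alpha> ` {0..1} \<subseteq> A \<longleftrightarrow> \<alpha> ` {0..1} \<subseteq> A" for \<alpha> :: "real \<Rightarrow> 'a"
    by (simp only: reverse_image)
  then show ?thesis unfolding dpaths_in_def opposite_def dspace.select_convs by blast
qed

lemma opposite_dpaths_between: "dpaths_between (opposite X) A B C = reverse_path ` dpaths_between X A C B"
  by (auto simp: dpaths_between_def opposite_dpaths_in)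

lemma opposite_convex: "d_convex (opposite X) A \<longleftrightarrow> d_convex X A"
proof -
  have "dpaths_between X S T U \<subseteq> extensional {0..1}" for S T U
    using dpath_extensional by (auto simp: dpaths_between_def dpaths_in_def)
  then show ?thesis
    unfolding d_convex_def opposite_dpaths_between opposite_top
    by (intro inj_on_image_eq_iff[OF reverse_inj])
qed

lemma opposite_connected: "future_connected (opposite X) A \<longleftrightarrow> past_connected X A"
  by (simp add: future_connected_def past_connected_def opposite_dpaths_between)

lemma opposite_St:
  assumes "\<alpha> \<in> dpaths X" shows "St_future F (opposite X) (reverse_path \<alpha>) A = St_past F X A \<alpha>"
proof -
  have up: "upper_part (opposite X) A z = lower_part X A z" for z
    by (simp add: upper_part_def lower_part_def opposite_le)
  have "extension_equivalence F (opposite X) (reverse_path \<alpha>) (reverse_path \<beta>) \<longleftrightarrow> extension_equivalence F X \<beta> \<alpha>"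
    if "\<beta> \<in> dpaths_in X S" for \<beta> S
    using opposite_extension_equivalence[of \<beta> "\<beta> 0" "\<beta> 1" \<alpha> "\<alpha> 0" "\<alpha> 1"] assms that
    by (simp add: dpaths_from_to_def dpaths_in_def)
  then show ?thesis
    unfolding St_future_def St_past_def up opposite_dpaths_in by auto
qed

lemma opposite_stable: "future_stable F (opposite X) B A \<longleftrightarrow> past_stable F X A B"
proof -
  have "St_future F (opposite X) (reverse_path \<alpha>) A = St_past F X A \<alpha>" if "\<alpha> \<in> dpaths_in X B" for \<alpha>
    using opposite_St[of \<alpha> A] that by (simp add: dpaths_in_def)
  then show ?thesis
    by (auto simp: future_stable_def past_stable_def opposite_connected opposite_dpaths_in)
qed

lemma opposite_trivial:
  assumes "A \<subseteq> space" shows "future_trivial F (opposite X) A \<longleftrightarrow> past_trivial F X A"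
proof -
  have St: "St_future F (opposite X) (const_path a) A = St_past F X A (const_path a)" if "a \<in> A" for a
    using opposite_St[of "const_path a" A] dpaths_const[of a] assms that by (auto simp: dpaths_from_to_def)
  have "(\<exists>Y\<in>future_stable_path_spaces F (opposite X) A A. F_contractible F Y) \<longleftrightarrow>
      (\<exists>a\<in>A. \<exists>z\<in>St_future F (opposite X) (const_path a) A. F_contractible F (dpath_space (opposite X) a z))"
    unfolding future_stable_path_spaces_def by blast
  also have "\<dots> \<longleftrightarrow> (\<exists>a\<in>A. \<exists>z\<in>St_past F X A (const_path a). F_contractible F (path_space z a))"
    using St opposite_contractible by simp
  also have "\<dots> \<longleftrightarrow> (\<exists>Y\<in>past_stable_path_spaces F X A A. F_contractible F Y)"
    unfolding past_stable_path_spaces_def by blast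
  finally show ?thesis by (simp add: future_trivial_def past_trivial_def opposite_connected opposite_stable)
qed

lemma opposite_system: "stable_future_component_system F (opposite X) \<A> \<longleftrightarrow> stable_past_component_system F X \<A>"
proof (cases "\<Union>\<A> = space")
  case True
  then have "\<And>A. A \<in> \<A> \<Longrightarrow> A \<subseteq> space" by blast
  then show ?thesis
    unfolding stable_future_component_system_def stable_past_component_system_def
    by (auto simp: opposite_trivial opposite_stable opposite_convex opposite_connected)
qed (simp add: stable_future_component_system_def stable_past_component_system_def)

lemma join_future:
  assumes "stable_future_component_system F X \<A>" "finite \<A>" "stable_future_component_system F X \<B>"
  shows "stable_future_component_system F X (join_partition space \<A> \<B>)"
proof -
  interpret two_future_systems X F \<A> \<B> using assms by unfold_locales
  show ?thesis by (rule join_future_system)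
qed

lemma join_past:
  assumes "stable_past_component_system F X \<A>" "finite \<A>" "stable_past_component_system F X \<B>"
  shows "stable_past_component_system F X (join_partition space \<A> \<B>)"
proof -
  interpret op: equivalence_setting "opposite X" F by (rule opposite_setting)
  show ?thesis using op.join_future[of \<A> \<B>] assms by (simp add: opposite_system)
qed

text \<open>Nothing of \<open>D\<close> lies above its last member \<open>D1\<close> outside
  \<open>D1\<close>, and dually for the first member \<open>C1\<close> of \<open>C\<close>. So the
  points witnessing total stability of \<open>(C1, D1)\<close> in \<open>\<A>\<close> do so for
  \<open>(C, D)\<close>.\<close>

lemma join_total:
  assumes A: "stable_total_component_system F X \<A>" "finite \<A>" and B: "stable_total_component_system F X \<B>"
  shows "stable_total_component_system F X (join_partition space \<A> \<B>)"
  unfolding stable_total_component_system_def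
proof (intro conjI ballI)
  let ?J = "join_partition space \<A> \<B>"
  have AB: "stable_future_component_system F X \<A>" "stable_future_component_system F X \<B>"
    "stable_past_component_system F X \<A>" "stable_past_component_system F X \<B>"
    using A B by (auto simp: stable_total_component_system_def)
  show f: "stable_future_component_system F X ?J" using join_future AB A(2) by blast
  show p: "stable_past_component_system F X ?J" using join_past AB A(2) by blast
  interpret fut: two_future_systems X F \<A> \<B> using AB A(2) by unfold_locales
  interpret past: two_future_systems "opposite X" F \<A> \<B>
  proof -
    interpret op: equivalence_setting "opposite X" F by (rule opposite_setting)
    show "two_future_systems (opposite X) F \<A> \<B>"
      using AB A(2) by unfold_locales (simp_all add: opposite_system)
  qed
  fix C D assume C: "C \<in> ?J" and D: "D \<in> ?J"
  obtain D1 where D1: "D1 \<in> \<A>" "D1 \<subseteq> D" "\<And>a w. a \<in> D1 \<Longrightarrow> w \<in> D \<Longrightarrow> le a w \<Longrightarrow> w \<in> D1"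
    using fut.join_end[OF D] by blast
  obtain C1 where C1: "C1 \<in> \<A>" "C1 \<subseteq> C" "\<And>a w. a \<in> C1 \<Longrightarrow> w \<in> C \<Longrightarrow> le w a \<Longrightarrow> w \<in> C1"
    using past.join_end[of C] C by (auto simp: opposite_le)
  have "totally_stable F X C1 D1" using A C1(1) D1(1) by (simp add: stable_total_component_system_def)
  then obtain a b where ab: "a \<in> C1" "b \<in> D1" "b \<in> St_future F X (const_path a) D1" "a \<in> St_past F X C1 (const_path b)"
    by (auto simp: totally_stable_def)
  have "upper_part X D b \<subseteq> upper_part X D1 b" using D1(3)[OF ab(2)] by (auto simp: upper_part_def)
  then have "b \<in> St_future F X (const_path a) D"
    using ab(2,3) D1(2) unfolding St_future_def dpaths_in_def by blast
  moreover have "lower_part X C a \<subseteq> lower_part X C1 a" using C1(3)[OF ab(1)] by (auto simp: lower_part_def)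
  then have "a \<in> St_past F X C (const_path b)"
    using ab(1,4) C1(2) unfolding St_past_def dpaths_in_def by blast
  moreover have "future_stable F X C D" "past_stable F X C D"
    using f p C D by (simp_all add: stable_future_component_system_def stable_past_component_system_def)
  moreover have "a \<in> C" "b \<in> D" using ab(1,2) C1(2) D1(2) by blast+
  ultimately show "totally_stable F X C D" unfolding totally_stable_def by blast
qed

end

section \<open>Coarsest systems\<close>

text \<open>A finite system \<open>\<A>\<close> with the least number of members is coarsest. The
  map \<open>c\<close> from \<open>\<A>\<close> onto its join with \<open>\<B>\<close> is
  injective by minimality, so members of \<open>\<A>\<close> meeting the same member of
  \<open>\<B>\<close> coincide.\<close>

lemma coarsest_if_joins:
  assumes base: "is_system \<A>0" "finite \<A>0"
    and join: "\<And>\<A> \<B>. is_system \<A> \<Longrightarrow> finite \<A> \<Longrightarrow> is_system \<B> \<Longrightarrow> is_system (join_partition U \<A> \<B>)"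
    and partition: "\<And>\<A>. is_system \<A> \<Longrightarrow> \<Union>\<A> = U \<and> {} \<notin> \<A>"
  obtains \<A> where "coarsest is_system \<A>"
proof -
  define N where "N = (LEAST n. \<exists>\<A>. is_system \<A> \<and> finite \<A> \<and> card \<A> = n)"
  have "\<exists>\<A>. is_system \<A> \<and> finite \<A> \<and> card \<A> = N"
    unfolding N_def by (rule LeastI[of _ "card \<A>0"]) (use base in blast)
  then obtain \<A> where A: "is_system \<A>" "finite \<A>" "card \<A> = N" by blast
  have "coarser \<A> \<B>" if B: "is_system \<B>" for \<B>
    unfolding coarser_def
  proof
    fix S assume S: "S \<in> \<B>"
    define J where "J = (\<lambda>x. {y \<in> U. (x, y) \<in> (meets \<A> \<B>)\<^sup>*})"
    have sym: "sym ((meets \<A> \<B>)\<^sup>*)" by (rule sym_rtrancl) (auto simp: sym_def meets_def)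
    have J_eq: "J x = J y" if "(x, y) \<in> (meets \<A> \<B>)\<^sup>*" for x y
      unfolding J_def using that symD[OF sym that] by (auto intro: rtrancl_trans)
    have J_member: "J x = J y" if "T \<in> \<A> \<union> \<B>" "x \<in> T" "y \<in> T" for T x y
      using that by (intro J_eq r_into_rtrancl) (auto simp: meets_def)
    define c where "c = (\<lambda>T. J (SOME x. x \<in> T))"
    have c: "c T = J x" if "T \<in> \<A>" "x \<in> T" for T x
      unfolding c_def using J_member[of T] that by (meson UnI1 someI_ex)
    have img: "join_partition U \<A> \<B> = c ` \<A>"
    proof
      show "join_partition U \<A> \<B> \<subseteq> c ` \<A>"
      proof
        fix T assume "T \<in> join_partition U \<A> \<B>"
        then obtain x where "x \<in> U" "T = J x" by (auto simp: join_partition_def J_def)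
        moreover then obtain R where "R \<in> \<A>" "x \<in> R" using partition[OF A(1)] by blast
        ultimately show "T \<in> c ` \<A>" using c by blast
      qed
      show "c ` \<A> \<subseteq> join_partition U \<A> \<B>"
      proof
        fix T assume "T \<in> c ` \<A>"
        then obtain R where R: "R \<in> \<A>" "T = c R" by blast
        then obtain x where "x \<in> R" using partition[OF A(1)] by fastforce
        then show "T \<in> join_partition U \<A> \<B>"
          using c R partition[OF A(1)] by (auto simp: join_partition_def J_def)
      qed
    qed
    have "is_system (join_partition U \<A> \<B>)" "finite (join_partition U \<A> \<B>)"
      using join[OF A(1,2) B] A(2) img by auto
    then have "N \<le> card (join_partition U \<A> \<B>)" unfolding N_def by (intro Least_le) blast
    then have "inj_on c \<A>" using img A(2,3) card_image_le[OF A(2), of c] by (intro eq_card_imp_inj_on) auto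
    obtain b where b: "b \<in> S" using partition[OF B] S by fastforce
    then obtain R where R: "R \<in> \<A>" "b \<in> R" using partition[OF A(1)] partition[OF B] S by blast
    have "S \<subseteq> R"
    proof
      fix y assume y: "y \<in> S"
      then obtain R' where R': "R' \<in> \<A>" "y \<in> R'" using partition[OF A(1)] partition[OF B] S by blast
      have "c R' = c R" using c R R' J_member[of S y b] S y b by simp
      then show "y \<in> R" using \<open>inj_on c \<A>\<close> R(1) R' by (auto dest: inj_onD)
    qed
    then show "\<exists>A\<in>\<A>. S \<subseteq> A" using R(1) by blast
  qed
  then have "coarsest is_system \<A>" using A(1) by (simp add: coarsest_def)
  then show thesis by (rule that)
qed

lemma (in future_system) directed_finite:
  assumes A: "A \<in> \<S>" and "finite S" "S \<subseteq> A" obtains z where "z \<in> A" "\<And>x. x \<in> S \<Longrightarrow> le x z"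
proof -
  have "\<exists>z\<in>A. \<forall>x\<in>S. le x z"
    using assms(2,3)
  proof (induction rule: finite_induct)
    case empty then show ?case using member_nonempty[OF A] by auto
  next
    case (insert x S)
    then obtain z where z: "z \<in> A" "\<forall>x\<in>S. le x z" by auto
    obtain w where "w \<in> A" "le x w" "le z w" using directed2[OF A _ z(1), of x] insert.prems by auto
    then show ?case using z le_trans by blast
  qed
  then show thesis using that by blast
qed

text \<open>A member \<open>A\<close> of the coarser system is a union of members of
  \<open>\<B>\<close>. An upper bound in \<open>A\<close> of their finitely many final points
  \<open>v B\<close> is a final point of \<open>A\<close>.\<close>

lemma (in future_system) closed_if_coarser_than_closed:
  assumes B: "finite \<B>" "future_closed X \<B>" "\<Union>\<B> = space" and co: "coarser \<S> \<B>"
  shows "future_closed X \<S>"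
  unfolding future_closed_def
proof
  fix A assume A: "A \<in> \<S>"
  define v where "v = (\<lambda>B. SOME x. x \<in> B \<and> (\<forall>y\<in>B. le y x))"
  have v: "v B \<in> B \<and> (\<forall>y\<in>B. le y (v B))" if "B \<in> \<B>" for B
    unfolding v_def using bspec[OF B(2)[unfolded future_closed_def] that] by - (rule someI_ex, simp only: Bex_def)
  have in_A: "v B \<in> A" if b: "B \<in> \<B>" "x \<in> B" "x \<in> A" for B x
  proof -
    obtain A' where A': "A' \<in> \<S>" "B \<subseteq> A'" using co b unfolding coarser_def by blast
    have "A' = A" using comp_eq[OF A'(1), of x] comp_eq[OF A b(3)] A'(2) b(2) by auto
    then show ?thesis using A'(2) v[OF b(1)] by auto
  qed
  let ?S = "v ` {B \<in> \<B>. B \<inter> A \<noteq> {}}"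
  have "finite ?S" using B(1) by simp
  moreover have "?S \<subseteq> A"
  proof
    fix u assume "u \<in> ?S"
    then obtain B x where "B \<in> \<B>" "x \<in> B" "x \<in> A" "u = v B" by blast
    then show "u \<in> A" using in_A[of B x] by simp
  qed
  ultimately obtain z where z: "z \<in> A" "\<And>x. x \<in> ?S \<Longrightarrow> le x z"
    by (rule directed_finite[OF A]) (rule that)
  have "le y z" if y: "y \<in> A" for y
  proof -
    obtain B where b: "B \<in> \<B>" "y \<in> B" using B(3) member_space[OF A y] by blast
    have "v B \<in> ?S" using b y by blast
    from z(2)[OF this] show ?thesis using v[OF b(1)] b(2) le_trans by blast
  qed
  then show "\<exists>x\<in>A. \<forall>y\<in>A. le y x" using z(1) by blast
qed

context equivalence_setting begin

lemma future_system_partition: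
  "stable_future_component_system F X \<A> \<Longrightarrow> \<Union>\<A> = space \<and> {} \<notin> \<A>"
proof -
  assume "stable_future_component_system F X \<A>"
  then interpret future_system X F \<A> by unfold_locales
  show ?thesis using cover member_nonempty by blast
qed

theorem coarsest_future_closed:
  assumes B: "stable_future_component_system F X \<B>" "finite \<B>" "future_closed X \<B>"
  shows "\<exists>\<A>. coarsest (stable_future_component_system F X) \<A> \<and> future_closed X \<A>"
proof -
  obtain \<A> where A: "coarsest (stable_future_component_system F X) \<A>"
    by (rule coarsest_if_joins[OF B(1,2) join_future future_system_partition])
  then interpret future_system X F \<A> by unfold_locales (simp add: coarsest_def)
  have "coarser \<A> \<B>" using A B(1) by (simp add: coarsest_def)
  then have "future_closed X \<A>"
    using closed_if_coarser_than_closed[OF B(2,3)] future_system_partition[OF B(1)] by blast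
  with A show ?thesis by blast
qed

theorem coarsest_past_closed:
  assumes B: "stable_past_component_system F X \<B>" "finite \<B>" "past_closed X \<B>"
  shows "\<exists>\<A>. coarsest (stable_past_component_system F X) \<A> \<and> past_closed X \<A>"
proof -
  interpret op: equivalence_setting "opposite X" F by (rule opposite_setting)
  have closed: "future_closed (opposite X) \<C> \<longleftrightarrow> past_closed X \<C>" for \<C>
    by (simp add: future_closed_def past_closed_def opposite_le)
  have sys: "stable_future_component_system F (opposite X) = stable_past_component_system F X"
    using opposite_system by blast
  have "stable_future_component_system F (opposite X) \<B>" "future_closed (opposite X) \<B>"
    using B by (simp_all only: opposite_system closed)
  from op.coarsest_future_closed[OF this(1) B(2) this(2)] show ?thesis unfolding sys closed .
qed

theorem coarsest_total:
  assumes B: "stable_total_component_system F X \<B>" "finite \<B>"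
  shows "\<exists>\<A>. coarsest (stable_total_component_system F X) \<A>"
proof -
  have "\<Union>\<A> = space \<and> {} \<notin> \<A>" if "stable_total_component_system F X \<A>" for \<A>
    using future_system_partition that by (simp add: stable_total_component_system_def)
  note partition = this
  show ?thesis by (rule coarsest_if_joins[OF B join_total partition]; (assumption | erule exI))
qed

end

section \<open>The realization of a pre-cubical set\<close>

locale cubical =
  fixes K :: "'c precubical"
  assumes precubical: "precubical_set K" and finite_cubes: "finite_precubical K"
    and no_cycles: "precubical_no_loops K"
begin

abbreviation (input) X :: "'c cube_point set dspace" where "X \<equiv> realization K"

definition cells :: "(nat \<times> 'c) set" where "cells = (SIGMA n:UNIV. cubes K n)"

definition cube_sum :: "'c cube_point dspace" where
  "cube_sum = dspace_sum (\<lambda>(n, c). directed_cube n) cells"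

definition pt :: "nat \<Rightarrow> 'c \<Rightarrow> (nat \<Rightarrow> real) \<Rightarrow> 'c cube_point set" where
  "pt n c t = glue_class K ((n, c), t)"

lemma face_in: "c \<in> cubes K (Suc n) \<Longrightarrow> 1 \<le> i \<Longrightarrow> i \<le> Suc n \<Longrightarrow> face K \<epsilon> i c \<in> cubes K n"
  using precubical unfolding precubical_set_def by (metis diff_Suc_1)

lemma face_face:
  assumes "c \<in> cubes K n" "1 \<le> i" "i < j" "j \<le> n"
  shows "face K \<epsilon> i (face K \<eta> j c) = face K \<eta> (j - 1) (face K \<epsilon> i c)"
  using precubical assms unfolding precubical_set_def by blast

lemma finite_cells: "finite cells"
proof -
  have "disjoint_family (cubes K)" using precubical by (simp add: precubical_set_def)
  then have "inj_on snd cells"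
    by (auto simp: inj_on_def cells_def disjoint_family_on_def)
  moreover have "snd ` cells \<subseteq> (\<Union>n. cubes K n)" by (auto simp: cells_def)
  ultimately show ?thesis
    using finite_cubes unfolding finite_precubical_def by (meson finite_imageD finite_subset)
qed

lemma dtop_cube_sum: "dtop cube_sum = sum_topology (\<lambda>i. unit_cube (fst i)) cells"
  by (simp add: cube_sum_def dspace_sum_def directed_cube_def case_prod_unfold)

lemma dtop_realization: "dtop X = quotient_topology (dtop cube_sum) (glue_class K)"
  by (simp add: realization_def dspace_quotient_def cube_sum_def cells_def)

lemma space_realization: "topspace (dtop X) = {pt n c t | n c t. c \<in> cubes K n \<and> t \<in> topspace (unit_cube n)}"
  by (force simp: dtop_realization dtop_cube_sum pt_def cells_def)

lemma pt_in_space: "c \<in> cubes K n \<Longrightarrow> t \<in> topspace (unit_cube n) \<Longrightarrow> pt n c t \<in> topspace (dtop X)"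
  by (auto simp: space_realization)

lemma quotient_map_glue: "quotient_map (dtop cube_sum) (dtop X) (glue_class K)"
  unfolding dtop_realization by (rule quotient_map_quotient_topology)

lemma glue_class_eq:
  assumes "(p, p') \<in> glue K" shows "glue_class K p = glue_class K p'"
proof -
  have "sym ((glue K \<union> (glue K)\<inverse>)\<^sup>*)" by (rule sym_rtrancl) (auto simp: sym_def)
  moreover have "(p, p') \<in> (glue K \<union> (glue K)\<inverse>)\<^sup>*" using assms by blast
  ultimately show ?thesis
    unfolding glue_class_def by (auto intro: rtrancl_trans dest: symD)
qed

lemma pt_face:
  assumes "c \<in> cubes K n" "1 \<le> i" "i \<le> n" "t \<in> topspace (unit_cube (n - 1))"
  shows "pt n c (insert_coord n i (of_bool \<epsilon>) t) = pt (n - 1) (face K \<epsilon> i c) t"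
  unfolding pt_def by (rule glue_class_eq[symmetric]) (use assms in \<open>auto simp: glue_def\<close>)

text \<open>The map induced on gluing classes by a map \<open>f\<close> that respects the gluing,
  computed at some representative.\<close>

definition lift :: "('c cube_point \<Rightarrow> 'b) \<Rightarrow> 'c cube_point set \<Rightarrow> 'b" where
  "lift f x = f (SOME p. p \<in> x)"

lemma lift_glue_class:
  assumes "\<And>p p'. (p, p') \<in> glue K \<Longrightarrow> f p = f p'"
  shows "lift f (glue_class K p) = f p"
proof -
  define r where "r = (SOME p'. p' \<in> glue_class K p)"
  have "p \<in> glue_class K p" by (simp add: glue_class_def)
  then have "r \<in> glue_class K p" unfolding r_def by (rule someI)
  then have "(p, r) \<in> (glue K \<union> (glue K)\<inverse>)\<^sup>*" by (simp add: glue_class_def)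
  then have "f r = f p"
  proof (induction rule: rtrancl_induct)
    case (step y z)
    then have "f y = f z" using assms[of y z] assms[of z y] by auto
    then show ?case using step by simp
  qed simp
  then show ?thesis by (simp add: lift_def r_def)
qed

lemma lift_pt:
  assumes "\<And>n c \<epsilon> i t. c \<in> cubes K n \<Longrightarrow> 1 \<le> i \<Longrightarrow> i \<le> n \<Longrightarrow> t \<in> topspace (unit_cube (n - 1)) \<Longrightarrow>
      f (n - 1) (face K \<epsilon> i c) t = f n c (insert_coord n i (of_bool \<epsilon>) t)"
  shows "lift (\<lambda>((n, c), t). f n c t) (pt n c t) = f n c t"
proof -
  have "lift (\<lambda>((n, c), t). f n c t) (glue_class K ((n, c), t)) = (\<lambda>((n, c), t). f n c t) ((n, c), t)"
    by (rule lift_glue_class) (use assms in \<open>auto simp: glue_def\<close>)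
  then show ?thesis by (simp add: pt_def)
qed

subsection \<open>Its d-paths\<close>

lemma pathin_concat:
  assumes "pathin T \<alpha>" "pathin T \<beta>" "\<alpha> 1 = \<beta> 0" shows "pathin T (path_concat \<alpha> \<beta>)"
proof -
  have "continuous_map (prod_topology unit_interval unit_interval) T (\<lambda>p. path_concat \<alpha> \<beta> (snd p))"
    by (rule continuous_map_path_concat[where a = "\<lambda>_. \<alpha>" and b = "\<lambda>_. \<beta>",
          OF continuous_map_compose'[OF assms(1)[unfolded pathin_def] continuous_map_snd]
            continuous_map_compose'[OF assms(2)[unfolded pathin_def] continuous_map_snd] assms(3)])
  moreover have "continuous_map unit_interval (prod_topology unit_interval unit_interval) (\<lambda>t. (0::real, t))"
    by (intro continuous_map_pairedI) (simp_all add: continuous_map_into_unit_interval)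
  ultimately have "continuous_map unit_interval T (\<lambda>t. path_concat \<alpha> \<beta> (snd (0::real, t)))"
    by (rule continuous_map_compose')
  then show ?thesis by (simp add: pathin_def)
qed

lemma pathin_reparam:
  assumes "pathin T \<alpha>" "continuous_on {0..1} \<phi>" "\<phi> ` {0..1} \<subseteq> {0..1}"
  shows "pathin T (restrict (\<alpha> \<circ> \<phi>) {0..1})"
proof -
  have "continuous_map unit_interval unit_interval \<phi>" using assms by (auto simp: continuous_map_into_unit_interval)
  then have "continuous_map unit_interval T (\<lambda>t. \<alpha> (\<phi> t))"
    by (rule continuous_map_compose'[OF assms(1)[unfolded pathin_def]])
  then show ?thesis unfolding pathin_def by (rule continuous_map_eq) simp
qed

lemma pathin_const_path: "x \<in> topspace T \<Longrightarrow> pathin T (const_path x)"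
  unfolding pathin_def by (rule continuous_map_eq[of _ _ "\<lambda>_. x"]) (auto simp: const_path_def)

lemma d_space_all_paths: "d_space \<lparr>dtop = T, dpaths = {\<alpha> \<in> extensional {0..1}. pathin T \<alpha>}\<rparr>"
  unfolding d_space_def dspace.select_convs
  by (intro conjI ballI allI impI)
    (simp_all add: pathin_concat pathin_reparam pathin_const_path, simp_all add: path_concat_def const_path_def)

text \<open>The family of d-structures over which the realization takes the intersection.\<close>

definition structures :: "(real \<Rightarrow> 'c cube_point set) set set" where
  "structures = {P. d_space \<lparr>dtop = dtop X, dpaths = P\<rparr> \<and>
                     (\<forall>\<alpha>\<in>dpaths cube_sum. restrict (glue_class K \<circ> \<alpha>) {0..1} \<in> P)}"

lemma dpaths_realization: "dpaths X = \<Inter>structures"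
  unfolding structures_def dtop_realization
  by (simp add: realization_def dspace_quotient_def cube_sum_def cells_def)

lemma cube_sum_path_continuous:
  assumes "\<alpha> \<in> dpaths cube_sum"
  shows "pathin (dtop X) (restrict (glue_class K \<circ> \<alpha>) {0..1})"
proof -
  obtain i a where i: "i \<in> cells" "\<alpha> = (\<lambda>t\<in>{0..1}. (i, a t))" and a: "pathin (unit_cube (fst i)) a"
    using assms by (auto simp: cube_sum_def dspace_sum_def directed_cube_def split: prod.splits)
  have "continuous_map unit_interval (dtop cube_sum) (\<lambda>t. (i, a t))"
    unfolding dtop_cube_sum
    by (rule continuous_map_compose'[OF continuous_map_component_injection[where X = "\<lambda>i. unit_cube (fst i)", OF i(1)] a[unfolded pathin_def]])
  from continuous_map_compose'[OF quotient_imp_continuous_map[OF quotient_map_glue] this]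
  show ?thesis unfolding pathin_def by (rule continuous_map_eq) (simp add: i)
qed

lemma all_paths_structure: "{\<alpha> \<in> extensional {0..1}. pathin (dtop X) \<alpha>} \<in> structures"
  using d_space_all_paths cube_sum_path_continuous by (simp add: structures_def)

lemma d_space_realization: "d_space X"
proof -
  have s: "d_space \<lparr>dtop = dtop X, dpaths = P\<rparr>" if "P \<in> structures" for P using that by (simp add: structures_def)
  have all: "dpaths X \<subseteq> {\<alpha> \<in> extensional {0..1}. pathin (dtop X) \<alpha>}"
    using all_paths_structure unfolding dpaths_realization by blast
  show ?thesis
    unfolding d_space_def
  proof (intro conjI ballI allI impI)
    fix \<alpha> assume "\<alpha> \<in> dpaths X"
    then show "pathin (dtop X) \<alpha>" "\<alpha> \<in> extensional {0..1}" using all by blast+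
  next
    fix x assume x: "x \<in> topspace (dtop X)"
    show "const_path x \<in> dpaths X"
      unfolding dpaths_realization
    proof
      fix P assume "P \<in> structures"
      from s[OF this] x show "const_path x \<in> P" by (simp add: d_space_def)
    qed
  next
    fix \<alpha> \<beta> assume a: "\<alpha> \<in> dpaths X" "\<beta> \<in> dpaths X" "\<alpha> 1 = \<beta> 0"
    show "path_concat \<alpha> \<beta> \<in> dpaths X"
      unfolding dpaths_realization
    proof
      fix P assume P: "P \<in> structures"
      have "\<alpha> \<in> P" "\<beta> \<in> P" using a P unfolding dpaths_realization by blast+
      with s[OF P] a(3) show "path_concat \<alpha> \<beta> \<in> P" by (simp add: d_space_def)
    qed
  next
    fix \<alpha> \<phi> assume a: "\<alpha> \<in> dpaths X" "continuous_on {0..1} \<phi> \<and> \<phi> ` {0..1} \<subseteq> {0..1} \<and> mono_on {0..1} (\<phi> :: real \<Rightarrow> real)"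
    show "restrict (\<alpha> \<circ> \<phi>) {0..1} \<in> dpaths X"
      unfolding dpaths_realization
    proof
      fix P assume P: "P \<in> structures"
      have "\<alpha> \<in> P" using a P unfolding dpaths_realization by blast
      with s[OF P] a(2) show "restrict (\<alpha> \<circ> \<phi>) {0..1} \<in> P" by (simp add: d_space_def)
    qed
  qed
qed

sublocale dspace X by unfold_locales (rule d_space_realization)

lemma cube_path:
  assumes c: "c \<in> cubes K n" and a: "\<And>i. i \<in> {1..n} \<Longrightarrow> continuous_on {0..1} (\<lambda>s. a s i)"
    "\<And>i. i \<in> {1..n} \<Longrightarrow> mono_on {0..1} (\<lambda>s. a s i)" "\<And>s. s \<in> {0..1} \<Longrightarrow> a s \<in> topspace (unit_cube n)"
  shows "(\<lambda>s\<in>{0..1}. pt n c (a s)) \<in> dpaths X"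
proof -
  have ext: "(\<lambda>i\<in>{1..n}. a s i) = a s" if "s \<in> {0..1}" for s
    using a(3)[OF that] by (auto simp: topspace_unit_cube PiE_def extensional_restrict)
  have "continuous_map unit_interval (unit_cube n) (\<lambda>s. \<lambda>i\<in>{1..n}. a s i)"
    by (rule continuous_map_into_unit_cube) (use a(1) a(3)[THEN unit_cube_range] in auto)
  then have "continuous_map unit_interval (unit_cube n) (\<lambda>s\<in>{0..1}. a s)"
    by (rule continuous_map_eq) (use ext in auto)
  moreover have "mono_on {0..1} (\<lambda>s. (\<lambda>s\<in>{0..1}. a s) s i)" if "i \<in> {1..n}" for i
    using a(2)[OF that] by (auto simp: monotone_on_def)
  ultimately have "(\<lambda>s\<in>{0..1}. a s) \<in> dpaths (directed_cube n)"
    by (simp add: directed_cube_def pathin_def)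
  then have "(\<lambda>t\<in>{0..1}. ((n, c), (\<lambda>s\<in>{0..1}. a s) t)) \<in> dpaths cube_sum"
    using c unfolding cube_sum_def dspace_sum_def cells_def dspace.select_convs
    by (intro CollectI exI[of _ "(n, c)"] exI[of _ "\<lambda>s\<in>{0..1}. a s"]) simp
  then have "restrict (glue_class K \<circ> (\<lambda>t\<in>{0..1}. ((n, c), (\<lambda>s\<in>{0..1}. a s) t))) {0..1} \<in> dpaths X"
    unfolding dpaths_realization structures_def by blast
  moreover have "restrict (glue_class K \<circ> (\<lambda>t\<in>{0..1}. ((n, c), (\<lambda>s\<in>{0..1}. a s) t))) {0..1} = (\<lambda>s\<in>{0..1}. pt n c (a s))"
    by (simp add: fun_eq_iff pt_def restrict_def)
  ultimately show ?thesis by simp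
qed

text \<open>The d-paths satisfying \<open>Q\<close> form a d-structure containing the images of
  the d-paths of the cubes, and the d-structure of the realization is the smallest such one.\<close>

lemma dpath_induct [consumes 1, case_names const concat reparam cube]:
  assumes "\<alpha> \<in> dpaths X"
    and const: "\<And>x. x \<in> topspace (dtop X) \<Longrightarrow> Q (const_path x)"
    and concat: "\<And>\<alpha> \<beta>. \<alpha> \<in> dpaths X \<Longrightarrow> \<beta> \<in> dpaths X \<Longrightarrow> Q \<alpha> \<Longrightarrow> Q \<beta> \<Longrightarrow> \<alpha> 1 = \<beta> 0 \<Longrightarrow> Q (path_concat \<alpha> \<beta>)"
    and reparam: "\<And>\<alpha> \<phi>. \<alpha> \<in> dpaths X \<Longrightarrow> Q \<alpha> \<Longrightarrow> continuous_on {0..1} \<phi> \<Longrightarrow> \<phi> ` {0..1} \<subseteq> {0..1} \<Longrightarrow> mono_on {0..1} \<phi> \<Longrightarrow>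
        Q (restrict (\<alpha> \<circ> \<phi>) {0..1})"
    and cube: "\<And>n c a. c \<in> cubes K n \<Longrightarrow> (\<And>s. s \<in> {0..1} \<Longrightarrow> a s \<in> topspace (unit_cube n)) \<Longrightarrow>
        (\<And>i. i \<in> {1..n} \<Longrightarrow> continuous_on {0..1} (\<lambda>s. a s i)) \<Longrightarrow>
        (\<And>i. i \<in> {1..n} \<Longrightarrow> mono_on {0..1} (\<lambda>s. a s i)) \<Longrightarrow> Q (\<lambda>s\<in>{0..1}. pt n c (a s))"
  shows "Q \<alpha>"
proof -
  let ?P = "{\<alpha> \<in> dpaths X. Q \<alpha>}"
  have "?P \<in> structures"
    unfolding structures_def
  proof (rule CollectI, intro conjI ballI)
    show "d_space \<lparr>dtop = dtop X, dpaths = ?P\<rparr>"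
      using d_space_realization const concat reparam
      unfolding d_space_def dspace.select_convs by (simp add: image_subset_iff)
    fix \<alpha> assume a: "\<alpha> \<in> dpaths cube_sum"
    then obtain n c b where b: "c \<in> cubes K n" "\<alpha> = (\<lambda>t\<in>{0..1}. ((n, c), b t))" "b \<in> dpaths (directed_cube n)"
      by (auto simp: cube_sum_def dspace_sum_def cells_def)
    have cont: "continuous_map unit_interval (unit_cube n) b" and mono: "\<And>i. i \<in> {1..n} \<Longrightarrow> mono_on {0..1} (\<lambda>t. b t i)"
      using b(3) by (auto simp: directed_cube_def pathin_def)
    have eq: "restrict (glue_class K \<circ> \<alpha>) {0..1} = (\<lambda>s\<in>{0..1}. pt n c (b s))"
      by (simp add: fun_eq_iff b(2) pt_def restrict_def)
    have "Q (\<lambda>s\<in>{0..1}. pt n c (b s))"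
    proof (rule cube[OF b(1) _ _ mono])
      show "b s \<in> topspace (unit_cube n)" if "s \<in> {0..1}" for s
        using continuous_map_funspace[OF cont] that by auto
      show "continuous_on {0..1} (\<lambda>s. b s i)" if "i \<in> {1..n}" for i
        using continuous_map_unit_cube_coord[OF cont that] by simp
    qed
    moreover have "restrict (glue_class K \<circ> \<alpha>) {0..1} \<in> dpaths X"
      using a unfolding dpaths_realization structures_def by blast
    ultimately show "restrict (glue_class K \<circ> \<alpha>) {0..1} \<in> ?P" unfolding eq by simp
  qed
  then have "dpaths X \<subseteq> ?P" unfolding dpaths_realization by blast
  then show ?thesis using assms(1) by blast
qed

subsection \<open>Acting on coordinates\<close>

text \<open>Fixing 0 and 1 makes the coordinatewise action compatible with faces, and monotonicity
  makes it compatible with the order. Discontinuous maps are included for the sake of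
  \<open>center\<close>, which jumps at the ends of the interval.\<close>

definition unit_map :: "(real \<Rightarrow> real) \<Rightarrow> bool" where
  "unit_map \<phi> \<longleftrightarrow> \<phi> 0 = 0 \<and> \<phi> 1 = 1 \<and> mono_on {0..1} \<phi>"

lemma unit_map_range: "unit_map \<phi> \<Longrightarrow> \<tau> \<in> {0..1} \<Longrightarrow> \<phi> \<tau> \<in> {0..1}"
  unfolding unit_map_def using monotone_onD[of "{0..1}" "(\<le>)" "(\<le>)" \<phi> 0 \<tau>] monotone_onD[of "{0..1}" "(\<le>)" "(\<le>)" \<phi> \<tau> 1] by auto

definition on_coords :: "(real \<Rightarrow> real) \<Rightarrow> nat \<Rightarrow> (nat \<Rightarrow> real) \<Rightarrow> nat \<Rightarrow> real" where
  "on_coords \<phi> n t = (\<lambda>i\<in>{1..n}. \<phi> (t i))"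

definition act :: "(real \<Rightarrow> real) \<Rightarrow> 'c cube_point set \<Rightarrow> 'c cube_point set" where
  "act \<phi> = lift (\<lambda>((n, c), t). pt n c (on_coords \<phi> n t))"

lemma on_coords_in_cube:
  assumes "unit_map \<phi>" "t \<in> topspace (unit_cube n)" shows "on_coords \<phi> n t \<in> topspace (unit_cube n)"
proof -
  have "\<phi> (t i) \<in> {0..1}" if "i \<in> {1..n}" for i
    using unit_map_range[OF assms(1), of "t i"] unit_cube_range[OF assms(2) that] by simp
  then show ?thesis by (auto simp: on_coords_def topspace_unit_cube)
qed

lemma act_pt:
  assumes "unit_map \<phi>" shows "act \<phi> (pt n c t) = pt n c (on_coords \<phi> n t)"
  unfolding act_def
proof (rule lift_pt)
  fix n c \<epsilon> i t
  assume c: "c \<in> cubes K n" "1 \<le> i" "i \<le> n" and t: "t \<in> topspace (unit_cube (n - 1))"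
  have "on_coords \<phi> n (insert_coord n i (of_bool \<epsilon>) t) = insert_coord n i (of_bool \<epsilon>) (on_coords \<phi> (n - 1) t)"
  proof
    fix k show "on_coords \<phi> n (insert_coord n i (of_bool \<epsilon>) t) k = insert_coord n i (of_bool \<epsilon>) (on_coords \<phi> (n - 1) t) k"
      using assms c by (auto simp: on_coords_def insert_coord_def unit_map_def)
  qed
  then show "pt (n - 1) (face K \<epsilon> i c) (on_coords \<phi> (n - 1) t) = pt n c (on_coords \<phi> n (insert_coord n i (of_bool \<epsilon>) t))"
    using pt_face[OF c on_coords_in_cube[OF assms t]] by simp
qed

lemma spaceE:
  assumes "x \<in> topspace (dtop X)"
  obtains n c t where "x = pt n c t" "c \<in> cubes K n" "t \<in> topspace (unit_cube n)"
  using assms by (auto simp: space_realization)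

lemma act_space: "unit_map \<phi> \<Longrightarrow> x \<in> topspace (dtop X) \<Longrightarrow> act \<phi> x \<in> topspace (dtop X)"
  by (erule spaceE) (simp add: act_pt pt_in_space on_coords_in_cube)

lemma on_coords_on_coords: "on_coords \<phi> n (on_coords \<psi> n t) = on_coords (\<phi> \<circ> \<psi>) n t"
  by (auto simp: on_coords_def)

lemma act_act:
  assumes "unit_map \<phi>" "unit_map \<psi>" "unit_map (\<phi> \<circ> \<psi>)" "x \<in> topspace (dtop X)"
  shows "act \<phi> (act \<psi> x) = act (\<phi> \<circ> \<psi>) x"
  using assms(4) by (rule spaceE) (simp add: act_pt assms on_coords_on_coords)

lemma line_le:
  assumes c: "c \<in> cubes K n" and u: "u \<in> topspace (unit_cube n)" and v: "v \<in> topspace (unit_cube n)"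
    and uv: "\<And>i. i \<in> {1..n} \<Longrightarrow> u i \<le> v i"
  shows "dle X (pt n c u) (pt n c v)"
proof -
  let ?a = "\<lambda>s. \<lambda>i\<in>{1..n}. (1 - s) * u i + s * v i"
  have p: "(\<lambda>s\<in>{0..1}. pt n c (?a s)) \<in> dpaths X"
  proof (rule cube_path[OF c])
    fix i assume i: "i \<in> {1..n}"
    show "continuous_on {0..1} (\<lambda>s. ?a s i)" using i by (auto intro!: continuous_intros)
    show "mono_on {0..1} (\<lambda>s. ?a s i)"
    proof (rule mono_onI)
      fix r s :: real assume "r \<le> s"
      then have "0 \<le> (s - r) * (v i - u i)" using uv[OF i] by (intro mult_nonneg_nonneg) auto
      then show "?a r i \<le> ?a s i" using i by (simp add: algebra_simps)
    qed
  next
    fix s :: real assume s: "s \<in> {0..1}"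
    have "(1 - s) * u i + s * v i \<in> {0..1}" if i: "i \<in> {1..n}" for i
      using unit_cube_range[OF u i] unit_cube_range[OF v i] s convex_bound_le[of "u i" 1 "v i" "1 - s" s] by auto
    then show "?a s \<in> topspace (unit_cube n)" by (auto simp: topspace_unit_cube)
  qed
  have "?a 0 = u" "?a 1 = v" using u v by (auto simp: topspace_unit_cube PiE_def extensional_restrict)
  then have "(\<lambda>s\<in>{0..1}. pt n c (?a s)) \<in> dpaths_from_to X (pt n c u) (pt n c v)"
    using p by (simp add: dpaths_from_to_def)
  then show ?thesis unfolding dle_def dpaths_between_eq by blast
qed

lemma act_dpath:
  assumes \<phi>: "unit_map \<phi>" "continuous_on {0..1} \<phi>" and "\<alpha> \<in> dpaths X"
  shows "(\<lambda>t\<in>{0..1}. act \<phi> (\<alpha> t)) \<in> dpaths X"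
  using assms(3)
proof (induction rule: dpath_induct)
  case (const x)
  then have "const_path (act \<phi> x) \<in> dpaths X" using dpaths_const[OF act_space[OF \<phi>(1)]] by (simp add: dpaths_from_to_def)
  moreover have "(\<lambda>t\<in>{0..1}. act \<phi> (const_path x t)) = const_path (act \<phi> x)"
    by (simp add: fun_eq_iff const_path_def restrict_def)
  ultimately show ?case by (simp only:)
next
  case (concat \<alpha> \<beta>)
  define a b where "a = (\<lambda>t\<in>{0..1}. act \<phi> (\<alpha> t))" and "b = (\<lambda>t\<in>{0..1}. act \<phi> (\<beta> t))"
  have "a \<in> dpaths X" "b \<in> dpaths X" unfolding a_def b_def by (rule concat.IH)+
  moreover have "a 1 = b 0" using concat.hyps(3) by (simp add: a_def b_def)
  ultimately have "path_concat a b \<in> dpaths_from_to X (a 0) (b 1)"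
    by (intro dpaths_concat[of a "a 0" "a 1"]) (simp_all add: dpaths_from_to_def)
  moreover have "(\<lambda>t\<in>{0..1}. act \<phi> (path_concat \<alpha> \<beta> t)) = path_concat a b"
    by (auto simp: path_concat_def fun_eq_iff a_def b_def)
  ultimately show ?case by (simp only: dpaths_from_to_def mem_Collect_eq)
next
  case (reparam \<alpha> \<psi>)
  have "restrict ((\<lambda>t\<in>{0..1}. act \<phi> (\<alpha> t)) \<circ> \<psi>) {0..1} \<in> dpaths X" using reparam by (intro dpaths_reparam)
  moreover have "(\<lambda>t\<in>{0..1}. act \<phi> (restrict (\<alpha> \<circ> \<psi>) {0..1} t)) = restrict ((\<lambda>t\<in>{0..1}. act \<phi> (\<alpha> t)) \<circ> \<psi>) {0..1}"
    using reparam.hyps(3) by (auto simp: fun_eq_iff image_subset_iff)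
  ultimately show ?case by (simp only:)
next
  case (cube n c a)
  have "(\<lambda>s\<in>{0..1}. pt n c (on_coords \<phi> n (a s))) \<in> dpaths X"
  proof (rule cube_path[OF cube(1)])
    show "on_coords \<phi> n (a s) \<in> topspace (unit_cube n)" if "s \<in> {0..1}" for s
      using on_coords_in_cube[OF \<phi>(1) cube(2)[OF that]] .
    fix i assume i: "i \<in> {1..n}"
    have r: "a s i \<in> {0..1}" if "s \<in> {0..1}" for s using unit_cube_range[OF cube(2)[OF that] i] by simp
    have "continuous_on {0..1} (\<lambda>s. \<phi> (a s i))"
      by (rule continuous_on_compose2[OF \<phi>(2) cube(3)[OF i]]) (use r in blast)
    then show "continuous_on {0..1} (\<lambda>s. on_coords \<phi> n (a s) i)" using i by (simp add: on_coords_def)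
    show "mono_on {0..1} (\<lambda>s. on_coords \<phi> n (a s) i)"
    proof (rule mono_onI)
      fix s s' :: real assume s: "s \<in> {0..1}" "s' \<in> {0..1}" "s \<le> s'"
      have "a s i \<le> a s' i" using monotone_onD[OF cube(4)[OF i]] s by auto
      then show "on_coords \<phi> n (a s) i \<le> on_coords \<phi> n (a s') i"
        using \<phi>(1) r[OF s(1)] r[OF s(2)] i by (auto simp: on_coords_def unit_map_def intro: monotone_onD)
    qed
  qed
  moreover have "(\<lambda>t\<in>{0..1}. act \<phi> ((\<lambda>s\<in>{0..1}. pt n c (a s)) t)) = (\<lambda>s\<in>{0..1}. pt n c (on_coords \<phi> n (a s)))"
    by (simp add: fun_eq_iff act_pt[OF \<phi>(1)])
  ultimately show ?case by (simp only:)
qed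

lemma dle_iff: "dle X x y \<longleftrightarrow> dpaths_from_to X x y \<noteq> {}"
  by (simp add: dle_def dpaths_between_eq)

lemma dle_trans: "dle X x y \<Longrightarrow> dle X y z \<Longrightarrow> dle X x z"
  unfolding dle_iff using dpaths_concat by fastforce

text \<open>The image of a d-path under a discontinuous \<open>\<phi>\<close> is not a path.
  Inside a cube, however, the order contains the coordinatewise order, which \<open>\<phi>\<close>
  preserves, and this spreads to all d-paths by transitivity.\<close>

lemma act_mono:
  assumes \<phi>: "unit_map \<phi>" and le: "dle X x y"
  shows "dle X (act \<phi> x) (act \<phi> y)"
proof -
  have "\<forall>s\<in>{0..1}. \<forall>t\<in>{0..1}. s \<le> t \<longrightarrow> dle X (act \<phi> (\<alpha> s)) (act \<phi> (\<alpha> t))" if "\<alpha> \<in> dpaths X" for \<alpha>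
    using that
  proof (induction rule: dpath_induct)
    case (const x)
    then show ?case using dpaths_const[OF act_space[OF \<phi>]] by (auto simp: const_path_def dle_iff)
  next
    case (concat \<alpha> \<beta>)
    show ?case
    proof (intro ballI impI)
      fix s t :: real assume st: "s \<in> {0..1}" "t \<in> {0..1}" "s \<le> t"
      consider "t \<le> 1/2" | "s \<le> 1/2" "1/2 < t" | "1/2 < s" using st by linarith
      then show "dle X (act \<phi> (path_concat \<alpha> \<beta> s)) (act \<phi> (path_concat \<alpha> \<beta> t))"
      proof cases
        case 1 then show ?thesis using bspec[OF bspec[OF concat.IH(1), of "2 * s"], of "2 * t"] st by (simp add: path_concat_def)
      next
        case 2
        have "dle X (act \<phi> (\<alpha> (2 * s))) (act \<phi> (\<alpha> 1))" "dle X (act \<phi> (\<beta> 0)) (act \<phi> (\<beta> (2 * t-1)))"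
          using bspec[OF bspec[OF concat.IH(1), of "2 * s"], of "1"] bspec[OF bspec[OF concat.IH(2), of "0"], of "2 * t-1"] st 2 by simp_all
        then show ?thesis using 2 st dle_trans[of "act \<phi> (\<alpha> (2 * s))" "act \<phi> (\<alpha> 1)"] concat.hyps(3) by (simp add: path_concat_def)
      next
        case 3 then show ?thesis using bspec[OF bspec[OF concat.IH(2), of "2 * s-1"], of "2 * t-1"] st by (simp add: path_concat_def)
      qed
    qed
  next
    case (reparam \<alpha> \<psi>)
    then show ?case by (auto simp: image_subset_iff dest: monotone_onD)
  next
    case (cube n c a)
    show ?case
    proof (intro ballI impI)
      fix s t :: real assume st: "s \<in> {0..1}" "t \<in> {0..1}" "s \<le> t"
      have "on_coords \<phi> n (a s) i \<le> on_coords \<phi> n (a t) i" if i: "i \<in> {1..n}" for i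
        using monotone_onD[OF cube(4)[OF i]] st unit_cube_range[OF cube(2)[OF st(1)] i] unit_cube_range[OF cube(2)[OF st(2)] i] \<phi> i
        by (auto simp: on_coords_def unit_map_def intro!: monotone_onD[of "{0..1}" "(\<le>)" "(\<le>)" \<phi>])
      then show "dle X (act \<phi> ((\<lambda>s\<in>{0..1}. pt n c (a s)) s)) (act \<phi> ((\<lambda>s\<in>{0..1}. pt n c (a s)) t))"
        using st line_le[OF cube(1) on_coords_in_cube[OF \<phi> cube(2)[OF st(1)]] on_coords_in_cube[OF \<phi> cube(2)[OF st(2)]]]
        by (simp add: act_pt[OF \<phi>])
    qed
  qed
  moreover obtain \<alpha> where "\<alpha> \<in> dpaths X" "\<alpha> 0 = x" "\<alpha> 1 = y" using le by (auto simp: dle_iff dpaths_from_to_def)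
  ultimately show ?thesis by force
qed

subsection \<open>A function increasing along d-paths\<close>

definition edges :: "('c \<times> 'c) set" where
  "edges = {(face K False 1 e, face K True 1 e) | e. e \<in> cubes K 1}"

lemma edges_trancl_list:
  assumes "(u, v) \<in> edges\<^sup>+"
  shows "\<exists>es. es \<noteq> [] \<and> set es \<subseteq> cubes K 1 \<and> face K False 1 (hd es) = u \<and> face K True 1 (last es) = v \<and>
    (\<forall>i. Suc i < length es \<longrightarrow> face K True 1 (es ! i) = face K False 1 (es ! Suc i))"
  using assms
proof (induction rule: trancl_induct)
  case (base v)
  then obtain e where "e \<in> cubes K 1" "u = face K False 1 e" "v = face K True 1 e" by (auto simp: edges_def)
  then show ?case by (intro exI[of _ "[e]"]) auto
next
  case (step v w)
  then obtain es where es: "es \<noteq> []" "set es \<subseteq> cubes K 1" "face K False 1 (hd es) = u" "face K True 1 (last es) = v"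
    "\<And>i. Suc i < length es \<Longrightarrow> face K True 1 (es ! i) = face K False 1 (es ! Suc i)" by blast
  obtain e where e: "e \<in> cubes K 1" "v = face K False 1 e" "w = face K True 1 e" using step by (auto simp: edges_def)
  have "face K True 1 ((es @ [e]) ! i) = face K False 1 ((es @ [e]) ! Suc i)" if "Suc i < length (es @ [e])" for i
  proof (cases "Suc i < length es")
    case True then show ?thesis using es(5) by (simp add: nth_append)
  next
    case False
    then have "i = length es - 1" "Suc i = length es" using that es(1) by auto
    then show ?thesis using es(1,4) e by (simp add: nth_append last_conv_nth)
  qed
  then show ?case using es e by (intro exI[of _ "es @ [e]"]) auto
qed

lemma edges_acyclic: "(v, v) \<notin> edges\<^sup>+"
  using edges_trancl_list[of v v] no_cycles unfolding precubical_no_loops_def by metis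

lemma finite_edges: "finite edges"
proof -
  have "finite (cubes K 1)" using finite_cubes unfolding finite_precubical_def by (rule finite_subset[rotated]) blast
  moreover have "edges = (\<lambda>e. (face K False 1 e, face K True 1 e)) ` cubes K 1" by (auto simp: edges_def)
  ultimately show ?thesis by simp
qed

text \<open>The number of vertices strictly below \<open>v\<close>. It increases strictly along
  edges because there are no cycles.\<close>

definition height :: "'c \<Rightarrow> nat" where "height v = card {u. (u, v) \<in> edges\<^sup>+}"

lemma height_edge:
  assumes "e \<in> cubes K 1" shows "height (face K False 1 e) < height (face K True 1 e)"
proof -
  let ?v = "face K False 1 e" and ?w = "face K True 1 e"
  have e: "(?v, ?w) \<in> edges" using assms by (auto simp: edges_def)
  have "finite {u. (u, ?w) \<in> edges\<^sup>+}"
    by (rule finite_subset[of _ "fst ` edges\<^sup>+"]) (use finite_edges in force)+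
  moreover have "{u. (u, ?v) \<in> edges\<^sup>+} \<subset> {u. (u, ?w) \<in> edges\<^sup>+}"
    using e edges_acyclic[of ?v] by (auto intro: trancl_into_trancl)
  ultimately show ?thesis unfolding height_def by (rule psubset_card_mono)
qed

text \<open>The multilinear interpolation on a cube of the heights of its vertices.\<close>

primrec level :: "nat \<Rightarrow> 'c \<Rightarrow> (nat \<Rightarrow> real) \<Rightarrow> real" where
  "level 0 c t = real (height c)"
| "level (Suc n) c t = (1 - t (Suc n)) * level n (face K False (Suc n) c) t + t (Suc n) * level n (face K True (Suc n) c) t"

lemma level_cong: "(\<And>i. i \<in> {1..n} \<Longrightarrow> t i = t' i) \<Longrightarrow> level n c t = level n c t'"
proof (induction n arbitrary: c)
  case (Suc n)
  then show ?case by (simp add: Suc.IH[of "face K _ (Suc n) c"])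
qed simp

text \<open>On a face, a multilinear function is the multilinear interpolation of the vertices of
  that face. Thus the functions on the individual cubes fit together to one on the realization.\<close>

lemma level_face:
  "c \<in> cubes K (Suc n) \<Longrightarrow> 1 \<le> i \<Longrightarrow> i \<le> Suc n \<Longrightarrow>
    level (Suc n) c (insert_coord (Suc n) i (of_bool \<epsilon>) t) = level n (face K \<epsilon> i c) t"
proof (induction n arbitrary: c i)
  case 0
  then have "i = 1" by simp
  then show ?case by (simp add: insert_coord_def)
next
  case (Suc n)
  let ?t = "insert_coord (Suc (Suc n)) i (of_bool \<epsilon>) t"
  show ?case
  proof (cases "i = Suc (Suc n)")
    case True
    have "level (Suc n) c' ?t = level (Suc n) c' t" for c'
      by (rule level_cong) (auto simp: insert_coord_def True)
    moreover have "?t (Suc (Suc n)) = of_bool \<epsilon>" by (simp add: insert_coord_def True)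
    ultimately show ?thesis using True by (cases \<epsilon>) auto
  next
    case False
    then have i: "1 \<le> i" "i \<le> Suc n" using Suc.prems by auto
    have t: "?t (Suc (Suc n)) = t (Suc n)" using i by (simp add: insert_coord_def)
    have "level (Suc n) (face K \<eta> (Suc (Suc n)) c) ?t = level n (face K \<eta> (Suc n) (face K \<epsilon> i c)) t" for \<eta>
    proof -
      have "level (Suc n) (face K \<eta> (Suc (Suc n)) c) ?t =
          level (Suc n) (face K \<eta> (Suc (Suc n)) c) (insert_coord (Suc n) i (of_bool \<epsilon>) t)"
        by (rule level_cong) (use i in \<open>auto simp: insert_coord_def\<close>)
      also have "\<dots> = level n (face K \<epsilon> i (face K \<eta> (Suc (Suc n)) c)) t"
        using Suc.IH[OF face_in[OF Suc.prems(1)] i] by simp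
      also have "face K \<epsilon> i (face K \<eta> (Suc (Suc n)) c) = face K \<eta> (Suc n) (face K \<epsilon> i c)"
        using face_face[OF Suc.prems(1) i(1), of "Suc (Suc n)"] i(2) by simp
      finally show ?thesis .
    qed
    then show ?thesis using t by simp
  qed
qed

lemma convex_strict:
  fixes a b a' b' s :: real
  assumes "0 \<le> s" "s \<le> 1" "a < a'" "b < b'" shows "(1 - s) * a + s * b < (1 - s) * a' + s * b'"
proof (cases "s = 1")
  case False
  have "(1 - s) * a < (1 - s) * a'" using False assms by (intro mult_strict_left_mono) auto
  moreover have "s * b \<le> s * b'" using assms by (intro mult_left_mono) auto
  ultimately show ?thesis by linarith
qed (use assms in auto)

text \<open>The levels on opposite faces differ by a convex combination of the height differences
  of edges, all of which are positive.\<close>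

lemma level_direction:
  assumes "c \<in> cubes K (Suc n)" "\<And>i. i \<in> {1..n} \<Longrightarrow> 0 \<le> t i \<and> t i \<le> 1"
  shows "level n (face K False (Suc n) c) t < level n (face K True (Suc n) c) t"
  using assms
proof (induction n arbitrary: c)
  case 0
  then show ?case using height_edge[of c] by simp
next
  case (Suc n)
  have ff: "face K \<eta> (Suc n) (face K \<epsilon> (Suc (Suc n)) c) = face K \<epsilon> (Suc n) (face K \<eta> (Suc n) c)" for \<eta> \<epsilon>
    using face_face[OF Suc.prems(1), of "Suc n" "Suc (Suc n)"] by simp
  have "level n (face K False (Suc n) (face K \<eta> (Suc n) c)) t < level n (face K True (Suc n) (face K \<eta> (Suc n) c)) t" for \<eta>
    using Suc.IH[OF face_in[OF Suc.prems(1), of "Suc n" \<eta>]] Suc.prems(2) by simp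
  then show ?case using Suc.prems(2)[of "Suc n"] by (auto simp: ff intro: convex_strict)
qed

lemma level_mono:
  assumes "c \<in> cubes K n" "\<And>i. i \<in> {1..n} \<Longrightarrow> 0 \<le> t i \<and> t i \<le> t' i \<and> t' i \<le> 1"
  shows "level n c t \<le> level n c t'" "level n c t = level n c t' \<Longrightarrow> i \<in> {1..n} \<Longrightarrow> t i = t' i"
proof -
  have "level n c t \<le> level n c t' \<and> (level n c t = level n c t' \<longrightarrow> (\<forall>i\<in>{1..n}. t i = t' i))"
    using assms
  proof (induction n arbitrary: c)
    case (Suc n)
    let ?a = "\<lambda>\<epsilon>. level n (face K \<epsilon> (Suc n) c) t" and ?b = "\<lambda>\<epsilon>. level n (face K \<epsilon> (Suc n) c) t'"
    let ?s = "t (Suc n)" and ?s' = "t' (Suc n)"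
    have s: "0 \<le> ?s" "?s \<le> ?s'" "?s' \<le> 1" using Suc.prems(2)[of "Suc n"] by auto
    have IH: "?a \<epsilon> \<le> ?b \<epsilon>" "?a \<epsilon> = ?b \<epsilon> \<Longrightarrow> \<forall>i\<in>{1..n}. t i = t' i" for \<epsilon>
      using Suc.IH[OF face_in[OF Suc.prems(1)]] Suc.prems(2) by auto
    have d: "?b False < ?b True"
      by (rule level_direction[OF Suc.prems(1)]) (use Suc.prems(2) in fastforce)
    have 1: "level (Suc n) c t \<le> (1 - ?s) * ?b False + ?s * ?b True"
      using s IH(1) by (auto intro!: add_mono mult_left_mono)
    have 2: "level (Suc n) c t' = (1 - ?s) * ?b False + ?s * ?b True + (?s' - ?s) * (?b True - ?b False)"
      by (simp add: algebra_simps)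
    have 3: "0 \<le> (?s' - ?s) * (?b True - ?b False)" using s d by (intro mult_nonneg_nonneg) auto
    show ?case
    proof (intro conjI impI)
      show "level (Suc n) c t \<le> level (Suc n) c t'" using 1 2 3 by linarith
      assume eq: "level (Suc n) c t = level (Suc n) c t'"
      then have "(?s' - ?s) * (?b True - ?b False) = 0" using 1 2 3 by linarith
      then have ss: "?s = ?s'" using d by simp
      have "\<forall>i\<in>{1..n}. t i = t' i"
      proof (rule ccontr)
        assume "\<not> (\<forall>i\<in>{1..n}. t i = t' i)"
        then have "?a \<epsilon> < ?b \<epsilon>" for \<epsilon> using IH(1)[of \<epsilon>] IH(2)[of \<epsilon>] by (auto simp: less_le)
        then have "level (Suc n) c t < (1 - ?s) * ?b False + ?s * ?b True" using s by (auto intro!: convex_strict)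
        then show False using eq ss by simp
      qed
      then show "\<forall>i\<in>{1..Suc n}. t i = t' i" using ss by (auto simp: le_Suc_eq)
    qed
  qed simp
  then show "level n c t \<le> level n c t'" "level n c t = level n c t' \<Longrightarrow> i \<in> {1..n} \<Longrightarrow> t i = t' i" by auto
qed

definition elevation :: "'c cube_point set \<Rightarrow> real" where
  "elevation = lift (\<lambda>((n, c), t). level n c t)"

lemma elevation_pt: "elevation (pt n c t) = level n c t"
  unfolding elevation_def
proof (rule lift_pt)
  fix n c \<epsilon> i t assume "c \<in> cubes K n" "1 \<le> i" "i \<le> n"
  then show "level (n - 1) (face K \<epsilon> i c) t = level n c (insert_coord n i (of_bool \<epsilon>) t)"
    using level_face[of c "n - 1" i \<epsilon> t] by simp
qed

lemma elevation_dpath: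
  assumes "\<alpha> \<in> dpaths X" "s \<in> {0..1}" "t \<in> {0..1}" "s \<le> t"
  shows "elevation (\<alpha> s) \<le> elevation (\<alpha> t)" "elevation (\<alpha> s) = elevation (\<alpha> t) \<Longrightarrow> \<alpha> s = \<alpha> t"
proof -
  have "\<forall>s\<in>{0..1}. \<forall>t\<in>{0..1}. s \<le> t \<longrightarrow>
      elevation (\<alpha> s) \<le> elevation (\<alpha> t) \<and> (elevation (\<alpha> s) = elevation (\<alpha> t) \<longrightarrow> \<alpha> s = \<alpha> t)"
    using assms(1)
  proof (induction rule: dpath_induct)
    case (concat \<alpha> \<beta>)
    show ?case
    proof (intro ballI impI)
      fix s t :: real assume st: "s \<in> {0..1}" "t \<in> {0..1}" "s \<le> t"
      consider "t \<le> 1/2" | "s \<le> 1/2" "1/2 < t" | "1/2 < s" using st by linarith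
      then show "elevation (path_concat \<alpha> \<beta> s) \<le> elevation (path_concat \<alpha> \<beta> t) \<and>
          (elevation (path_concat \<alpha> \<beta> s) = elevation (path_concat \<alpha> \<beta> t) \<longrightarrow> path_concat \<alpha> \<beta> s = path_concat \<alpha> \<beta> t)"
      proof cases
        case 1 then show ?thesis using bspec[OF bspec[OF concat.IH(1), of "2 * s"], of "2 * t"] st by (simp add: path_concat_def)
      next
        case 2
        have "elevation (\<alpha> (2 * s)) \<le> elevation (\<alpha> 1) \<and> (elevation (\<alpha> (2 * s)) = elevation (\<alpha> 1) \<longrightarrow> \<alpha> (2 * s) = \<alpha> 1)"
          "elevation (\<beta> 0) \<le> elevation (\<beta> (2 * t-1)) \<and> (elevation (\<beta> 0) = elevation (\<beta> (2 * t-1)) \<longrightarrow> \<beta> 0 = \<beta> (2 * t-1))"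
          using bspec[OF bspec[OF concat.IH(1), of "2 * s"], of "1"] bspec[OF bspec[OF concat.IH(2), of "0"], of "2 * t-1"] st 2 by simp_all
        then show ?thesis using 2 st concat.hyps(3) by (auto simp: path_concat_def)
      next
        case 3 then show ?thesis using bspec[OF bspec[OF concat.IH(2), of "2 * s-1"], of "2 * t-1"] st by (simp add: path_concat_def)
      qed
    qed
  next
    case (reparam \<alpha> \<psi>)
    show ?case
    proof (intro ballI impI)
      fix s t :: real assume st: "s \<in> {0..1}" "t \<in> {0..1}" "s \<le> t"
      have \<psi>: "\<psi> s \<in> {0..1}" "\<psi> t \<in> {0..1}" "\<psi> s \<le> \<psi> t"
        using reparam.hyps(3) st monotone_onD[OF reparam.hyps(4) st] by blast+
      show "elevation (restrict (\<alpha> \<circ> \<psi>) {0..1} s) \<le> elevation (restrict (\<alpha> \<circ> \<psi>) {0..1} t) \<and>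
          (elevation (restrict (\<alpha> \<circ> \<psi>) {0..1} s) = elevation (restrict (\<alpha> \<circ> \<psi>) {0..1} t) \<longrightarrow>
            restrict (\<alpha> \<circ> \<psi>) {0..1} s = restrict (\<alpha> \<circ> \<psi>) {0..1} t)"
        using bspec[OF bspec[OF reparam.IH(1) \<psi>(1)] \<psi>(2)] \<psi>(3) st by simp
    qed
  next
    case (cube n c a)
    show ?case
    proof (intro ballI impI)
      fix s t :: real assume st: "s \<in> {0..1}" "t \<in> {0..1}" "s \<le> t"
      have r: "0 \<le> a s i \<and> a s i \<le> a t i \<and> a t i \<le> 1" if i: "i \<in> {1..n}" for i
        using monotone_onD[OF cube(4)[OF i]] st unit_cube_range[OF cube(2)[OF st(1)] i] unit_cube_range[OF cube(2)[OF st(2)] i] by auto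
      have "a s = a t" if "level n c (a s) = level n c (a t)"
        using level_mono(2)[OF cube(1) r that] cube(2)[OF st(1)] cube(2)[OF st(2)]
        by (intro extensionalityI[of _ "{1..n}"]) (auto simp: topspace_unit_cube PiE_def)
      then show "elevation ((\<lambda>s\<in>{0..1}. pt n c (a s)) s) \<le> elevation ((\<lambda>s\<in>{0..1}. pt n c (a s)) t) \<and>
         (elevation ((\<lambda>s\<in>{0..1}. pt n c (a s)) s) = elevation ((\<lambda>s\<in>{0..1}. pt n c (a s)) t) \<longrightarrow>
          (\<lambda>s\<in>{0..1}. pt n c (a s)) s = (\<lambda>s\<in>{0..1}. pt n c (a s)) t)"
        using st level_mono(1)[OF cube(1) r] by (auto simp: elevation_pt)
    qed
  qed (auto simp: const_path_def)
  then show "elevation (\<alpha> s) \<le> elevation (\<alpha> t)" "elevation (\<alpha> s) = elevation (\<alpha> t) \<Longrightarrow> \<alpha> s = \<alpha> t"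
    using assms by auto
qed

lemma realization_no_loops:
  assumes "\<alpha> \<in> dpaths_from_to X x x" shows "\<alpha> = const_path x"
proof -
  have a: "\<alpha> \<in> dpaths X" "\<alpha> 0 = x" "\<alpha> 1 = x" using assms by (auto simp: dpaths_from_to_def)
  have "\<alpha> t = x" if "t \<in> {0..1}" for t
  proof -
    have t: "0 \<in> {0..1::real}" "1 \<in> {0..1::real}" "0 \<le> t" "t \<le> 1" using that by simp_all
    have "elevation (\<alpha> 0) = elevation (\<alpha> t)"
      using elevation_dpath(1)[OF a(1) t(1) that t(3)] elevation_dpath(1)[OF a(1) that t(2) t(4)]
      unfolding a(2,3) by (rule antisym)
    from elevation_dpath(2)[OF a(1) t(1) that t(3) this] show ?thesis by (simp only: a(2))
  qed
  then show ?thesis using dpath_extensional[OF a(1)] by (intro extensionalityI[of _ "{0..1}"]) (auto simp: const_path_def)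
qed

text \<open>The gluing may identify different points of a closed cube, but never comparable ones,
  since these have different levels. This makes it possible to read off coordinates from points
  without normal forms.\<close>

lemma pt_comparable_inj:
  assumes c: "c \<in> cubes K n" and u: "u \<in> topspace (unit_cube n)" "v \<in> topspace (unit_cube n)"
    and uv: "\<And>i. i \<in> {1..n} \<Longrightarrow> u i \<le> v i" and eq: "pt n c u = pt n c v"
  shows "u = v"
proof -
  have "level n c u = level n c v" using arg_cong[OF eq, of elevation] by (simp add: elevation_pt)
  then show ?thesis
    using level_mono(2)[OF c, of u v] uv unit_cube_range[OF u(1)] unit_cube_range[OF u(2)] u
    by (intro extensionalityI[of _ "{1..n}"]) (auto simp: topspace_unit_cube PiE_def)
qed

end

section \<open>Directed flows on the realization\<close>

text \<open>The summands are open, so continuity may be checked on each of them, also after taking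
  the product with \<open>Z\<close>.\<close>

lemma continuous_map_from_prod_sum:
  assumes cont: "\<And>i. i \<in> I \<Longrightarrow> continuous_map (prod_topology Z (T i)) Y (\<lambda>p. f (fst p, (i, snd p)))"
  shows "continuous_map (prod_topology Z (sum_topology T I)) Y f"
  unfolding continuous_map
proof (intro conjI allI impI)
  show "f ` topspace (prod_topology Z (sum_topology T I)) \<subseteq> topspace Y"
  proof
    fix y assume "y \<in> f ` topspace (prod_topology Z (sum_topology T I))"
    then obtain z i x where "z \<in> topspace Z" "i \<in> I" "x \<in> topspace (T i)" "y = f (z, (i, x))" by auto
    then show "y \<in> topspace Y" using continuous_map_funspace[OF cont[of i]] by (auto simp: Pi_iff)
  qed
  fix V assume V: "openin Y V"
  let ?W = "{p \<in> topspace (prod_topology Z (sum_topology T I)). f p \<in> V}"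
  show "openin (prod_topology Z (sum_topology T I)) ?W"
  proof (subst openin_subopen, intro ballI)
    fix p assume p: "p \<in> ?W"
    then obtain z i x where p_eq: "p = (z, (i, x))" and i: "i \<in> I" and zx: "z \<in> topspace Z" "x \<in> topspace (T i)" by auto
    let ?Wi = "{q \<in> topspace (prod_topology Z (T i)). f (fst q, (i, snd q)) \<in> V}"
    have W: "openin (prod_topology Z (T i)) ?Wi" using openin_continuous_map_preimage[OF cont[OF i] V] .
    have "(z, x) \<in> ?Wi" using p zx by (simp add: p_eq)
    from W[unfolded openin_prod_topology_alt, THEN spec, THEN spec, THEN mp, OF this]
    obtain A B where AB: "openin Z A" "openin (T i) B" "z \<in> A" "x \<in> B" "A \<times> B \<subseteq> ?Wi"
      by (elim exE conjE)
    have "openin (sum_topology T I) (Pair i ` B)"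
      using open_map_component_injection[OF i, of T] AB(2) unfolding open_map_def by blast
    then have "openin (prod_topology Z (sum_topology T I)) (A \<times> (Pair i ` B))"
      using AB(1) by (simp add: openin_prod_Times_iff)
    moreover have "p \<in> A \<times> (Pair i ` B)" using AB by (simp add: p_eq)
    moreover have "A \<times> (Pair i ` B) \<subseteq> ?W"
    proof
      fix q assume "q \<in> A \<times> (Pair i ` B)"
      then obtain a b where q: "q = (a, (i, b))" "a \<in> A" "b \<in> B" by blast
      then have "(a, b) \<in> ?Wi" using AB(5) by blast
      then show "q \<in> ?W" using i by (simp add: q)
    qed
    ultimately show "\<exists>S. openin (prod_topology Z (sum_topology T I)) S \<and> p \<in> S \<and> S \<subseteq> ?W" by blast
  qed
qed

context cubical begin

text \<open>The interval is locally compact, so its product with the quotient map onto the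
  realization is again a quotient map, and joint continuity can be checked on cubes.\<close>

lemma continuous_map_act:
  assumes unit: "\<And>s. s \<in> {0..1} \<Longrightarrow> unit_map (\<phi> s)"
    and cont: "continuous_map (prod_topology unit_interval unit_interval) euclideanreal (\<lambda>p. \<phi> (fst p) (snd p))"
  shows "continuous_map (prod_topology unit_interval (dtop X)) (dtop X) (\<lambda>p. act (\<phi> (fst p)) (snd p))"
proof (rule continuous_compose_quotient_map)
  have "locally_compact_space unit_interval" "Hausdorff_space unit_interval"
    by (auto intro!: compact_imp_locally_compact_space compact_space_subtopology Hausdorff_space_subtopology)
  then show "quotient_map (prod_topology unit_interval (dtop cube_sum)) (prod_topology unit_interval (dtop X)) (\<lambda>(s, p). (s, glue_class K p))"
    by (intro quotient_map_prod_right quotient_map_glue disjI1)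
  show "continuous_map (prod_topology unit_interval (dtop cube_sum)) (dtop X)
      ((\<lambda>p. act (\<phi> (fst p)) (snd p)) \<circ> (\<lambda>(s, p). (s, glue_class K p)))"
    unfolding dtop_cube_sum
  proof (rule continuous_map_from_prod_sum)
    fix i assume "i \<in> cells"
    then obtain n c where i: "i = (n, c)" "(n, c) \<in> cells" by (cases i) auto
    let ?P = "prod_topology unit_interval (unit_cube n)"
    have coords: "continuous_map ?P (unit_cube n) (\<lambda>p. on_coords (\<phi> (fst p)) n (snd p))"
      unfolding on_coords_def
    proof (rule continuous_map_into_unit_cube)
      fix j assume j: "j \<in> {1..n}"
      have "continuous_map ?P unit_interval (\<lambda>p. snd p j)"
        unfolding continuous_map_into_unit_interval
        using continuous_map_unit_cube_coord[OF continuous_map_snd j] unit_cube_range[OF _ j] by fastforce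
      from continuous_map_compose_pair[OF cont continuous_map_fst this]
      show "continuous_map ?P euclideanreal (\<lambda>p. \<phi> (fst p) (snd p j))" by simp
      fix p assume "p \<in> topspace ?P"
      then have "fst p \<in> {0..1}" "snd p j \<in> {0..1}" using unit_cube_range[OF _ j, of "snd p"] by auto
      then show "0 \<le> \<phi> (fst p) (snd p j) \<and> \<phi> (fst p) (snd p j) \<le> 1"
        using unit_map_range[OF unit] by (meson atLeastAtMost_iff)
    qed
    have inj: "continuous_map (unit_cube n) (dtop cube_sum) (\<lambda>t. ((n, c), t))"
      unfolding dtop_cube_sum
      using continuous_map_component_injection[where X = "\<lambda>i. unit_cube (fst i)", OF i(2)] by simp
    have "continuous_map (unit_cube n) (dtop X) (\<lambda>t. glue_class K ((n, c), t))"
      by (rule continuous_map_compose'[OF quotient_imp_continuous_map[OF quotient_map_glue] inj])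
    from continuous_map_compose'[OF this coords]
    have "continuous_map ?P (dtop X) (\<lambda>p. pt n c (on_coords (\<phi> (fst p)) n (snd p)))" by (simp add: pt_def)
    then have "continuous_map ?P (dtop X) (\<lambda>p. act (\<phi> (fst p)) (pt n c (snd p)))"
      by (rule continuous_map_eq) (auto simp: act_pt[OF unit])
    then show "continuous_map (prod_topology unit_interval (unit_cube (fst i))) (dtop X)
        (\<lambda>p. ((\<lambda>p. act (\<phi> (fst p)) (snd p)) \<circ> (\<lambda>(s, p). (s, glue_class K p))) (fst p, (i, snd p)))"
      by (simp add: i pt_def)
  qed
qed

text \<open>For \<open>e = True\<close> the lemmas below concern the opposite d-space, in which
  the coordinates \<open>1 - \<tau>\<close> increase; \<open>conj e \<phi>\<close> is the map
  \<open>\<phi>\<close> expressed in these coordinates. Each lemma thus covers both directions of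
  time.\<close>

definition flip :: "bool \<Rightarrow> real \<Rightarrow> real" where "flip e \<tau> = (if e then 1 - \<tau> else \<tau>)"

definition conj :: "bool \<Rightarrow> (real \<Rightarrow> real) \<Rightarrow> real \<Rightarrow> real" where
  "conj e \<phi> \<tau> = flip e (\<phi> (flip e \<tau>))"

definition orient :: "bool \<Rightarrow> 'c cube_point set dspace" where
  "orient e = (if e then opposite X else X)"

lemma flip_flip [simp]: "flip e (flip e \<tau>) = \<tau>" by (simp add: flip_def)

lemma flip_range: "\<tau> \<in> {0..1} \<Longrightarrow> flip e \<tau> \<in> {0..1}" by (auto simp: flip_def)

lemma unit_map_conj: "unit_map \<phi> \<Longrightarrow> unit_map (conj e \<phi>)"
  unfolding unit_map_def monotone_on_def by (auto simp: conj_def flip_def)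

lemma continuous_on_conj: "continuous_on {0..1} \<phi> \<Longrightarrow> continuous_on {0..1} (conj e \<phi>)"
  unfolding conj_def[abs_def] flip_def
  by (cases e) (auto intro!: continuous_intros elim!: continuous_on_compose2)

lemma orient_top [simp]: "dtop (orient e) = dtop X" by (simp add: orient_def opposite_def)

end

locale cubical_setting = cubical K for K :: "'c precubical" +
  fixes F :: "'u morphism_family"
  assumes equivalence_system: "equivalence_system F"
    and large: "\<exists>e :: (real \<Rightarrow> 'c cube_point set) \<Rightarrow> 'u. inj e"

sublocale cubical_setting \<subseteq> equivalence_setting "realization K" F
  by unfold_locales (fact equivalence_system realization_no_loops large)+

context cubical_setting begin

lemma orient_setting: "equivalence_setting (orient e) F"
  unfolding orient_def using opposite_setting equivalence_setting_axioms by simp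

lemma orient_le: "dle (orient e) x y \<longleftrightarrow> (if e then le y x else le x y)"
  by (simp add: orient_def opposite_le)

lemma orient_line:
  assumes "c \<in> cubes K n" "u \<in> topspace (unit_cube n)" "v \<in> topspace (unit_cube n)"
    "\<And>i. i \<in> {1..n} \<Longrightarrow> flip e (u i) \<le> flip e (v i)"
  shows "dle (orient e) (pt n c u) (pt n c v)"
  using line_le[of c n u v] line_le[of c n v u] assms by (auto simp: orient_le flip_def split: if_splits)

lemma orient_act_mono: "unit_map \<phi> \<Longrightarrow> dle (orient e) x y \<Longrightarrow> dle (orient e) (act \<phi> x) (act \<phi> y)"
  by (auto simp: orient_le act_mono split: if_splits)

lemma orient_act_dpath:
  assumes "unit_map \<phi>" "continuous_on {0..1} \<phi>" "\<alpha> \<in> dpaths (orient e)"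
  shows "(\<lambda>t\<in>{0..1}. act \<phi> (\<alpha> t)) \<in> dpaths (orient e)"
proof (cases e)
  case True
  then obtain a where a: "a \<in> dpaths X" "\<alpha> = reverse_path a" using assms(3) by (auto simp: orient_def opposite_def)
  have "(\<lambda>t\<in>{0..1}. act \<phi> (\<alpha> t)) = reverse_path (\<lambda>t\<in>{0..1}. act \<phi> (a t))"
    by (auto simp: a(2) reverse_path_def fun_eq_iff)
  then show ?thesis using act_dpath[OF assms(1,2) a(1)] True by (simp only: orient_def opposite_def if_True dspace.select_convs) (rule imageI)
next
  case False
  then show ?thesis using act_dpath[OF assms(1,2)] assms(3) unfolding orient_def by (simp only: if_False)
qed

lemma orient_cube_path:
  assumes c: "c \<in> cubes K n" and a: "\<And>i. i \<in> {1..n} \<Longrightarrow> continuous_on {0..1} (\<lambda>s. a s i)"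
    "\<And>i. i \<in> {1..n} \<Longrightarrow> mono_on {0..1} (\<lambda>s. flip e (a s i))" "\<And>s. s \<in> {0..1} \<Longrightarrow> a s \<in> topspace (unit_cube n)"
  shows "(\<lambda>s\<in>{0..1}. pt n c (a s)) \<in> dpaths (orient e)"
proof (cases e)
  case True
  have "(\<lambda>s\<in>{0..1}. pt n c (a (1 - s))) \<in> dpaths X"
  proof (rule cube_path[OF c])
    fix i assume i: "i \<in> {1..n}"
    show "continuous_on {0..1} (\<lambda>s. a (1 - s) i)"
      by (rule continuous_on_compose2[OF a(1)[OF i]]) (auto intro!: continuous_intros)
    show "mono_on {0..1} (\<lambda>s. a (1 - s) i)"
    proof (rule mono_onI)
      fix r s :: real assume "r \<in> {0..1}" "s \<in> {0..1}" "r \<le> s"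
      then show "a (1 - r) i \<le> a (1 - s) i"
        using monotone_onD[OF a(2)[OF i], of "1 - s" "1 - r"] True by (simp add: flip_def)
    qed
  qed (use a(3) in auto)
  moreover have "(\<lambda>s\<in>{0..1}. pt n c (a s)) = reverse_path (\<lambda>s\<in>{0..1}. pt n c (a (1 - s)))"
    by (auto simp: reverse_path_def fun_eq_iff)
  ultimately show ?thesis using True by (simp only: orient_def opposite_def if_True dspace.select_convs) (rule imageI)
next
  case False
  have "(\<lambda>s\<in>{0..1}. pt n c (a s)) \<in> dpaths X"
    by (rule cube_path[OF c a(1) _ a(3)]) (use a(2) False in \<open>simp_all add: flip_def\<close>)
  then show ?thesis using False unfolding orient_def by (simp only: if_False)
qed

text \<open>The flow is \<open>(1 - s) \<tau> + s \<phi> \<tau>\<close> on each coordinate. It is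
  directed because \<open>\<phi>\<close> only increases the coordinates, it fixes \<open>z\<close>
  because \<open>\<phi>\<close> fixes the coordinates of \<open>z\<close>, and it fixes its end
  \<open>act (conj e \<phi>) x\<close> because \<open>\<phi>\<close> is idempotent on the
  coordinates of \<open>x\<close>. Here \<open>x = pt n c t\<close> and \<open>z = pt n' c'
  t'\<close>.\<close>

lemma flow_equiv:
  assumes \<phi>: "unit_map \<phi>" "continuous_on {0..1} \<phi>" "\<And>\<tau>. \<tau> \<in> {0..1} \<Longrightarrow> \<tau> \<le> \<phi> \<tau>"
    and x: "c \<in> cubes K n" "t \<in> topspace (unit_cube n)" "\<And>i. i \<in> {1..n} \<Longrightarrow> \<phi> (\<phi> (flip e (t i))) = \<phi> (flip e (t i))"
    and z: "c' \<in> cubes K n'" "t' \<in> topspace (unit_cube n')" "\<And>i. i \<in> {1..n'} \<Longrightarrow> \<phi> (flip e (t' i)) = flip e (t' i)"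
  obtains \<gamma> where "\<gamma> \<in> dpaths_from_to (orient e) (pt n c t) (act (conj e \<phi>) (pt n c t))"
    "equivalence_setting.pre_equiv (orient e) F \<gamma> (pt n' c' t')"
proof -
  interpret Y: equivalence_setting "orient e" F by (rule orient_setting)
  let ?\<psi> = "conj e \<phi>"
  have \<psi>: "unit_map ?\<psi>" "continuous_on {0..1} ?\<psi>" using unit_map_conj continuous_on_conj \<phi> by auto
  define \<psi>s where "\<psi>s = (\<lambda>s \<tau>. (1 - s) * \<tau> + s * ?\<psi> \<tau>)"
  have unit: "unit_map (\<psi>s s)" if s: "s \<in> {0..1}" for s
    unfolding unit_map_def
  proof (intro conjI)
    show "\<psi>s s 0 = 0" "\<psi>s s 1 = 1" using \<psi>(1) by (simp_all add: \<psi>s_def unit_map_def)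
    show "mono_on {0..1} (\<psi>s s)"
      unfolding \<psi>s_def using s monotone_onD[of "{0..1}" "(\<le>)" "(\<le>)" ?\<psi>] \<psi>(1)
      by (intro mono_onI add_mono mult_left_mono) (auto simp: unit_map_def)
  qed
  have cont_s: "continuous_on {0..1} (\<psi>s s)" for s
    unfolding \<psi>s_def by (intro continuous_intros \<psi>(2))
  have "continuous_map unit_interval euclideanreal ?\<psi>" using \<psi>(2) by simp
  from continuous_map_compose'[OF this continuous_map_snd]
  have "continuous_map (prod_topology unit_interval unit_interval) euclideanreal (\<lambda>p. \<psi>s (fst p) (snd p))"
    unfolding \<psi>s_def by (intro continuous_intros continuous_map_fst_real continuous_map_snd_real)
  from continuous_map_act[OF unit this]
  have H: "continuous_map (prod_topology unit_interval (dtop (orient e))) (dtop (orient e)) (\<lambda>p. act (\<psi>s (fst p)) (snd p))" by simp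
  have s01: "(0::real) \<in> {0..1}" "(1::real) \<in> {0..1}" by simp_all
  have fixed: "act (\<psi>s s) (pt k d u) = pt k d u"
    if "s \<in> {0..1}" and u: "u \<in> topspace (unit_cube k)" and fx: "\<And>i. i \<in> {1..k} \<Longrightarrow> ?\<psi> (u i) = u i" for s k d u
  proof -
    have "on_coords (\<psi>s s) k u = u"
      using fx u by (intro extensionalityI[of _ "{1..k}"]) (auto simp: on_coords_def \<psi>s_def topspace_unit_cube PiE_def algebra_simps)
    then show ?thesis by (simp add: act_pt[OF unit[OF \<open>s \<in> {0..1}\<close>]])
  qed
  have psi1: "\<psi>s 1 = ?\<psi>" by (simp add: \<psi>s_def)
  have trace: "(\<lambda>s\<in>{0..1}. act (\<psi>s s) (pt k d u)) \<in> dpaths (orient e)"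
    if d: "d \<in> cubes K k" and u: "u \<in> topspace (unit_cube k)" for k d u
  proof -
    have "(\<lambda>s\<in>{0..1}. pt k d (on_coords (\<psi>s s) k u)) \<in> dpaths (orient e)"
    proof (rule orient_cube_path[OF d])
      show "on_coords (\<psi>s s) k u \<in> topspace (unit_cube k)" if "s \<in> {0..1}" for s
        by (rule on_coords_in_cube[OF unit[OF that] u])
      fix i assume i: "i \<in> {1..k}"
      show "continuous_on {0..1} (\<lambda>s. on_coords (\<psi>s s) k u i)"
        using i by (auto simp: on_coords_def \<psi>s_def intro!: continuous_intros)
      show "mono_on {0..1} (\<lambda>s. flip e (on_coords (\<psi>s s) k u i))"
      proof (rule mono_onI)
        fix r s :: real assume rs: "r \<le> s"
        have "flip e (u i) \<le> \<phi> (flip e (u i))" using \<phi>(3)[OF flip_range] unit_cube_range[OF u i] by simp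
        then have "0 \<le> (s - r) * (\<phi> (flip e (u i)) - flip e (u i))" using rs by (intro mult_nonneg_nonneg) auto
        then show "flip e (on_coords (\<psi>s r) k u i) \<le> flip e (on_coords (\<psi>s s) k u i)"
          using i by (cases e) (auto simp: on_coords_def \<psi>s_def conj_def flip_def algebra_simps)
      qed
    qed
    moreover have "(\<lambda>s\<in>{0..1}. act (\<psi>s s) (pt k d u)) = (\<lambda>s\<in>{0..1}. pt k d (on_coords (\<psi>s s) k u))"
      by (simp add: fun_eq_iff act_pt[OF unit])
    ultimately show ?thesis by (simp only:)
  qed
  have pre: "Y.pre_equiv (\<lambda>s\<in>{0..1}. (\<lambda>p. act (\<psi>s (fst p)) (snd p)) (s, pt n c t)) (pt n' c' t')"
  proof (rule Y.pre_equiv_flow[OF H, where y = "pt n c (on_coords ?\<psi> n t)"])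
    fix p assume "p \<in> topspace (dtop (orient e))"
    then obtain k d u where p: "p = pt k d u" "d \<in> cubes K k" "u \<in> topspace (unit_cube k)"
      by (auto simp: space_realization)
    have "on_coords (\<psi>s 0) k u = u"
      using p(3) by (intro extensionalityI[of _ "{1..k}"]) (auto simp: on_coords_def \<psi>s_def topspace_unit_cube PiE_def)
    then show "act (\<psi>s (fst (0::real, p))) (snd (0::real, p)) = p" by (simp add: p(1) act_pt[OF unit[OF s01(1)]])
    show "(\<lambda>s\<in>{0..1}. act (\<psi>s (fst (s, p))) (snd (s, p))) \<in> dpaths (orient e)"
      unfolding fst_conv snd_conv p(1) by (rule trace[OF p(2,3)])
  next
    fix s :: real and \<alpha> assume s: "s \<in> {0..1}" and a: "\<alpha> \<in> dpaths (orient e)"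
    show "(\<lambda>t\<in>{0..1}. act (\<psi>s (fst (s, \<alpha> t))) (snd (s, \<alpha> t))) \<in> dpaths (orient e)"
      unfolding fst_conv snd_conv by (rule orient_act_dpath[OF unit[OF s] cont_s a])
  next
    fix s :: real assume s: "s \<in> {0..1}"
    show "act (\<psi>s (fst (s, pt n' c' t'))) (snd (s, pt n' c' t')) = pt n' c' t'"
      unfolding fst_conv snd_conv by (rule fixed[OF s z(2)]) (use z(3) in \<open>simp add: conj_def\<close>)
    show "act (\<psi>s (fst (s, pt n c (on_coords ?\<psi> n t)))) (snd (s, pt n c (on_coords ?\<psi> n t))) = pt n c (on_coords ?\<psi> n t)"
      unfolding fst_conv snd_conv
      by (rule fixed[OF s on_coords_in_cube[OF \<psi>(1) x(2)]]) (use x(3) in \<open>simp add: conj_def on_coords_def\<close>)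
  next
    show "pt n c t \<in> topspace (dtop (orient e))" using pt_in_space[OF x(1,2)] by simp
    show "act (\<psi>s (fst (1::real, pt n c t))) (snd (1::real, pt n c t)) = pt n c (on_coords ?\<psi> n t)"
      by (simp add: psi1 act_pt[OF \<psi>(1)])
  qed
  note trace[OF x(1,2)]
  moreover have "act (\<psi>s 0) (pt n c t) = pt n c t"
  proof -
    have "on_coords (\<psi>s 0) n t = t"
      using x(2) by (intro extensionalityI[of _ "{1..n}"]) (auto simp: on_coords_def \<psi>s_def topspace_unit_cube PiE_def)
    then show ?thesis by (simp add: act_pt[OF unit[OF s01(1)]])
  qed
  ultimately have "(\<lambda>s\<in>{0..1}. act (\<psi>s s) (pt n c t)) \<in> dpaths_from_to (orient e) (pt n c t) (act ?\<psi> (pt n c t))"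
    unfolding dpaths_from_to_def using psi1 by simp
  then show thesis by (rule that) (rule pre[unfolded fst_conv snd_conv])
qed

end

section \<open>Systems given by a closure operator\<close>

definition fibres :: "'a set \<Rightarrow> ('a \<Rightarrow> 'a) \<Rightarrow> 'a set set" where
  "fibres U f = (\<lambda>v. {x \<in> U. f x = v}) ` f ` U"

lemma fibresE:
  assumes "A \<in> fibres U f" obtains x where "x \<in> U" "A = {y \<in> U. f y = f x}"
  using assms unfolding fibres_def by blast

lemma fibres_disjoint: "pairwise disjnt (fibres U f)"
  by (auto simp: fibres_def pairwise_def disjnt_iff)

lemma Union_fibres: "\<Union>(fibres U f) = U"
  by (auto simp: fibres_def)

text \<open>Each fibre of a closure operator \<open>f\<close> has a greatest element, the fixed
  point \<open>v\<close>, so stability only has to be tested at \<open>v\<close> itself, where the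
  only d-paths \<open>\<beta>\<close> are constant. A d-path \<open>\<alpha>\<close> within a
  fibre is compared with the d-paths from both of its ends to the greatest element of that fibre.\<close>

lemma (in equivalence_setting) closure_operator_system:
  assumes f: "\<And>x. x \<in> space \<Longrightarrow> f (f x) = f x" "\<And>x y. le x y \<Longrightarrow> le (f x) (f y)"
    and pre: "\<And>x v. x \<in> space \<Longrightarrow> v \<in> space \<Longrightarrow> f v = v \<Longrightarrow> \<exists>\<gamma>\<in>paths x (f x). pre_equiv \<gamma> v"
  shows "stable_future_component_system F X (fibres space f)" "future_closed X (fibres space f)"
proof -
  have up: "le x (f x)" if "x \<in> space" for x
  proof -
    have "le (f x) (f x)" using f(2)[OF le_refl[OF that]] .
    then have "f x \<in> space" using le_space by blast
    then show ?thesis using pre[OF that, of "f x"] f(1)[OF that] by (auto simp: le_iff)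
  qed
  have fspace: "f x \<in> space" if "x \<in> space" for x using le_space(2)[OF up[OF that]] .
  have fibreE: "\<exists>v\<in>space. f v = v \<and> A = {x \<in> space. f x = v}" if "A \<in> fibres space f" for A
  proof -
    from \<open>A \<in> fibres space f\<close> obtain x where x: "x \<in> space" "A = {y \<in> space. f y = f x}" by (rule fibresE)
    show ?thesis using fspace[OF x(1)] f(1)[OF x(1)] x(2) by (intro bexI[of _ "f x"]) simp_all
  qed
  have conv: "d_convex X A" if A: "A \<in> fibres space f" for A
  proof (rule d_convexI)
    obtain v where v: "A = {x \<in> space. f x = v}" using fibreE[OF A] by blast
    then show "A \<subseteq> space" by blast
    fix x y w assume "x \<in> A" "y \<in> A" and w: "le x w" "le w y"
    then have "le v (f w)" "le (f w) v" using f(2)[OF w(1)] f(2)[OF w(2)] v by auto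
    then show "w \<in> A" using le_antisym[of v "f w"] le_space(2)[OF w(1)] v by simp
  qed
  have conn: "future_connected X A" if A: "A \<in> fibres space f" for A
  proof (rule future_connectedI[OF conv[OF A]])
    obtain v where v: "v \<in> space" "f v = v" "A = {x \<in> space. f x = v}" using fibreE[OF A] by blast
    fix x y assume "x \<in> A" "y \<in> A"
    then show "\<exists>z\<in>A. le x z \<and> le y z" using up[of x] up[of y] v by auto
  qed
  have St: "v \<in> St_future F X \<alpha> {x \<in> space. f x = v}"
    if a: "\<alpha> \<in> paths x y" "f x = f y" and v: "v \<in> space" "f v = v" for \<alpha> x y v
  proof (rule St_futureI[OF a(1)])
    have xy: "x \<in> space" "y \<in> space" using dpaths_from_to_ends[OF a(1)] .
    have top: "b = v" if b: "b \<in> {x \<in> space. f x = v}" "le v b" for b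
      using le_antisym[OF b(2)] up[of b] b(1) by simp
    show "v \<in> {x \<in> space. f x = v}" using v by simp
    fix b assume b: "b \<in> {x \<in> space. f x = v}" "le v b"
    obtain \<gamma> where g: "\<gamma> \<in> paths y (f x)" "pre_equiv \<gamma> v" using pre[OF xy(2) v] a(2) by auto
    obtain \<delta> where d: "\<delta> \<in> paths x (f x)" "pre_equiv \<delta> v" using pre[OF xy(1) v] by auto
    obtain \<eta> where e: "\<eta> \<in> paths x (f x)" "pre_equiv \<eta> (f x)" using pre[OF xy(1) fspace[OF xy(1)] f(1)[OF xy(1)]] by auto
    have "F_contractible F (path_space x (f x))"
      using pre_equiv_contractible[OF e] contractible_loops[OF fspace[OF xy(1)]] by simp
    from pre_equiv_via[OF a(1) this g d] show "pre_equiv \<alpha> b" using top[OF b] by simp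
  next
    fix b b' \<beta> assume b: "b \<in> {x \<in> space. f x = v}" "b' \<in> {x \<in> space. f x = v}" "le v b" and \<beta>: "\<beta> \<in> paths b b'"
    have "le b b'" using \<beta> by (auto simp: le_iff)
    then have "b = v" "b' = v"
      using le_antisym[OF b(3)] le_antisym[OF le_trans[OF b(3) \<open>le b b'\<close>]] up[of b] up[of b'] b(1,2) by simp_all
    then have "\<beta> = const_path v" using no_loop[of \<beta> v] \<beta> by simp
    then show "post_equiv x \<beta>" using post_equiv_const[OF v(1)] by simp
  qed
  have stab: "future_stable F X A B" if A: "A \<in> fibres space f" and B: "B \<in> fibres space f" for A B
    unfolding future_stable_def
  proof (intro conjI conn A B ballI)
    obtain u where u: "A = {x \<in> space. f x = u}" using fibreE[OF A] by blast
    obtain v where v: "v \<in> space" "f v = v" "B = {x \<in> space. f x = v}" using fibreE[OF B] by blast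
    fix \<alpha> assume "\<alpha> \<in> dpaths_in X A"
    then have "\<alpha> \<in> paths (\<alpha> 0) (\<alpha> 1)" "f (\<alpha> 0) = f (\<alpha> 1)"
      using u by (auto simp: dpaths_in_def dpaths_from_to_def image_subset_iff)
    from St[OF this v(1,2)] show "St_future F X \<alpha> B \<noteq> {}" unfolding v(3) by blast
  qed
  have triv: "future_trivial F X A" if A: "A \<in> fibres space f" for A
  proof -
    obtain v where v: "v \<in> space" "f v = v" "A = {x \<in> space. f x = v}" using fibreE[OF A] by blast
    have "v \<in> St_future F X (const_path v) A" unfolding v(3) by (rule St[OF dpaths_const[OF v(1)] refl v(1,2)])
    then have "path_space v v \<in> future_stable_path_spaces F X A A"
      unfolding future_stable_path_spaces_def using v by blast
    then show ?thesis
      unfolding future_trivial_def using conn[OF A] stab[OF A A] contractible_loops[OF v(1)] by blast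
  qed
  show "stable_future_component_system F X (fibres space f)"
    unfolding stable_future_component_system_def
    by (intro conjI ballI fibres_disjoint Union_fibres conv conn triv stab)
  show "future_closed X (fibres space f)"
    unfolding future_closed_def
  proof
    fix A assume A: "A \<in> fibres space f"
    obtain v where v: "v \<in> space" "f v = v" "A = {x \<in> space. f x = v}" using fibreE[OF A] by blast
    then show "\<exists>x\<in>A. \<forall>y\<in>A. le y x" using up by (intro bexI[of _ v]) auto
  qed
qed

section \<open>Moving points inside their cubes\<close>

context cubical begin

text \<open>Acting with this map moves a point of an open cube to the point of that cube all of
  whose coordinates are \<open>m\<close>, and for \<open>m = 1\<close> to the final, for \<open>m
  = 0\<close> to the initial vertex of the cube.\<close>

definition center :: "real \<Rightarrow> real \<Rightarrow> real" where
  "center m \<tau> = (if \<tau> \<le> 0 then 0 else if \<tau> \<ge> 1 then 1 else m)"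

lemma unit_map_center: "0 \<le> m \<Longrightarrow> m \<le> 1 \<Longrightarrow> unit_map (center m)"
  by (auto simp: unit_map_def center_def intro!: mono_onI)

lemma conj_center: "conj e (center m) = center (flip e m)"
  by (auto simp: conj_def center_def flip_def fun_eq_iff)

lemma center_center: "0 < m \<Longrightarrow> m < 1 \<Longrightarrow> center m' \<circ> center m = center m'"
  by (auto simp: center_def fun_eq_iff)

lemma center_idem: "0 \<le> m \<Longrightarrow> m \<le> 1 \<Longrightarrow> center m (center m \<tau>) = center m \<tau>"
  by (auto simp: center_def)

lemma act_center_center:
  assumes "0 < m" "m < 1" "0 \<le> m'" "m' \<le> 1" "x \<in> topspace (dtop X)"
  shows "act (center m') (act (center m) x) = act (center m') x"
  using act_act[of "center m'" "center m" x] assms by (simp add: unit_map_center center_center)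

lemma finite_fibres_center:
  assumes "0 \<le> m" "m \<le> 1" shows "finite (fibres (topspace (dtop X)) (act (center m)))"
proof -
  let ?S = "\<Union>(n, c)\<in>cells. pt n c ` ({1..n} \<rightarrow>\<^sub>E {0, m, 1})"
  have "act (center m) ` topspace (dtop X) \<subseteq> ?S"
  proof
    fix y assume "y \<in> act (center m) ` topspace (dtop X)"
    then obtain n c t where c: "c \<in> cubes K n" "y = act (center m) (pt n c t)" by (auto simp: space_realization)
    then have "y = pt n c (on_coords (center m) n t)" by (simp add: act_pt unit_map_center assms)
    moreover have "on_coords (center m) n t \<in> {1..n} \<rightarrow>\<^sub>E {0, m, 1}" by (auto simp: on_coords_def center_def)
    ultimately show "y \<in> ?S" using c(1) by (auto simp: cells_def)
  qed
  moreover have "finite ?S" using finite_cells by (auto intro!: finite_PiE)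
  ultimately have "finite (act (center m) ` topspace (dtop X))" by (rule finite_subset)
  then show ?thesis unfolding fibres_def by (rule finite_imageI)
qed

text \<open>The coordinates 1 in \<open>below\<close> and 0 in \<open>above\<close> are admitted
  because they are fixed by all flows used. As points have representatives in several cubes, the
  definitions ask for one suitable representative.\<close>

definition below :: "bool \<Rightarrow> real \<Rightarrow> 'c cube_point set \<Rightarrow> bool" where
  "below e m x \<longleftrightarrow> (\<exists>n c t. x = pt n c t \<and> c \<in> cubes K n \<and> t \<in> topspace (unit_cube n) \<and>
     (\<forall>i\<in>{1..n}. flip e (t i) \<le> m \<or> flip e (t i) = 1))"

definition above :: "bool \<Rightarrow> real \<Rightarrow> 'c cube_point set \<Rightarrow> bool" where
  "above e m x \<longleftrightarrow> (\<exists>n c t. x = pt n c t \<and> c \<in> cubes K n \<and> t \<in> topspace (unit_cube n) \<and>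
     (\<forall>i\<in>{1..n}. flip e (t i) = 0 \<or> m \<le> flip e (t i)))"

lemma below_mono: "below e m x \<Longrightarrow> m \<le> m' \<Longrightarrow> below e m' x"
proof -
  assume "below e m x" "m \<le> m'"
  then obtain n c t where "x = pt n c t" "c \<in> cubes K n" "t \<in> topspace (unit_cube n)"
    "\<forall>i\<in>{1..n}. flip e (t i) \<le> m \<or> flip e (t i) = 1" unfolding below_def by blast
  moreover from this(4) \<open>m \<le> m'\<close> have "\<forall>i\<in>{1..n}. flip e (t i) \<le> m' \<or> flip e (t i) = 1" by (meson order_trans)
  ultimately show ?thesis unfolding below_def by blast
qed

lemma below_not: "below (\<not> e) (1 - m) x \<longleftrightarrow> above e m x"
proof -
  have "flip (\<not> e) \<tau> \<le> 1 - m \<or> flip (\<not> e) \<tau> = 1 \<longleftrightarrow> flip e \<tau> = 0 \<or> m \<le> flip e \<tau>" for \<tau>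
    by (cases e) (auto simp: flip_def)
  then show ?thesis unfolding below_def above_def by (simp only:)
qed

lemma above_not: "above (\<not> e) (1 - m) x \<longleftrightarrow> below e m x"
  using below_not[of "\<not> e" "1 - m" x] by simp

lemma below_one:
  assumes "x \<in> topspace (dtop X)" shows "below e 1 x"
proof -
  obtain n c t where x: "x = pt n c t" "c \<in> cubes K n" "t \<in> topspace (unit_cube n)" using assms by (rule spaceE)
  have "flip e (t i) \<le> 1" if "i \<in> {1..n}" for i
    using flip_range[of "t i" e] unit_cube_range[OF x(3) that] by simp
  with x show ?thesis unfolding below_def by blast
qed

lemma ex_below:
  assumes "x \<in> topspace (dtop X)" obtains m where "m < 1" "below e m x"
proof -
  obtain n c t where x: "x = pt n c t" "c \<in> cubes K n" "t \<in> topspace (unit_cube n)" using assms by (rule spaceE)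
  define M where "M = insert 0 {flip e (t i) | i. i \<in> {1..n} \<and> flip e (t i) < 1}"
  have fin: "finite M" unfolding M_def by simp
  have "Max M \<in> M" by (rule Max_in[OF fin]) (auto simp: M_def)
  then have "Max M < 1" by (auto simp: M_def)
  moreover have "flip e (t i) \<le> Max M \<or> flip e (t i) = 1" if i: "i \<in> {1..n}" for i
  proof (cases "flip e (t i) < 1")
    case True
    then have "flip e (t i) \<in> M" using i by (auto simp: M_def)
    then show ?thesis using Max_ge[OF fin] by blast
  next
    case False
    then show ?thesis using flip_range[of "t i" e] unit_cube_range[OF x(3) i] by auto
  qed
  ultimately show thesis using that[of "Max M"] x unfolding below_def by blast
qed

lemma above_center:
  assumes m: "0 \<le> m" "m \<le> 1" and x: "x \<in> topspace (dtop X)"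
  shows "above e m (act (center (flip e m)) x)" "below e m (act (center (flip e m)) x)"
proof -
  obtain n c t where x: "x = pt n c t" "c \<in> cubes K n" "t \<in> topspace (unit_cube n)" using x by (rule spaceE)
  have u: "unit_map (center (flip e m))" using m flip_range[of m e] by (intro unit_map_center) auto
  have eq: "act (center (flip e m)) x = pt n c (on_coords (center (flip e m)) n t)" using x by (simp add: act_pt[OF u])
  have c: "flip e (on_coords (center (flip e m)) n t i) \<in> {0, m, 1}" if "i \<in> {1..n}" for i
    using that by (auto simp: on_coords_def center_def flip_def)
  show "above e m (act (center (flip e m)) x)"
    unfolding above_def eq using x(2) on_coords_in_cube[OF u x(3)] c m
    by (intro exI[of _ n] exI[of _ c] exI[of _ "on_coords (center (flip e m)) n t"]) fastforce
  show "below e m (act (center (flip e m)) x)"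
    unfolding below_def eq using x(2) on_coords_in_cube[OF u x(3)] c m
    by (intro exI[of _ n] exI[of _ c] exI[of _ "on_coords (center (flip e m)) n t"]) fastforce
qed

end

context cubical_setting begin

text \<open>All positive coordinates of \<open>x\<close> are at least some \<open>\<delta> >
  0\<close>. Multiplying by \<open>m / \<delta>\<close>, but not beyond \<open>m\<close>, takes
  those up to \<open>m\<close> to \<open>m\<close>, whereas 0 and the coordinates from
  \<open>m\<close> on do not move. This continuous map agrees with \<open>center m\<close> on the
  coordinates of \<open>x\<close> and fixes those of \<open>z\<close>.\<close>

lemma center_flow:
  assumes m: "0 < m" "m \<le> 1" and x: "below e m x" and z: "above e m z"
  obtains \<gamma> where "\<gamma> \<in> dpaths_from_to (orient e) x (act (center (flip e m)) x)"
    "equivalence_setting.pre_equiv (orient e) F \<gamma> z"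
proof -
  obtain n c t where t: "x = pt n c t" "c \<in> cubes K n" "t \<in> topspace (unit_cube n)"
    "\<And>i. i \<in> {1..n} \<Longrightarrow> flip e (t i) \<le> m \<or> flip e (t i) = 1" using x by (auto simp: below_def)
  obtain n' c' t' where t': "z = pt n' c' t'" "c' \<in> cubes K n'" "t' \<in> topspace (unit_cube n')"
    "\<And>i. i \<in> {1..n'} \<Longrightarrow> flip e (t' i) = 0 \<or> m \<le> flip e (t' i)" using z by (auto simp: above_def)
  define D where "D = insert m {flip e (t i) | i. i \<in> {1..n} \<and> 0 < flip e (t i)}"
  define \<delta> where "\<delta> = Min D"
  have fin: "finite D" by (simp add: D_def)
  have "\<delta> \<in> D" unfolding \<delta>_def by (rule Min_in[OF fin]) (simp add: D_def)
  then have \<delta>: "0 < \<delta>" "\<delta> \<le> m" using m Min_le[OF fin, of m] by (auto simp: D_def \<delta>_def)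
  have ge: "\<delta> \<le> flip e (t i)" if "i \<in> {1..n}" "0 < flip e (t i)" for i
    unfolding \<delta>_def by (rule Min_le[OF fin]) (use that in \<open>auto simp: D_def\<close>)
  define \<phi> where "\<phi> = (\<lambda>\<tau>. max \<tau> (min m (m / \<delta> * \<tau>)))"
  have unit: "unit_map \<phi>"
    unfolding unit_map_def
  proof (intro conjI mono_onI)
    show "\<phi> 0 = 0" "\<phi> 1 = 1" using m by (auto simp: \<phi>_def)
    fix r s :: real assume "r \<le> s"
    moreover then have "m / \<delta> * r \<le> m / \<delta> * s" using m \<delta> by (intro mult_left_mono) auto
    ultimately show "\<phi> r \<le> \<phi> s" unfolding \<phi>_def by (intro max.mono min.mono) auto
  qed
  have big: "\<phi> \<tau> = m" if "\<delta> \<le> \<tau>" "\<tau> \<le> m" for \<tau>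
  proof -
    have "m / \<delta> * \<delta> \<le> m / \<delta> * \<tau>" using that m \<delta> by (intro mult_left_mono) auto
    then have "m \<le> m / \<delta> * \<tau>" using \<delta> by simp
    then show ?thesis using that by (simp add: \<phi>_def)
  qed
  have fixed: "\<phi> \<tau> = \<tau>" if "\<tau> = 0 \<or> m \<le> \<tau>" for \<tau> using that m by (auto simp: \<phi>_def)
  have val: "\<phi> (flip e (t i)) = center m (flip e (t i))" if i: "i \<in> {1..n}" for i
  proof -
    have r: "0 \<le> flip e (t i)" "flip e (t i) \<le> 1" using flip_range[of "t i" e] unit_cube_range[OF t(3) i] by auto
    consider "flip e (t i) = 0" | "0 < flip e (t i)" "flip e (t i) = 1" | "0 < flip e (t i)" "flip e (t i) < 1" using r by linarith
    then show ?thesis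
    proof cases
      case 1 then show ?thesis by (simp add: fixed center_def)
    next
      case 2 then show ?thesis using fixed m by (simp add: center_def)
    next
      case 3 then show ?thesis using big[OF ge[OF i 3(1)]] t(4)[OF i] by (auto simp: center_def)
    qed
  qed
  have idem: "\<phi> (\<phi> (flip e (t i))) = \<phi> (flip e (t i))" if i: "i \<in> {1..n}" for i
    unfolding val[OF i] by (rule fixed) (use m in \<open>auto simp: center_def\<close>)
  have "act (conj e \<phi>) (pt n c t) = act (center (flip e m)) x"
  proof -
    have "conj e \<phi> (t i) = center (flip e m) (t i)" if "i \<in> {1..n}" for i
      using val[OF that] by (simp add: conj_def flip: conj_center)
    then have "on_coords (conj e \<phi>) n t = on_coords (center (flip e m)) n t" by (auto simp: on_coords_def)
    moreover have "unit_map (center (flip e m))" using m flip_range[of m e] by (intro unit_map_center) auto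
    ultimately show ?thesis by (simp add: t(1) act_pt unit_map_conj[OF unit])
  qed
  moreover obtain \<gamma> where "\<gamma> \<in> dpaths_from_to (orient e) (pt n c t) (act (conj e \<phi>) (pt n c t))"
    "equivalence_setting.pre_equiv (orient e) F \<gamma> (pt n' c' t')"
  proof (rule flow_equiv[OF unit _ _ t(2,3) idem t'(2,3)])
    show "continuous_on {0..1} \<phi>" unfolding \<phi>_def by (intro continuous_intros)
    show "\<tau> \<le> \<phi> \<tau>" for \<tau> by (simp add: \<phi>_def)
    show "\<phi> (flip e (t' i)) = flip e (t' i)" if "i \<in> {1..n'}" for i by (rule fixed[OF t'(4)[OF that]])
  qed
  ultimately show thesis using that t(1) t'(1) by simp
qed

text \<open>For \<open>m = 1\<close> every point lies below \<open>m\<close>, so each point flows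
  to the final vertex of its open cube, and every vertex is fixed by that flow.\<close>

lemma corner_system:
  shows "stable_future_component_system F (orient e) (fibres space (act (center (flip e 1))))"
    "future_closed (orient e) (fibres space (act (center (flip e 1))))"
proof -
  interpret Y: equivalence_setting "orient e" F by (rule orient_setting)
  let ?f = "act (center (flip e 1))"
  have u: "unit_map (center (flip e 1))" by (rule unit_map_center) (auto simp: flip_def)
  have "?f (?f x) = ?f x" if "x \<in> Y.space" for x
  proof -
    have "center (flip e 1) \<circ> center (flip e 1) = center (flip e 1)" by (simp add: fun_eq_iff center_idem flip_def)
    then show ?thesis using act_act[OF u u] u that by simp
  qed
  moreover have "Y.le (?f x) (?f y)" if "Y.le x y" for x y by (rule orient_act_mono[OF u that])
  moreover have "\<exists>\<gamma>\<in>Y.paths x (?f x). Y.pre_equiv \<gamma> v" if x: "x \<in> Y.space" and v: "v \<in> Y.space" "?f v = v" for x v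
  proof -
    have "below e 1 x" using below_one x by simp
    moreover have "above e 1 v" using above_center(1)[of 1 v e] v by simp
    ultimately obtain \<gamma> where "\<gamma> \<in> Y.paths x (?f x)" "Y.pre_equiv \<gamma> v"
      by (rule center_flow[rotated 2]) simp_all
    then show ?thesis by blast
  qed
  ultimately show "stable_future_component_system F (orient e) (fibres space ?f)" "future_closed (orient e) (fibres space ?f)"
    using Y.closure_operator_system[of ?f] by simp_all
qed

text \<open>The fibres of this map are the open cubes.\<close>

abbreviation mid :: "'c cube_point set \<Rightarrow> 'c cube_point set" where "mid \<equiv> act (center (1/2))"

lemma mid_center: "0 \<le> m \<Longrightarrow> m \<le> 1 \<Longrightarrow> x \<in> space \<Longrightarrow> act (center m) (mid x) = act (center m) x"
  by (rule act_center_center) auto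

lemma center_cong:
  assumes "0 \<le> m" "m \<le> 1" "x \<in> space" "y \<in> space" "mid x = mid y" shows "act (center m) x = act (center m) y"
  using mid_center[OF assms(1,2,3)] mid_center[OF assms(1,2,4)] assms(5) by simp

lemma center_same_fibre:
  assumes "0 < m" "m < 1" "x \<in> space" shows "mid (act (center m) x) = mid x" "act (center m) x \<in> space"
  using act_center_center[of m "1/2" x] act_space[OF unit_map_center, of m x] assms by auto

text \<open>Both ends of \<open>\<alpha>\<close> flow to the same point \<open>?w\<close> of their
  open cube, and the path space from \<open>x\<close> to \<open>?w\<close> is contractible because
  \<open>?w\<close> is fixed by the flow.\<close>

lemma center_pre:
  assumes m: "0 < m" "m < 1" and xy: "x \<in> space" "y \<in> space" "mid x = mid y"
    and a: "\<alpha> \<in> dpaths_from_to (orient e) x y" and b: "below e m x" "below e m y" and z: "above e m z"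
  shows "equivalence_setting.pre_equiv (orient e) F \<alpha> z"
proof -
  interpret Y: equivalence_setting "orient e" F by (rule orient_setting)
  let ?w = "act (center (flip e m)) x"
  have fm: "0 < flip e m" "flip e m < 1" using m by (auto simp: flip_def)
  have w: "?w = act (center (flip e m)) y" by (rule center_cong) (use fm xy in auto)
  have ab: "above e m ?w" using above_center(1)[of m x e] m xy by simp
  have m': "m \<le> 1" using m by simp
  obtain \<gamma> where g: "\<gamma> \<in> Y.paths y ?w" "Y.pre_equiv \<gamma> z" using center_flow[OF m(1) m' b(2) z] unfolding w[symmetric] .
  obtain \<delta> where d: "\<delta> \<in> Y.paths x ?w" "Y.pre_equiv \<delta> z" using center_flow[OF m(1) m' b(1) z] .
  obtain \<eta> where h: "\<eta> \<in> Y.paths x ?w" "Y.pre_equiv \<eta> ?w" using center_flow[OF m(1) m' b(1) ab] .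
  have "?w \<in> Y.space" using center_same_fibre(2)[OF fm xy(1)] by simp
  then have "F_contractible F (Y.path_space x ?w)"
    using Y.pre_equiv_contractible[OF h] Y.contractible_loops by simp
  from Y.pre_equiv_via[OF a this g d] show ?thesis .
qed

text \<open>Cutting off the coordinates below 1 at \<open>m\<close> fixes the
  \<open>m\<close>-centre of the cube and preserves the order, so the cut-off of \<open>b\<close>
  is still above the centre. It is also coordinatewise below the centre, hence equal to it, and
  then the coordinates agree as well, which means that nonzero coordinates of \<open>b\<close> are
  at least \<open>m\<close>.\<close>

lemma above_if_ge_center:
  assumes m: "0 < m" "m < 1" and b: "b \<in> space" and le: "dle (orient e) (act (center (flip e m)) b) b"
  shows "above e m b"
proof -
  interpret Y: equivalence_setting "orient e" F by (rule orient_setting)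
  obtain n c t where t: "b = pt n c t" "c \<in> cubes K n" "t \<in> topspace (unit_cube n)" using b by (rule spaceE)
  define \<phi> where "\<phi> = (\<lambda>\<tau>::real. if 1 \<le> \<tau> then 1 else min \<tau> m)"
  have "unit_map \<phi>" using m by (auto simp: unit_map_def \<phi>_def intro!: mono_onI)
  then have u: "unit_map (conj e \<phi>)" by (rule unit_map_conj)
  have fm: "0 \<le> flip e m" "flip e m \<le> 1" using m by (auto simp: flip_def)
  have uc: "unit_map (center (flip e m))" using fm by (rule unit_map_center)
  let ?z = "act (center (flip e m)) b"
  let ?u = "on_coords (conj e \<phi>) n t" and ?v = "on_coords (center (flip e m)) n t"
  have "conj e \<phi> \<circ> center (flip e m) = center (flip e m)"
    using m by (auto simp: fun_eq_iff \<phi>_def center_def conj_def flip_def min_def)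
  then have "act (conj e \<phi>) ?z = ?z" using act_act[OF u uc _ b] uc by simp
  then have 1: "Y.le ?z (act (conj e \<phi>) b)" using orient_act_mono[OF u le] by simp
  have uv: "flip e (?u i) \<le> flip e (?v i)" if i: "i \<in> {1..n}" for i
    using i m unit_cube_range[OF t(3) i] by (auto simp: on_coords_def \<phi>_def center_def conj_def flip_def)
  have U: "?u \<in> topspace (unit_cube n)" and V: "?v \<in> topspace (unit_cube n)"
    using on_coords_in_cube[OF u t(3)] on_coords_in_cube[OF uc t(3)] .
  have "Y.le (act (conj e \<phi>) b) ?z" using orient_line[OF t(2) U V uv] by (simp add: t(1) act_pt[OF u] act_pt[OF uc])
  then have "act (conj e \<phi>) b = ?z" using Y.le_antisym 1 by blast
  then have eq: "pt n c ?u = pt n c ?v" by (simp add: t(1) act_pt[OF u] act_pt[OF uc])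
  have "?u = ?v"
  proof (cases e)
    case True
    then show ?thesis using pt_comparable_inj[OF t(2) V U _ eq[symmetric]] uv by (simp add: flip_def)
  next
    case False
    then show ?thesis using pt_comparable_inj[OF t(2) U V _ eq] uv by (simp add: flip_def)
  qed
  have "flip e (t i) = 0 \<or> m \<le> flip e (t i)" if i: "i \<in> {1..n}" for i
  proof -
    have "conj e \<phi> (t i) = conj e (center m) (t i)"
      using fun_cong[OF \<open>?u = ?v\<close>, of i] i by (simp add: on_coords_def conj_center)
    then have "\<phi> (flip e (t i)) = center m (flip e (t i))" unfolding conj_def by (metis flip_flip)
    moreover have "0 \<le> flip e (t i)" using flip_range[of "t i" e] unit_cube_range[OF t(3) i] by auto
    ultimately show ?thesis using m by (auto simp: \<phi>_def center_def min_def split: if_splits)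
  qed
  then show ?thesis using t unfolding above_def by blast
qed

text \<open>Points of the cube of \<open>d\<close> above its \<open>m\<close>-centre have all
  nonzero coordinates at least \<open>m\<close>, so prepending \<open>\<alpha>\<close> is governed
  by the flow up to \<open>m\<close>. Dually, appending \<open>\<beta>\<close> is governed by the
  flow down to \<open>m\<close>, which fixes \<open>x\<close> because the coordinates of
  \<open>x\<close> other than 1 are at most \<open>m\<close>.\<close>

lemma center_St:
  assumes m: "0 < m" "m < 1" and a: "\<alpha> \<in> dpaths_from_to (orient e) x y" "mid x = mid y"
    and b: "below e m x" "below e m y" and d: "d \<in> space"
  shows "act (center (flip e m)) d \<in> St_future F (orient e) \<alpha> {z \<in> space. mid z = mid d}"
proof -
  interpret Y: equivalence_setting "orient e" F by (rule orient_setting)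
  let ?D = "{z \<in> space. mid z = mid d}" and ?z = "act (center (flip e m)) d"
  have fm: "0 < flip e m" "flip e m < 1" using m by (auto simp: flip_def)
  have xy: "x \<in> space" "y \<in> space" using Y.dpaths_from_to_ends[OF a(1)] by simp_all
  have ab: "above e m v" if v: "v \<in> ?D" "Y.le ?z v" for v
  proof (rule above_if_ge_center[OF m])
    show "v \<in> space" using v by simp
    have "act (center (flip e m)) v = ?z" by (rule center_cong) (use fm d v in auto)
    then show "Y.le (act (center (flip e m)) v) v" using v by simp
  qed
  show ?thesis
  proof (rule Y.St_futureI[OF a(1)])
    show "?z \<in> ?D" using center_same_fibre[OF fm d] by simp
    show "Y.pre_equiv \<alpha> v" if v: "v \<in> ?D" "Y.le ?z v" for v
      by (rule center_pre[OF m xy a(2,1) b ab[OF v]])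
    fix v v' \<beta> assume v: "v \<in> ?D" "v' \<in> ?D" "Y.le ?z v" and \<beta>: "\<beta> \<in> Y.paths v v'"
    have "Y.le v v'" using \<beta> by (auto simp: Y.le_iff)
    then have v': "above e m v'" using ab[OF v(2)] Y.le_trans[OF v(3)] by blast
    have op: "opposite (orient e) = orient (\<not> e)" by (simp add: orient_def opposite_opposite)
    have "equivalence_setting.pre_equiv (orient (\<not> e)) F (reverse_path \<beta>) x"
    proof (rule center_pre[of "1 - m"])
      show "reverse_path \<beta> \<in> dpaths_from_to (orient (\<not> e)) v' v" using Y.reverse_in_opposite[OF \<beta>] by (simp add: op)
      show "below (\<not> e) (1 - m) v'" "below (\<not> e) (1 - m) v" using v' ab[OF v(1,3)] by (simp_all add: below_not)
      show "above (\<not> e) (1 - m) x" using b(1) by (simp add: above_not)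
    qed (use m v in auto)
    then show "Y.post_equiv x \<beta>" using Y.opposite_pre_equiv[OF \<beta>, of x] by (simp add: op)
  qed
qed

lemma common_below:
  assumes "x \<in> space" "y \<in> space" obtains m where "0 < m" "m < 1" "below e m x" "below e m y"
proof -
  obtain m1 where m1: "m1 < 1" "below e m1 x" using ex_below[OF assms(1)] .
  obtain m2 where m2: "m2 < 1" "below e m2 y" using ex_below[OF assms(2)] .
  show thesis
    by (rule that[of "max (1/2) (max m1 m2)"])
      (use m1 m2 below_mono[OF m1(2), of "max (1/2) (max m1 m2)"] below_mono[OF m2(2), of "max (1/2) (max m1 m2)"] in auto)
qed

text \<open>The ends of a d-path in an open cube lie below some common \<open>m < 1\<close>. The
  \<open>m\<close>-centres of the cubes are then late enough for stability and triviality.\<close>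

lemma open_cube_system: "stable_future_component_system F (orient e) (fibres space mid)"
proof -
  interpret Y: equivalence_setting "orient e" F by (rule orient_setting)
  have u: "unit_map (center (1/2))" by (rule unit_map_center) auto
  have fibreE: "\<exists>d\<in>space. A = {z \<in> space. mid z = mid d}" if "A \<in> fibres space mid" for A
    using that by (rule fibresE) blast
  have conv: "d_convex (orient e) A" if A: "A \<in> fibres space mid" for A
  proof (rule Y.d_convexI)
    obtain d where d: "A = {z \<in> space. mid z = mid d}" using fibreE[OF A] by blast
    then show "A \<subseteq> Y.space" by auto
    fix x y w assume "x \<in> A" "y \<in> A" and w: "Y.le x w" "Y.le w y"
    then have "Y.le (mid d) (mid w)" "Y.le (mid w) (mid d)"
      using orient_act_mono[OF u w(1)] orient_act_mono[OF u w(2)] d by simp_all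
    then have "mid w = mid d" using Y.le_antisym by blast
    then show "w \<in> A" using Y.le_space(2)[OF w(1)] d by simp
  qed
  have conn: "future_connected (orient e) A" if A: "A \<in> fibres space mid" for A
  proof (rule Y.future_connectedI[OF conv[OF A]])
    obtain d where d: "A = {z \<in> space. mid z = mid d}" using fibreE[OF A] by blast
    fix x y assume "x \<in> A" "y \<in> A"
    then have xy: "x \<in> space" "y \<in> space" "mid x = mid d" "mid y = mid d" using d by auto
    obtain m where m: "0 < m" "m < 1" "below e m x" "below e m y" using common_below[OF xy(1,2)] .
    have fm: "0 < flip e m" "flip e m < 1" using m by (auto simp: flip_def)
    let ?w = "act (center (flip e m)) x"
    have w: "?w = act (center (flip e m)) y" by (rule center_cong) (use fm xy in auto)
    have ab: "above e m ?w" using above_center(1)[of m x e] m xy by simp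
    have m1: "m \<le> 1" using m by simp
    obtain \<gamma> where "\<gamma> \<in> Y.paths x ?w" using center_flow[OF m(1) m1 m(3) ab] .
    moreover obtain \<delta> where "\<delta> \<in> Y.paths y ?w" using center_flow[OF m(1) m1 m(4) ab] unfolding w[symmetric] .
    moreover have "?w \<in> A" using center_same_fibre[OF fm xy(1)] xy(3) d by simp
    ultimately show "\<exists>z\<in>A. Y.le x z \<and> Y.le y z" unfolding Y.le_iff by blast
  qed
  have stab: "future_stable F (orient e) A B" if A: "A \<in> fibres space mid" and B: "B \<in> fibres space mid" for A B
    unfolding future_stable_def
  proof (intro conjI conn A B ballI)
    obtain c where c: "A = {z \<in> space. mid z = mid c}" using fibreE[OF A] by blast
    obtain d where d: "d \<in> space" "B = {z \<in> space. mid z = mid d}" using fibreE[OF B] by blast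
    fix \<alpha> assume "\<alpha> \<in> dpaths_in (orient e) A"
    then have a: "\<alpha> \<in> Y.paths (\<alpha> 0) (\<alpha> 1)" "mid (\<alpha> 0) = mid (\<alpha> 1)" "\<alpha> 0 \<in> space" "\<alpha> 1 \<in> space"
      using c by (auto simp: dpaths_in_def dpaths_from_to_def image_subset_iff)
    obtain m where m: "0 < m" "m < 1" "below e m (\<alpha> 0)" "below e m (\<alpha> 1)" using common_below[OF a(3,4)] .
    from center_St[OF m(1,2) a(1,2) m(3,4) d(1)] show "St_future F (orient e) \<alpha> B \<noteq> {}" unfolding d(2) by blast
  qed
  have triv: "future_trivial F (orient e) A" if A: "A \<in> fibres space mid" for A
  proof -
    obtain d where d: "d \<in> space" "A = {z \<in> space. mid z = mid d}" using fibreE[OF A] by blast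
    obtain m where m: "0 < m" "m < 1" "below e m d" using common_below[OF d(1) d(1)] .
    have m1: "m \<le> 1" using m by simp
    let ?w = "act (center (flip e m)) d"
    have ab: "above e m ?w" using above_center(1)[of m d e] m d by simp
    obtain \<gamma> where g: "\<gamma> \<in> Y.paths d ?w" "Y.pre_equiv \<gamma> ?w" using center_flow[OF m(1) m1 m(3) ab] .
    have "F_contractible F (Y.path_space d ?w)"
      using Y.pre_equiv_contractible[OF g] Y.contractible_loops[OF Y.dpaths_from_to_ends(2)[OF g(1)]] by simp
    moreover have "?w \<in> St_future F (orient e) (const_path d) A"
      unfolding d(2) by (rule center_St[OF m(1,2) Y.dpaths_const _ m(3) m(3) d(1)]) (use d in simp_all)
    then have "Y.path_space d ?w \<in> future_stable_path_spaces F (orient e) A A"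
      unfolding future_stable_path_spaces_def using d by blast
    ultimately show ?thesis
      unfolding future_trivial_def using conn[OF A] stab[OF A A] by blast
  qed
  have "\<Union>(fibres space mid) = Y.space" by (simp add: Union_fibres)
  then show ?thesis
    unfolding stable_future_component_system_def
    by (intro conjI ballI fibres_disjoint conv conn triv stab)
qed

lemma orient_False: "orient False = X" and orient_True: "orient True = opposite X"
  by (simp_all add: orient_def)

text \<open>For \<open>m = 1/2\<close> the same centres serve both directions of time.\<close>

lemma open_cube_total_system: "stable_total_component_system F X (fibres space mid)"
  unfolding stable_total_component_system_def
proof (intro conjI ballI)
  show f: "stable_future_component_system F X (fibres space mid)"
    using open_cube_system[of False] by (simp only: orient_False)
  show p: "stable_past_component_system F X (fibres space mid)"
    using open_cube_system[of True] by (simp only: orient_True opposite_system)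
  fix C D assume C: "C \<in> fibres space mid" and D: "D \<in> fibres space mid"
  obtain c where c: "c \<in> space" "C = {z \<in> space. mid z = mid c}" using C by (rule fibresE)
  obtain d where d: "d \<in> space" "D = {z \<in> space. mid z = mid d}" using D by (rule fibresE)
  let ?a = "mid c" and ?b = "mid d"
  have half: "flip e (1/2) = 1/2" for e by (simp add: flip_def)
  have ab: "?a \<in> space" "mid ?a = mid c" "?b \<in> space" "mid ?b = mid d"
    using center_same_fibre[of "1/2"] c d by simp_all
  have bel: "below e (1/2) ?a" "below e (1/2) ?b" for e
    using above_center(2)[of "1/2" c e] above_center(2)[of "1/2" d e] c d by (simp_all add: half)
  have "?b \<in> St_future F (orient False) (const_path ?a) D"
    using center_St[of "1/2" "const_path ?a" False ?a ?a d] dpaths_const[OF ab(1)] bel d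
    by (simp add: half orient_False)
  then have 1: "?b \<in> St_future F X (const_path ?a) D" by (simp only: orient_False)
  interpret op: equivalence_setting "opposite X" F by (rule opposite_setting)
  have "?a \<in> St_future F (orient True) (const_path ?b) C"
    using center_St[of "1/2" "const_path ?b" True ?b ?b c] op.dpaths_const[of ?b] ab bel c
    by (simp add: half orient_True)
  then have "?a \<in> St_future F (opposite X) (reverse_path (const_path ?b)) C" by (simp add: orient_True)
  then have 2: "?a \<in> St_past F X C (const_path ?b)"
    using opposite_St[of "const_path ?b" C] dpaths_const[OF ab(3)] by (simp add: dpaths_from_to_def)
  have 3: "?a \<in> C" "?b \<in> D" using ab c(2) d(2) by simp_all
  have "future_stable F X C D" "past_stable F X C D"
    using f p C D by (simp_all add: stable_future_component_system_def stable_past_component_system_def)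
  then show "totally_stable F X C D"
    unfolding totally_stable_def using 1 2 3 by blast
qed

lemma realization_coarsest_systems:
  "(\<exists>\<A>. coarsest (stable_total_component_system F X) \<A>) \<and>
    (\<exists>\<A>. coarsest (stable_future_component_system F X) \<A> \<and> future_closed X \<A>) \<and>
    (\<exists>\<A>. coarsest (stable_past_component_system F X) \<A> \<and> past_closed X \<A>)"
proof (intro conjI)
  show "\<exists>\<A>. coarsest (stable_total_component_system F X) \<A>"
    by (rule coarsest_total[OF open_cube_total_system]) (rule finite_fibres_center, simp_all)
  have fin: "finite (fibres space (act (center (flip e 1))))" for e
    by (rule finite_fibres_center) (auto simp: flip_def)
  show "\<exists>\<A>. coarsest (stable_future_component_system F X) \<A> \<and> future_closed X \<A>"
    by (rule coarsest_future_closed[OF corner_system(1)[of False, unfolded orient_False] fin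
          corner_system(2)[of False, unfolded orient_False]])
  let ?\<B> = "fibres space (act (center (flip True 1)))"
  have "past_closed X ?\<B>"
    using corner_system(2)[of True] unfolding orient_True future_closed_def past_closed_def opposite_le .
  moreover have "stable_past_component_system F X ?\<B>"
    using corner_system(1)[of True] unfolding orient_True opposite_system .
  ultimately show "\<exists>\<A>. coarsest (stable_past_component_system F X) \<A> \<and> past_closed X \<A>"
    using coarsest_past_closed fin by blast
qed

end

theorem corollary5p7:
  fixes K :: "'c precubical" and F :: "'u morphism_family"
  assumes "precubical_set K" and "finite_precubical K" and "precubical_no_loops K"
    and "equivalence_system F"
    and universe_large: "\<exists>e :: (real \<Rightarrow> 'c cube_point set) \<Rightarrow> 'u. inj e"
  shows "(\<exists>\<A>. coarsest (stable_total_component_system F (realization K)) \<A>) \<and>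
    (\<exists>\<A>. coarsest (stable_future_component_system F (realization K)) \<A> \<and>
        future_closed (realization K) \<A>) \<and>
    (\<exists>\<A>. coarsest (stable_past_component_system F (realization K)) \<A> \<and>
        past_closed (realization K) \<A>)"
proof -
  interpret cubical_setting K F using assms by unfold_locales
  show ?thesis by (rule realization_coarsest_systems)
qed

end
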